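(* For every $u\in[0,1]$ there exists a Lebesgue measure preserving transformation $T$ with good cyclic approximation whose lower measure-theoretic slow entropy with respect to the polynomial scale $a_n(t)=n^t$ satisfies $\underline{\mathrm{ent}}^{\mu}_{n^t}(T)=u$.
   Context: "Lebesgue measure preserving transformation" means an invertible transformation $T$ of $X$ preserving normalized Lebesgue measure $\mu$; the constructions can be viewed as taking place on $X=\mathbb{T}^2=\mathbb{R}^2/\mathbb{Z}^2$, the disc $\mathbb{D}$, or the annulus $\mathbb{A}=\mathbb{S}^1\times[0,1]$. Good cyclic approximation. A cyclic process of height $q$ on $(X,\mu)$ is a partition $\xi=\{c_1,\dots,c_q\}$ of $X$ into sets of equal measure (a single tower covering $X$) together with a cyclic measure-preserving permutation $\sigma$ with $\sigma(c_i)=c_{i+1}$, $c_{q+1}=c_1$. A sequence $(\xi_n,\sigma_n)$ of cyclic processes is exhaustive if $\xi_n$ converges to the decomposition into points as $n\to\infty$. An exhaustive sequence of cyclic processes, with heights $q_n$, is a cyclic approximation of $T$ if $\sum_{c\in\xi_n}\mu(Tc\,\triangle\,\sigma_nc)\to0$ as $n\to\infty$; it has speed $g(n)$ if $\sum_{c\in\xi_{n_k}}\mu(Tc\,\triangle\,\sigma_{n_k}c)<g(n_k)$ for a certain subsequence $\{n_k\}$. $T$ has a good cyclic approximation if it admits a cyclic approximation with speed $o(1/q_n)$. Slow entropy. For a finite measurable partition $\mathcal{P}=\{P_1,\dots,P_m\}$, the $n$-name of $x$ is $w(x)=(w_k(x))_{k=0}^{n-1}\in\{1,\dots,m\}^n$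 with $T^k(x)\in P_{w_k(x)}$. For words of length $n$, $d_n^H(w,w')=\frac1n\#\{0\le k\le n-1: w_k\ne w'_k\}$ (Hamming metric). Put $B_{\mathcal{P},n}(x,T,\epsilon)=\{y\in X: d_n^H(w(x),w(y))<\epsilon\}$ and let $S_{\mathcal{P}}(T,n,\epsilon)$ be the minimal cardinality of a family of such balls whose union has $\mu$-measure greater than $1-\epsilon$. For a family $\{a_n(t)\}_{n\in\mathbb{N},t>0}$ of positive sequences increasing to infinity and monotone in $t$, let $B(\epsilon,\mathcal{P})=\{t>0:\liminf_{n\to\infty}\frac{S_{\mathcal{P}}(T,n,\epsilon)}{a_n(t)}>0\}$, $A(\epsilon,\mathcal{P})=\sup B(\epsilon,\mathcal{P})$ if this set is nonempty and $A(\epsilon,\mathcal{P})=0$ otherwise. The lower slow entropy is $\underline{\mathrm{ent}}_{a_n(t)}^{\mu}(T)=\sup_{\mathcal{P}}\lim_{\epsilon\to0}A(\epsilon,\mathcal{P})$, the supremum being over finite measurable partitions. *)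

theory Defs
  imports "HOL-Analysis.Analysis" "HOL-Library.Landau_Symbols"
begin

(* The surfaces. Only the measure space matters here, so R/Z is represented by its
   fundamental domain {0..<1}. *)

definition torus :: "(real \<times> real) set" where
  "torus = {0..<1} \<times> {0..<1}"

definition disc :: "(real \<times> real) set" where
  "disc = cball 0 1"

definition annulus :: "(real \<times> real) set" where
  "annulus = {0..<1} \<times> {0..1}"

definition normalized_lebesgue :: "(real \<times> real) set \<Rightarrow> (real \<times> real) measure" where
  "normalized_lebesgue X = restrict_space (uniform_measure lebesgue X) X"

definition invertible_measure_preserving :: "'a measure \<Rightarrow> ('a \<Rightarrow> 'a) \<Rightarrow> bool" where
  "invertible_measure_preserving M T \<longleftrightarrow>
     bij_betw T (space M) (space M) \<and>
     T \<in> measurable M M \<and>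
     the_inv_into (space M) T \<in> measurable M M \<and>
     distr M M T = M"

(* A partition into m measurable sets P 0, ..., P (m - 1). Empty parts are not excluded. *)
definition measurable_partition :: "'a measure \<Rightarrow> nat \<Rightarrow> (nat \<Rightarrow> 'a set) \<Rightarrow> bool" where
  "measurable_partition M m P \<longleftrightarrow>
     (\<forall>i<m. P i \<in> sets M) \<and> disjoint_family_on P {..<m} \<and> (\<Union>i<m. P i) = space M"


subsection \<open>Good cyclic approximation\<close>

(* The permutation of a cyclic process is carried by the enumeration c of the partition:
   it sends c i to c (Suc i mod q). Since all parts have the same measure, it
   preserves measure. *)
definition cyclic_process :: "'a measure \<Rightarrow> nat \<Rightarrow> (nat \<Rightarrow> 'a set) \<Rightarrow> bool" where
  "cyclic_process M q c \<longleftrightarrow>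
     0 < q \<and> measurable_partition M q c \<and>
     (\<forall>i<q. \<forall>j<q. measure M (c i) = measure M (c j))"

(* Convergence of partitions to the decomposition into points: every measurable set is
   approximated in measure by unions of elements of the n-th partition. *)
definition exhaustive :: "'a measure \<Rightarrow> (nat \<Rightarrow> nat) \<Rightarrow> (nat \<Rightarrow> nat \<Rightarrow> 'a set) \<Rightarrow> bool" where
  "exhaustive M q c \<longleftrightarrow>
     (\<forall>A\<in>sets M. \<exists>J. (\<forall>n. J n \<subseteq> {..<q n}) \<and>
        (\<lambda>n. measure M (sym_diff A (\<Union>i\<in>J n. c n i))) \<longlonglongrightarrow> 0)"

definition cyclic_error :: "'a measure \<Rightarrow> ('a \<Rightarrow> 'a) \<Rightarrow> nat \<Rightarrow> (nat \<Rightarrow> 'a set) \<Rightarrow> real" where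
  "cyclic_error M T q c = (\<Sum>i<q. measure M (sym_diff (T ` c i) (c (Suc i mod q))))"

definition cyclic_approximation ::
  "'a measure \<Rightarrow> ('a \<Rightarrow> 'a) \<Rightarrow> (nat \<Rightarrow> nat) \<Rightarrow> (nat \<Rightarrow> nat \<Rightarrow> 'a set) \<Rightarrow> bool" where
  "cyclic_approximation M T q c \<longleftrightarrow>
     (\<forall>n. cyclic_process M (q n) (c n)) \<and> exhaustive M q c \<and>
     (\<lambda>n. cyclic_error M T (q n) (c n)) \<longlonglongrightarrow> 0"

definition has_speed ::
  "'a measure \<Rightarrow> ('a \<Rightarrow> 'a) \<Rightarrow> (nat \<Rightarrow> nat) \<Rightarrow> (nat \<Rightarrow> nat \<Rightarrow> 'a set) \<Rightarrow> (nat \<Rightarrow> real) \<Rightarrow> bool" where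
  "has_speed M T q c g \<longleftrightarrow>
     (\<exists>r :: nat \<Rightarrow> nat. strict_mono r \<and> (\<forall>k. cyclic_error M T (q (r k)) (c (r k)) < g (r k)))"

definition good_cyclic_approximation :: "'a measure \<Rightarrow> ('a \<Rightarrow> 'a) \<Rightarrow> bool" where
  "good_cyclic_approximation M T \<longleftrightarrow>
     (\<exists>q c g. cyclic_approximation M T q c \<and> g \<in> o(\<lambda>n. 1 / real (q n)) \<and> has_speed M T q c g)"


subsection \<open>Lower slow entropy\<close>

definition name :: "nat \<Rightarrow> (nat \<Rightarrow> 'a set) \<Rightarrow> ('a \<Rightarrow> 'a) \<Rightarrow> 'a \<Rightarrow> nat \<Rightarrow> nat" where
  "name m P T x k = (THE i. i < m \<and> (T ^^ k) x \<in> P i)"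

definition hamming_dist :: "nat \<Rightarrow> (nat \<Rightarrow> nat) \<Rightarrow> (nat \<Rightarrow> nat) \<Rightarrow> real" where
  "hamming_dist n w w' = real (card {k. k < n \<and> w k \<noteq> w' k}) / real n"

definition hamming_ball ::
  "'a measure \<Rightarrow> nat \<Rightarrow> (nat \<Rightarrow> 'a set) \<Rightarrow> ('a \<Rightarrow> 'a) \<Rightarrow> nat \<Rightarrow> real \<Rightarrow> 'a \<Rightarrow> 'a set" where
  "hamming_ball M m P T n \<epsilon> x =
     {y \<in> space M. hamming_dist n (name m P T x) (name m P T y) < \<epsilon>}"

definition covering_number ::
  "'a measure \<Rightarrow> nat \<Rightarrow> (nat \<Rightarrow> 'a set) \<Rightarrow> ('a \<Rightarrow> 'a) \<Rightarrow> nat \<Rightarrow> real \<Rightarrow> nat" where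
  "covering_number M m P T n \<epsilon> =
     Inf {card F | F. finite F \<and> F \<subseteq> hamming_ball M m P T n \<epsilon> ` space M \<and>
                      measure M (\<Union>F) > 1 - \<epsilon>}"

definition growth_set ::
  "'a measure \<Rightarrow> (nat \<Rightarrow> real \<Rightarrow> real) \<Rightarrow> ('a \<Rightarrow> 'a) \<Rightarrow> nat \<Rightarrow> (nat \<Rightarrow> 'a set) \<Rightarrow> real \<Rightarrow> real set" where
  "growth_set M a T m P \<epsilon> =
     {t. t > 0 \<and> liminf (\<lambda>n. ereal (real (covering_number M m P T n \<epsilon>) / a n t)) > 0}"

definition growth_exponent ::
  "'a measure \<Rightarrow> (nat \<Rightarrow> real \<Rightarrow> real) \<Rightarrow> ('a \<Rightarrow> 'a) \<Rightarrow> nat \<Rightarrow> (nat \<Rightarrow> 'a set) \<Rightarrow> real \<Rightarrow> ereal" where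
  "growth_exponent M a T m P \<epsilon> =
     (if growth_set M a T m P \<epsilon> = {} then 0 else Sup (ereal ` growth_set M a T m P \<epsilon>))"

(* The exponent is monotone in \<epsilon>, so the one-sided limit exists in the extended reals. *)
definition lower_slow_entropy ::
  "'a measure \<Rightarrow> (nat \<Rightarrow> real \<Rightarrow> real) \<Rightarrow> ('a \<Rightarrow> 'a) \<Rightarrow> ereal" where
  "lower_slow_entropy M a T =
     (SUP (m, P) \<in> {(m, P). measurable_partition M m P}.
        Lim (at_right 0) (growth_exponent M a T m P))"

end

theory Submission
  imports Defs "HOL-Probability.Probability_Measure" "HOL-Number_Theory.Cong" "HOL-Real_Asymp.Real_Asymp"
begin

text \<open>
  The transformation is a skew shift \<open>T (x, y) = (x + \<alpha>, y + f x)\<close> of the torus over a Liouville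
  rotation, where \<open>f = \<beta> + (\<Sum>k. g k (x + \<alpha>) - g k x)\<close> and \<open>g k x = A k * bump (q k * x)\<close> for a
  1-periodic, piecewise quadratic function \<open>bump\<close>. With \<open>s k\<close> the distance of \<open>q k * \<alpha>\<close> to the
  integers, the parameters are tuned such that \<open>A k * s k\<close> is about \<open>1 / N k\<close>.

  Up to times of order \<open>N k\<close>, the functions \<open>g j\<close> with \<open>j \<ge> k\<close> are invisible, and \<open>T\<close> is conjugate
  by \<open>g 0 + \<dots> + g (k - 1)\<close> to a translation of the torus by a rational vector, which permutes
  \<open>q k * r k\<close> small parallelograms cyclically. This gives the cyclic approximation and the upper
  bound: there are at most \<open>q k * r k\<close> names of length about \<open>N k\<close>.

  Conversely, let the displacement of two points be of the right order for level \<open>k\<close>. The difference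
  of their second coordinates is affine in time while neither orbit wraps around, because \<open>bump\<close> is
  quadratic; it equidistributes as soon as it has moved by one unit, and then the names of the two
  points with respect to eight horizontal strips differ with positive frequency. Using this at two
  consecutive levels bounds the Hamming balls and yields at least \<open>A k * max 1 (n / N (k + 1))\<close> names
  of length \<open>n\<close>, up to a constant. Choosing \<open>A k\<close> much larger than \<open>q k\<close> makes \<open>q (k + 1)\<close> comparable
  to \<open>A k\<close>, and \<open>N k\<close> of order \<open>q k\<close> to the power \<open>1 / u\<close> gives the exponent \<open>u\<close>.

  Finally the torus is identified with the disc and the annulus almost everywhere.
\<close>

subsection \<open>Covering numbers and slow entropy\<close>

text \<open>The lower slow entropy is a lower limit in \<open>n\<close>: the upper bound may be
  tested along one sequence of times, while the lower bound must hold at every large time. The weak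
  spot of the latter is \<open>n = N (k + 1)\<close>, just before level \<open>k + 1\<close> starts
  to separate points: only about \<open>A k\<close> names are available there, although the time is
  already of order \<open>q (k + 1)\<close> to the power \<open>1 / u\<close>. Since
  \<open>q (k + 1) = q k * A k * N k\<close>, the amplitude has to beat every fixed power of
  \<open>q k\<close>; this forces the growing exponent in \<open>amplitude\<close>. The factor
  \<open>r k\<close> is slack that tends to infinity slowly. It makes the cells thin in the vertical
  direction, makes the escape from the tower small against the inverse height, and disappears in the
  exponents. The drift \<open>\<beta>\<close> makes the rational model a single cycle: translating
  by \<open>p k / q k\<close> in the first coordinate alone would leave \<open>r k\<close> separate
  cycles of length \<open>q k\<close>. For \<open>u = 0\<close> there is no exponent
  \<open>1 / u\<close>. It is replaced by exponents tending to infinity, and the lower bound is then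
  just nonnegativity.\<close>

lemma hamming_dist_triangle:
  "hamming_dist n v w \<le> hamming_dist n u v + hamming_dist n u w"
proof -
  have "card {k. k < n \<and> v k \<noteq> w k} \<le> card ({k. k < n \<and> u k \<noteq> v k} \<union> {k. k < n \<and> u k \<noteq> w k})"
    by (rule card_mono) auto
  also have "\<dots> \<le> card {k. k < n \<and> u k \<noteq> v k} + card {k. k < n \<and> u k \<noteq> w k}"
    by (rule card_Un_le)
  finally show ?thesis
    unfolding hamming_dist_def add_divide_distrib[symmetric] by (intro divide_right_mono) auto
qed

lemma hamming_dist_cong:
  assumes "\<And>k. k < n \<Longrightarrow> v k = v' k" "\<And>k. k < n \<Longrightarrow> w k = w' k"
  shows "hamming_dist n v w = hamming_dist n v' w'"
  unfolding hamming_dist_def using assms by (metis (mono_tags, lifting))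

lemma hamming_dist_refl [simp]: "hamming_dist n w w = 0"
  by (simp add: hamming_dist_def)

locale partitioned_system = prob_space M for M :: "'a measure" +
  fixes T :: "'a \<Rightarrow> 'a" and m :: nat and P :: "nat \<Rightarrow> 'a set"
  assumes T_meas [measurable]: "T \<in> M \<rightarrow>\<^sub>M M"
    and part: "measurable_partition M m P"
begin

lemma P_sets [measurable]: "i < m \<Longrightarrow> P i \<in> sets M"
  using part by (auto simp: measurable_partition_def)

lemma funpow_space: "x \<in> space M \<Longrightarrow> (T ^^ k) x \<in> space M"
  using measurable_compose_n[OF T_meas, of k] measurable_space by metis

lemma name_unique:
  assumes "i < m" "(T ^^ k) x \<in> P i"
  shows "name m P T x k = i"
  unfolding name_def
proof (rule the_equality)
  fix j assume j: "j < m \<and> (T ^^ k) x \<in> P j"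
  then show "j = i"
    using part assms unfolding measurable_partition_def disjoint_family_on_def
    by (metis disjoint_iff lessThan_iff)
qed (use assms in auto)

lemma name_props:
  assumes "x \<in> space M"
  shows name_less: "name m P T x k < m" and name_in: "(T ^^ k) x \<in> P (name m P T x k)"
proof -
  have "(T ^^ k) x \<in> (\<Union>i<m. P i)"
    using funpow_space[OF assms, of k] part by (simp add: measurable_partition_def)
  then obtain i where i: "i < m" "(T ^^ k) x \<in> P i" by auto
  then have "name m P T x k = i" by (rule name_unique)
  with i show "name m P T x k < m" "(T ^^ k) x \<in> P (name m P T x k)" by auto
qed

lemma name_eq_iff: "x \<in> space M \<Longrightarrow> i < m \<Longrightarrow> name m P T x k = i \<longleftrightarrow> (T ^^ k) x \<in> P i"
  using name_unique name_in by metis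

lemma measurable_name [measurable]: "(\<lambda>x. name m P T x k) \<in> M \<rightarrow>\<^sub>M count_space UNIV"
proof -
  have [measurable]: "T ^^ k \<in> M \<rightarrow>\<^sub>M M" by (rule measurable_compose_n) (rule T_meas)
  have "(\<lambda>x. name m P T x k) -` {i} \<inter> space M \<in> sets M" for i
  proof (cases "i < m")
    case True
    have "(\<lambda>x. name m P T x k) -` {i} \<inter> space M = (T ^^ k) -` P i \<inter> space M"
      using name_eq_iff[OF _ True] by auto
    then show ?thesis using True by simp
  next
    case False
    then have "(\<lambda>x. name m P T x k) -` {i} \<inter> space M = {}" using name_less by auto
    then show ?thesis by simp
  qed
  then show ?thesis by (subst measurable_count_space_eq2_countable) auto
qed

lemma measurable_hamming_dist [measurable]:
  "(\<lambda>y. hamming_dist n w (name m P T y)) \<in> borel_measurable M"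
proof -
  have "hamming_dist n w (name m P T y) = (\<Sum>k<n. if w k \<noteq> name m P T y k then 1 else 0) / n" for y
  proof -
    have "{k. k < n \<and> w k \<noteq> name m P T y k} = {k \<in> {..<n}. w k \<noteq> name m P T y k}" by auto
    then show ?thesis unfolding hamming_dist_def by (simp add: sum.If_cases Int_def)
  qed
  then show ?thesis by simp
qed

lemma sets_hamming_ball [measurable]: "hamming_ball M m P T n \<epsilon> x \<in> sets M"
  unfolding hamming_ball_def by measurable

text \<open>A ball depends on its centre only through the first \<open>n\<close> letters of the name
  of the centre, and there are finitely many such words.\<close>

lemma finite_hamming_balls: "finite (hamming_ball M m P T n \<epsilon> ` space M)"
proof -
  let ?W = "(\<lambda>x. restrict (name m P T x) {..<n}) ` space M"
  have "?W \<subseteq> {..<n} \<rightarrow>\<^sub>E {..<m}" by (simp add: image_subset_iff restrict_PiE_iff name_less)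
  then have "finite ?W" by (rule finite_subset) (simp add: finite_PiE)
  moreover have "hamming_ball M m P T n \<epsilon> x =
      {y \<in> space M. hamming_dist n (restrict (name m P T x) {..<n}) (name m P T y) < \<epsilon>}" for x
  proof -
    have "hamming_dist n (name m P T x) v = hamming_dist n (restrict (name m P T x) {..<n}) v" for v
      by (rule hamming_dist_cong) auto
    then show ?thesis by (simp add: hamming_ball_def)
  qed
  then have "hamming_ball M m P T n \<epsilon> ` space M =
      (\<lambda>w. {y \<in> space M. hamming_dist n w (name m P T y) < \<epsilon>}) ` ?W"
    by (auto simp: image_image)
  ultimately show ?thesis by simp
qed

abbreviation ball where "ball \<equiv> hamming_ball M m P T"
abbreviation cov where "cov \<equiv> covering_number M m P T"

text \<open>Every point lies in its own ball, so the family of all balls is admissible. The infimum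
  thus runs over a nonempty set of naturals and is a minimum.\<close>

lemma covering_number_attained:
  assumes "\<epsilon> > 0"
  obtains F where "finite F" "F \<subseteq> ball n \<epsilon> ` space M" "measure M (\<Union>F) > 1 - \<epsilon>"
    "card F = cov n \<epsilon>"
proof -
  let ?K = "{card F | F. finite F \<and> F \<subseteq> ball n \<epsilon> ` space M \<and> measure M (\<Union>F) > 1 - \<epsilon>}"
  have "\<Union> (ball n \<epsilon> ` space M) = space M"
    using assms by (auto simp: hamming_ball_def)
  then have "card (ball n \<epsilon> ` space M) \<in> ?K"
    using finite_hamming_balls[of n \<epsilon>] assms prob_space by auto
  then have "Inf ?K \<in> ?K" by (intro Inf_nat_def1) auto
  then show thesis using that unfolding covering_number_def by auto
qed

lemma covering_number_le:
  assumes "finite F" "F \<subseteq> ball n \<epsilon> ` space M" "measure M (\<Union>F) > 1 - \<epsilon>"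
  shows "cov n \<epsilon> \<le> card F"
  unfolding covering_number_def by (rule cInf_lower) (use assms in auto)

text \<open>The centres of an optimal family are kept and the radius is enlarged. One centre is
  chosen per ball, so the number of centres is the old cardinality; balls that coincide after the
  enlargement only lower the new one.\<close>

lemma covering_number_antimono:
  assumes "0 < \<epsilon>" "\<epsilon> \<le> \<epsilon>'"
  shows "cov n \<epsilon>' \<le> cov n \<epsilon>"
proof -
  obtain F where F: "finite F" "F \<subseteq> ball n \<epsilon> ` space M" "measure M (\<Union>F) > 1 - \<epsilon>"
    "card F = cov n \<epsilon>"
    using covering_number_attained[OF assms(1)] .
  then obtain C where C: "C \<subseteq> space M" "F = ball n \<epsilon> ` C" "inj_on (ball n \<epsilon>) C"
    by (meson subset_image_inj)
  have "finite C" using C F by (simp add: finite_image_iff)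
  let ?F = "ball n \<epsilon>' ` C"
  have "ball n \<epsilon> x \<subseteq> ball n \<epsilon>' x" for x
    using assms by (auto simp: hamming_ball_def)
  then have "\<Union>F \<subseteq> \<Union>?F" unfolding C(2) by blast
  then have "measure M (\<Union>F) \<le> measure M (\<Union>?F)"
    using \<open>finite C\<close> by (intro finite_measure_mono) auto
  then have "cov n \<epsilon>' \<le> card ?F"
    using F(3) assms C(1) \<open>finite C\<close> by (intro covering_number_le) auto
  also have "\<dots> \<le> card C" by (rule card_image_le) fact
  also have "\<dots> = card F" using C by (simp add: card_image)
  finally show ?thesis using F by simp
qed

lemma growth_exponent_nonneg: "growth_exponent M a T m P \<epsilon> \<ge> 0"
proof (cases "growth_set M a T m P \<epsilon> = {}")
  case False
  then obtain t where "t \<in> growth_set M a T m P \<epsilon>" by auto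
  then have "0 \<le> ereal t" "ereal t \<le> Sup (ereal ` growth_set M a T m P \<epsilon>)"
    by (auto simp: growth_set_def intro: Sup_upper)
  then have "0 \<le> Sup (ereal ` growth_set M a T m P \<epsilon>)" by (rule order_trans)
  then show ?thesis unfolding growth_exponent_def if_not_P[OF False] .
qed (simp add: growth_exponent_def)

lemma growth_exponent_antimono:
  assumes "\<And>n t. a n t \<ge> 0" "0 < \<epsilon>" "\<epsilon> \<le> \<epsilon>'"
  shows "growth_exponent M a T m P \<epsilon>' \<le> growth_exponent M a T m P \<epsilon>"
proof -
  have "growth_set M a T m P \<epsilon>' \<subseteq> growth_set M a T m P \<epsilon>"
  proof
    fix t assume "t \<in> growth_set M a T m P \<epsilon>'"
    then have t: "t > 0" "liminf (\<lambda>n. ereal (real (cov n \<epsilon>') / a n t)) > 0"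
      by (auto simp: growth_set_def)
    have "liminf (\<lambda>n. ereal (real (cov n \<epsilon>') / a n t))
        \<le> liminf (\<lambda>n. ereal (real (cov n \<epsilon>) / a n t))"
      using covering_number_antimono[OF assms(2,3)] assms(1)
      by (intro Liminf_mono always_eventually) (auto intro!: divide_right_mono)
    with t show "t \<in> growth_set M a T m P \<epsilon>" by (auto simp: growth_set_def)
  qed
  then have "growth_set M a T m P \<epsilon>' \<noteq> {} \<Longrightarrow> ?thesis"
    by (auto simp: growth_exponent_def intro!: Sup_subset_mono)
  moreover have "growth_set M a T m P \<epsilon>' = {} \<Longrightarrow> ?thesis"
    using growth_exponent_nonneg[of a \<epsilon>] by (simp add: growth_exponent_def)
  ultimately show ?thesis by blast
qed

text \<open>Monotonicity in \<open>\<epsilon>\<close> turns the one-sided limit into a supremum. As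
  \<open>Lim\<close> is a definite description, convergence has to be known before the value of the
  limit can be used.\<close>

lemma tendsto_growth_exponent:
  assumes "\<And>n t. a n t \<ge> 0"
  shows "(growth_exponent M a T m P \<longlongrightarrow> (SUP \<epsilon>\<in>{0<..}. growth_exponent M a T m P \<epsilon>)) (at_right 0)"
proof (rule order_tendstoI)
  let ?g = "growth_exponent M a T m P"
  fix c assume "c < (SUP \<epsilon>\<in>{0<..}. ?g \<epsilon>)"
  then obtain \<epsilon> where e: "\<epsilon> > 0" "c < ?g \<epsilon>" by (auto simp: less_SUP_iff)
  have "eventually (\<lambda>x. x \<in> {0<..<\<epsilon>}) (at_right 0)" by (rule eventually_at_right_real) fact
  then show "eventually (\<lambda>x. c < ?g x) (at_right 0)"
    by eventually_elim (use e growth_exponent_antimono[OF assms] in \<open>fastforce intro: less_le_trans\<close>)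
next
  let ?g = "growth_exponent M a T m P"
  fix c assume c: "(SUP \<epsilon>\<in>{0<..}. ?g \<epsilon>) < c"
  have "eventually (\<lambda>x::real. x \<in> {0<..<1}) (at_right 0)" by (rule eventually_at_right_real) simp
  then show "eventually (\<lambda>x. ?g x < c) (at_right 0)"
    by eventually_elim (use c in \<open>auto intro: le_less_trans[OF SUP_upper]\<close>)
qed

lemma Lim_growth_exponent:
  assumes "\<And>n t. a n t \<ge> 0"
  shows "Lim (at_right 0) (growth_exponent M a T m P) = (SUP \<epsilon>\<in>{0<..}. growth_exponent M a T m P \<epsilon>)"
  using tendsto_Lim[OF trivial_limit_at_right_real tendsto_growth_exponent[OF assms]] .

text \<open>A volume argument: two points of one \<open>\<epsilon>\<close>-ball have names closer
  than \<open>2 * \<epsilon>\<close>, so the part of the ball in \<open>Y\<close> lies in a set of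
  measure at most \<open>b\<close>, and mass \<open>1 - \<epsilon>\<close> takes at least
  \<open>(1 - \<epsilon>) / b\<close> of these. The set \<open>Y\<close> of full measure allows the
  names to be analysed only where the orbits are under control.\<close>

lemma le_covering_number:
  assumes "\<epsilon> > 0" "b > 0" "Y \<in> sets M" "measure M Y = 1"
    and ball: "\<And>y. y \<in> Y \<Longrightarrow> \<exists>B\<in>sets M. measure M B \<le> b \<and>
      {y' \<in> Y. hamming_dist n (name m P T y) (name m P T y') < 2 * \<epsilon>} \<subseteq> B"
  shows "(1 - \<epsilon>) / b \<le> cov n \<epsilon>"
proof -
  obtain F where F: "finite F" "F \<subseteq> ball n \<epsilon> ` space M" "measure M (\<Union>F) > 1 - \<epsilon>"
    "card F = cov n \<epsilon>"
    using covering_number_attained[OF assms(1)] .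
  have F_sets: "A \<in> sets M" if "A \<in> F" for A using that F by auto
  have small: "measure M A \<le> b" if "A \<in> F" for A
  proof -
    obtain x where x: "A = ball n \<epsilon> x" using \<open>A \<in> F\<close> F(2) by blast
    have AE: "measure M A = measure M (A \<inter> Y)"
    proof -
      have "AE y in M. y \<in> Y" using assms by (simp add: prob_eq_1)
      then show ?thesis using assms F_sets[OF that] by (intro measure_eq_AE) auto
    qed
    show ?thesis
    proof (cases "A \<inter> Y = {}")
      case False
      then obtain y where y: "y \<in> A" "y \<in> Y" by auto
      obtain B where B: "B \<in> sets M" "measure M B \<le> b"
        "{y' \<in> Y. hamming_dist n (name m P T y) (name m P T y') < 2 * \<epsilon>} \<subseteq> B"
        using ball[OF y(2)] by auto
      have "A \<inter> Y \<subseteq> B"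
      proof
        fix y' assume y': "y' \<in> A \<inter> Y"
        then have "hamming_dist n (name m P T y) (name m P T y') < 2 * \<epsilon>"
          using y hamming_dist_triangle[of n "name m P T y" "name m P T y'" "name m P T x"]
          unfolding x hamming_ball_def by auto
        with y' B show "y' \<in> B" by auto
      qed
      with B AE show ?thesis by (metis finite_measure_mono order_trans)
    qed (use AE assms in simp)
  qed
  have "1 - \<epsilon> \<le> measure M (\<Union>F)" using F by simp
  also have "\<dots> \<le> (\<Sum>A\<in>F. measure M A)"
    using finite_measure_subadditive_finite[of F "\<lambda>A. A"] F F_sets by auto
  also have "\<dots> \<le> real (card F) * b" using sum_bounded_above[of F "measure M" b] small by simp
  finally show ?thesis using F assms by (simp add: field_simps)
qed

lemma le_growth_exponent:
  assumes "\<And>t. 0 < t \<Longrightarrow> t < u \<Longrightarrow>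
    \<exists>c>0. eventually (\<lambda>n. c * real n powr t \<le> cov n \<epsilon>) sequentially"
  shows "ereal u \<le> growth_exponent M (\<lambda>n t. real n powr t) T m P \<epsilon>"
proof (cases "u \<le> 0")
  case True
  then have "ereal u \<le> 0" by simp
  then show ?thesis using growth_exponent_nonneg by (rule order_trans)
next
  case False
  let ?G = "growth_set M (\<lambda>n t. real n powr t) T m P \<epsilon>"
  have G: "t \<in> ?G" if t: "0 < t" "t < u" for t
  proof -
    obtain c where c: "c > 0"
      "eventually (\<lambda>n. c * real n powr t \<le> cov n \<epsilon>) sequentially"
      using assms[OF t] by auto
    have "eventually (\<lambda>n. ereal c \<le> ereal (cov n \<epsilon> / real n powr t)) sequentially"
      using c(2) eventually_gt_at_top[of 0] by eventually_elim (simp add: field_simps)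
    then have "ereal c \<le> liminf (\<lambda>n. ereal (cov n \<epsilon> / real n powr t))"
      by (rule Liminf_bounded)
    then have "0 < liminf (\<lambda>n. ereal (cov n \<epsilon> / real n powr t))"
      using c(1) by (metis ereal_less(2) less_le_trans)
    then show ?thesis using t by (simp add: growth_set_def)
  qed
  have "ereal u \<le> Sup (ereal ` ?G)"
  proof (rule dense_le)
    fix y assume "y < ereal u"
    then have "max y 0 < ereal u" using False by auto
    then obtain t where t: "max y 0 < ereal t" "ereal t < ereal u"
      using ereal_dense2 by blast
    then have "ereal t \<in> ereal ` ?G" using G by auto
    then have "ereal t \<le> Sup (ereal ` ?G)" by (rule Sup_upper)
    with t show "y \<le> Sup (ereal ` ?G)" by (auto intro: order_trans less_imp_le)
  qed
  moreover have "u / 2 \<in> ?G" using G[of "u / 2"] False by auto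
  ultimately show ?thesis by (auto simp: growth_exponent_def)
qed

lemma le_lower_slow_entropy:
  assumes "\<epsilon> > 0" "\<And>t. 0 < t \<Longrightarrow> t < u \<Longrightarrow>
    \<exists>c>0. eventually (\<lambda>n. c * real n powr t \<le> cov n \<epsilon>) sequentially"
  shows "ereal u \<le> lower_slow_entropy M (\<lambda>n t. real n powr t) T"
proof -
  let ?a = "\<lambda>n t. real n powr t"
  have "ereal u \<le> growth_exponent M ?a T m P \<epsilon>" by (rule le_growth_exponent) (rule assms(2))
  also have "\<dots> \<le> (SUP \<epsilon>\<in>{0<..}. growth_exponent M ?a T m P \<epsilon>)" using assms(1) by (intro SUP_upper) auto
  also have "\<dots> = Lim (at_right 0) (growth_exponent M ?a T m P)"
    by (rule Lim_growth_exponent[symmetric]) simp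
  also have "\<dots> \<le> lower_slow_entropy M ?a T"
    unfolding lower_slow_entropy_def using part by (intro SUP_upper2[where i="(m, P)"]) auto
  finally show ?thesis .
qed

text \<open>Along an almost periodic orbit segment the name is determined by the starting column, up to
  the visits to the set where the partition differs from its approximation by columns.\<close>

lemma covering_number_le_height:
  assumes q: "0 < q" and c: "measurable_partition M q c" and \<epsilon>: "\<epsilon> > 0" and n: "n > 0"
    and T_pres: "\<And>A. A \<in> sets M \<Longrightarrow> measure M (T -` A \<inter> space M) = measure M A"
    and J: "\<And>l. l < m \<Longrightarrow> J l \<subseteq> {..<q}"
    and small: "n * (\<Sum>i<q. measure M {x \<in> c i. T x \<notin> c (Suc i mod q)})
      + 2 / \<epsilon> * (\<Sum>l<m. measure M (sym_diff (P l) (\<Union>i\<in>J l. c i))) < \<epsilon>"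
  shows "cov n \<epsilon> \<le> q"
proof -
  have c_sets [measurable]: "c i \<in> sets M" if "i < q" for i
    using c that by (auto simp: measurable_partition_def)
  have c_disj: "i = j" if "x \<in> c i" "x \<in> c j" "i < q" "j < q" for x i j
    using c that unfolding measurable_partition_def disjoint_family_on_def
    by (metis disjoint_iff lessThan_iff)
  have c_cover: "\<exists>i<q. x \<in> c i" if "x \<in> space M" for x
    using c that unfolding measurable_partition_def by auto
  have pow_meas [measurable]: "T ^^ k \<in> M \<rightarrow>\<^sub>M M" for k by (rule measurable_compose_n) (rule T_meas)
  have pow_pres: "measure M ((T ^^ k) -` A \<inter> space M) = measure M A" if "A \<in> sets M" for A k
    using that
  proof (induction k arbitrary: A)
    case 0
    then show ?case using sets.sets_into_space by (simp add: Int_absorb2)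
  next
    case (Suc k)
    have "(T ^^ Suc k) -` A \<inter> space M = (T ^^ k) -` (T -` A \<inter> space M) \<inter> space M"
      using funpow_space by auto
    then show ?case using Suc T_pres[OF Suc.prems] by (metis T_meas measurable_sets)
  qed
  define D where "D = (\<Union>i<q. {x \<in> c i. T x \<notin> c (Suc i mod q)})"
  define E where "E = (\<Union>l<m. sym_diff (P l) (\<Union>i\<in>J l. c i))"
  have c_T [measurable]: "{x \<in> c i. T x \<notin> c (Suc i mod q)} \<in> sets M" if "i < q" for i
  proof -
    have "{x \<in> c i. T x \<notin> c (Suc i mod q)} = c i - (T -` c (Suc i mod q) \<inter> space M)"
      using sets.sets_into_space[OF c_sets[OF that]] by auto
    then show ?thesis using that q by simp
  qed
  have D_sets [measurable]: "D \<in> sets M" unfolding D_def using c_T by auto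
  have J_sets [measurable]: "(\<Union>i\<in>J l. c i) \<in> sets M" if "l < m" for l
    using J[OF that] c_sets by (intro sets.countable_UN') (auto simp: countable_finite finite_subset)
  have E_sets [measurable]: "E \<in> sets M" unfolding E_def by (intro sets.finite_UN) auto
  have D_le: "measure M D \<le> (\<Sum>i<q. measure M {x \<in> c i. T x \<notin> c (Suc i mod q)})"
    unfolding D_def using c_T by (intro finite_measure_subadditive_finite) auto
  have E_le: "measure M E \<le> (\<Sum>l<m. measure M (sym_diff (P l) (\<Union>i\<in>J l. c i)))"
    unfolding E_def by (intro finite_measure_subadditive_finite) auto
  \<comment> \<open>\<open>D'\<close> is the set of starting points that break the cyclic column
    order within \<open>n\<close> steps; \<open>V\<close> is the set of those that spend at least
    the fraction \<open>\<epsilon> / 2\<close> of the time in \<open>E\<close>, where a column does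
    not tell the letter.\<close>
  define D' where "D' = (\<Union>k<n. (T ^^ k) -` D \<inter> space M)"
  define v where "v x = (\<Sum>k<n. indicat_real E ((T ^^ k) x))" for x
  define V where "V = {x \<in> space M. v x \<ge> n * (\<epsilon> / 2)}"
  have [measurable]: "D' \<in> sets M" "v \<in> borel_measurable M" unfolding D'_def v_def by measurable
  have [measurable]: "V \<in> sets M" unfolding V_def by measurable
  have "measure M D' \<le> (\<Sum>k<n. measure M ((T ^^ k) -` D \<inter> space M))"
    unfolding D'_def by (intro finite_measure_subadditive_finite) auto
  then have D'_le: "measure M D' \<le> n * measure M D" using pow_pres[OF D_sets] by simp
  have ind_int: "integrable M (\<lambda>x. indicat_real E ((T ^^ k) x))"
    "(LINT x|M. indicat_real E ((T ^^ k) x)) = measure M E" for k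
  proof -
    have ind: "AE x in M. indicat_real E ((T ^^ k) x) = indicat_real ((T ^^ k) -` E \<inter> space M) x"
      by (auto simp: indicator_def)
    have "integrable M (indicat_real ((T ^^ k) -` E \<inter> space M))" by (simp add: emeasure_eq_measure)
    then show "integrable M (\<lambda>x. indicat_real E ((T ^^ k) x))"
      by (subst integrable_cong_AE[OF _ _ ind]) auto
    show "(LINT x|M. indicat_real E ((T ^^ k) x)) = measure M E"
      by (subst integral_cong_AE[OF _ _ ind]) (use pow_pres[OF E_sets] in \<open>auto simp: Int_absorb1 Int_assoc\<close>)
  qed
  have v_int: "integrable M v" "(LINT x|M. v x) = n * measure M E"
    unfolding v_def using ind_int by auto
  \<comment> \<open>Markov's inequality: by invariance the mean number of visits to \<open>E\<close>
    is \<open>n * measure M E\<close>.\<close>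
  have V_le: "measure M V \<le> 2 / \<epsilon> * measure M E"
  proof -
    have "measure M V \<le> (LINT x|M. v x) / (n * (\<epsilon> / 2))"
      unfolding V_def using v_int(1) n \<epsilon>
      by (intro integral_Markov_inequality_measure[where A="{}"]) (auto intro!: sum_nonneg simp: v_def[abs_def])
    then show ?thesis using v_int n \<epsilon> by (simp add: field_simps)
  qed
  define G where "G = space M - D' - V"
  have [measurable]: "G \<in> sets M" unfolding G_def by measurable
  have follow: "(T ^^ k) x \<in> c ((i + k) mod q)" if "x \<in> G" "x \<in> c i" "i < q" "k < n" for x i k
    using that(4)
  proof (induction k)
    case (Suc k)
    have "(T ^^ k) x \<notin> D"
      using that(1) Suc.prems funpow_space[of x k] unfolding G_def D'_def by auto
    moreover have "(T ^^ k) x \<in> c ((i + k) mod q)" using Suc by simp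
    ultimately have "T ((T ^^ k) x) \<in> c (Suc ((i + k) mod q) mod q)"
      unfolding D_def using q by auto
    then show ?case by (simp add: mod_Suc_eq)
  qed (use that in auto)
  \<comment> \<open>Centres are chosen inside \<open>G\<close>, not merely in the column, so that
    the centre of a ball obeys the same bound on the visits to \<open>E\<close> as the points it has
    to cover.\<close>
  define I where "I = {i. i < q \<and> c i \<inter> G \<noteq> {}}"
  define z where "z i = (SOME x. x \<in> c i \<inter> G)" for i
  have z: "z i \<in> c i \<inter> G" if "i \<in> I" for i
    using that unfolding I_def z_def by (simp only: some_in_eq) simp
  let ?F = "(\<lambda>i. ball n \<epsilon> (z i)) ` I"
  have "finite I" "card I \<le> q" unfolding I_def using card_mono[of "{..<q}" "{i. i < q \<and> c i \<inter> G \<noteq> {}}"] by auto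
  have "G \<subseteq> \<Union>?F"
  proof
    fix x assume x: "x \<in> G"
    then have xs: "x \<in> space M" by (auto simp: G_def)
    then obtain i where i: "i < q" "x \<in> c i" using c_cover by auto
    then have "i \<in> I" using x by (auto simp: I_def)
    note zi = z[OF this]
    then have zs: "z i \<in> space M" by (auto simp: G_def)
    have same: "name m P T (z i) k = name m P T x k"
      if k: "k < n" and nE: "(T ^^ k) x \<notin> E" "(T ^^ k) (z i) \<notin> E" for k
    proof -
      define l where "l = name m P T x k"
      have l: "l < m" "(T ^^ k) x \<in> P l" unfolding l_def using name_props[OF xs] by auto
      have a: "(T ^^ k) x \<in> c ((i + k) mod q)" "(T ^^ k) (z i) \<in> c ((i + k) mod q)"
        using follow x zi i k by auto
      have "(T ^^ k) x \<in> (\<Union>i\<in>J l. c i)" using l nE(1) unfolding E_def by auto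
      then obtain j where j: "j \<in> J l" "(T ^^ k) x \<in> c j" by auto
      then have "j = (i + k) mod q" using c_disj[OF j(2) a(1)] J[OF l(1)] q by auto
      then have "(T ^^ k) (z i) \<in> (\<Union>i\<in>J l. c i)" using a j by auto
      then have "(T ^^ k) (z i) \<in> P l" using l nE(2) unfolding E_def by auto
      then show ?thesis using name_unique[OF l(1)] by (simp add: l_def)
    qed
    have v_card: "v y = card {k. k < n \<and> (T ^^ k) y \<in> E}" for y
    proof -
      have "{k. k < n \<and> (T ^^ k) y \<in> E} = {..<n} \<inter> {k. (T ^^ k) y \<in> E}" by auto
      then show ?thesis unfolding v_def by (simp add: indicator_def sum.If_cases)
    qed
    \<comment> \<open>Two orbits that start in the same column stay together, so their letters
      differ only while one of them is in \<open>E\<close>; two fractions below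
      \<open>\<epsilon> / 2\<close> add up to less than \<open>\<epsilon>\<close>.\<close>
    have "card {k. k < n \<and> name m P T (z i) k \<noteq> name m P T x k}
        \<le> card ({k. k < n \<and> (T ^^ k) (z i) \<in> E} \<union> {k. k < n \<and> (T ^^ k) x \<in> E})"
      by (rule card_mono) (use same in auto)
    also have "\<dots> \<le> card {k. k < n \<and> (T ^^ k) (z i) \<in> E} + card {k. k < n \<and> (T ^^ k) x \<in> E}"
      by (rule card_Un_le)
    finally have "card {k. k < n \<and> name m P T (z i) k \<noteq> name m P T x k} \<le> v (z i) + v x"
      unfolding v_card by linarith
    also have "\<dots> < n * \<epsilon>" using x zi xs zs unfolding G_def V_def by auto
    finally have "hamming_dist n (name m P T (z i)) (name m P T x) < \<epsilon>"
      using n by (simp add: hamming_dist_def field_simps)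
    then show "x \<in> \<Union>?F" using \<open>i \<in> I\<close> xs by (auto simp: hamming_ball_def)
  qed
  then have "measure M G \<le> measure M (\<Union>?F)"
    using \<open>finite I\<close> by (intro finite_measure_mono) auto
  moreover have "measure M G \<ge> 1 - measure M D' - measure M V"
  proof -
    have "measure M (space M - (D' \<union> V)) = 1 - measure M (D' \<union> V)" by (simp add: prob_compl)
    moreover have "measure M (D' \<union> V) \<le> measure M D' + measure M V" by (rule measure_Un_le) auto
    moreover have "G = space M - (D' \<union> V)" by (auto simp: G_def)
    ultimately show ?thesis by simp
  qed
  moreover have "measure M D' + measure M V < \<epsilon>"
  proof -
    have "measure M D' \<le> n * (\<Sum>i<q. measure M {x \<in> c i. T x \<notin> c (Suc i mod q)})"
      using D'_le D_le by (meson mult_left_mono of_nat_0_le_iff order_trans)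
    moreover have "measure M V \<le> 2 / \<epsilon> * (\<Sum>l<m. measure M (sym_diff (P l) (\<Union>i\<in>J l. c i)))"
      using V_le E_le \<epsilon> by (meson divide_nonneg_pos less_eq_real_def mult_left_mono order_trans zero_le_numeral)
    ultimately show ?thesis using small by linarith
  qed
  ultimately have "cov n \<epsilon> \<le> card ?F"
    using \<open>finite I\<close> z by (intro covering_number_le) (auto simp: G_def)
  also have "\<dots> \<le> q" using card_image_le[OF \<open>finite I\<close>] \<open>card I \<le> q\<close> le_trans by blast
  finally show ?thesis .
qed

end

text \<open>A positive lower limit over all times gives a positive lower bound along the times
  \<open>\<tau> k\<close>, where the covering number is at most \<open>q k\<close>. One sequence of
  times short enough for the tower to remain accurate therefore bounds the entropy from
  above.\<close>

lemma (in prob_space) lower_slow_entropy_le: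
  assumes T [measurable]: "T \<in> M \<rightarrow>\<^sub>M M"
    and T_pres: "\<And>A. A \<in> sets M \<Longrightarrow> measure M (T -` A \<inter> space M) = measure M A"
    and q: "\<And>k. 0 < q k" and c: "\<And>k. measurable_partition M (q k) (c k)" and ex: "exhaustive M q c"
    and \<tau>: "filterlim \<tau> at_top sequentially"
    and err: "(\<lambda>k. real (\<tau> k) * (\<Sum>i<q k. measure M {x \<in> c k i. T x \<notin> c k (Suc i mod q k)})) \<longlonglongrightarrow> 0"
    and u: "u \<ge> 0" and growth: "\<And>t. t > u \<Longrightarrow> (\<lambda>k. real (q k) / real (\<tau> k) powr t) \<longlonglongrightarrow> 0"
  shows "lower_slow_entropy M (\<lambda>n t. real n powr t) T \<le> ereal u"
  unfolding lower_slow_entropy_def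
proof (rule SUP_least, clarsimp)
  let ?a = "\<lambda>n t. real n powr t"
  fix m P assume P: "measurable_partition M m P"
  interpret partitioned_system M T m P by unfold_locales (use P in auto)
  have "growth_exponent M ?a T m P \<epsilon> \<le> u" if \<epsilon>: "\<epsilon> > 0" for \<epsilon>
  proof -
    have "\<forall>l\<in>{..<m}. \<exists>J. (\<forall>k. J k \<subseteq> {..<q k}) \<and>
        (\<lambda>k. measure M (sym_diff (P l) (\<Union>i\<in>J k. c k i))) \<longlonglongrightarrow> 0"
      using ex P_sets unfolding exhaustive_def by blast
    from bchoice[OF this] obtain J where J: "\<And>l k. l < m \<Longrightarrow> J l k \<subseteq> {..<q k}"
      "\<And>l. l < m \<Longrightarrow> (\<lambda>k. measure M (sym_diff (P l) (\<Union>i\<in>J l k. c k i))) \<longlonglongrightarrow> 0"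
      by blast
    have "(\<lambda>k. real (\<tau> k) * (\<Sum>i<q k. measure M {x \<in> c k i. T x \<notin> c k (Suc i mod q k)})
      + 2 / \<epsilon> * (\<Sum>l<m. measure M (sym_diff (P l) (\<Union>i\<in>J l k. c k i)))) \<longlonglongrightarrow> 0 + 2 / \<epsilon> * (\<Sum>l<m. 0)"
      using err J(2) by (intro tendsto_add tendsto_mult tendsto_sum tendsto_const) auto
    then have "eventually (\<lambda>k. real (\<tau> k) * (\<Sum>i<q k. measure M {x \<in> c k i. T x \<notin> c k (Suc i mod q k)})
      + 2 / \<epsilon> * (\<Sum>l<m. measure M (sym_diff (P l) (\<Union>i\<in>J l k. c k i))) < \<epsilon>) sequentially"
      using \<epsilon> by (intro order_tendstoD(2)) auto
    moreover have "eventually (\<lambda>k. \<tau> k \<ge> 1) sequentially"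
      using \<tau> unfolding filterlim_at_top by simp
    ultimately have cov: "eventually (\<lambda>k. covering_number M m P T (\<tau> k) \<epsilon> \<le> q k) sequentially"
    proof eventually_elim
      case (elim k)
      then show ?case using q c \<epsilon> J(1) T_pres by (intro covering_number_le_height[where c="c k" and J="\<lambda>l. J l k"]) auto
    qed
    have "t \<le> u" if "t \<in> growth_set M ?a T m P \<epsilon>" for t
    proof (rule ccontr)
      assume "\<not> t \<le> u"
      then have lim: "(\<lambda>k. real (q k) / real (\<tau> k) powr t) \<longlonglongrightarrow> 0" using growth by auto
      have "0 < liminf (\<lambda>n. ereal (covering_number M m P T n \<epsilon> / real n powr t))"
        using that by (auto simp: growth_set_def)
      then obtain y where y: "0 < y" "y < liminf (\<lambda>n. ereal (covering_number M m P T n \<epsilon> / real n powr t))"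
        using dense by blast
      then have "eventually (\<lambda>n. y < ereal (covering_number M m P T n \<epsilon> / real n powr t)) sequentially"
        using less_LiminfD by blast
      then have "eventually (\<lambda>k. y < ereal (covering_number M m P T (\<tau> k) \<epsilon> / real (\<tau> k) powr t)) sequentially"
        using \<tau> by (rule eventually_compose_filterlim)
      with cov have ev: "eventually (\<lambda>k. y \<le> ereal (real (q k) / real (\<tau> k) powr t)) sequentially"
      proof eventually_elim
        case (elim k)
        have "covering_number M m P T (\<tau> k) \<epsilon> / real (\<tau> k) powr t \<le> real (q k) / real (\<tau> k) powr t"
          using elim by (intro divide_right_mono) auto
        then show ?case using elim by (metis ereal_less_eq(3) less_imp_le order_trans)
      qed
      have "y \<le> ereal 0"
        by (rule tendsto_lowerbound[OF _ ev]) (use lim in \<open>auto simp: zero_ereal_def\<close>)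
      with y show False by (simp add: zero_ereal_def)
    qed
    then show ?thesis using u by (auto simp: growth_exponent_def intro!: Sup_least)
  qed
  then show "Lim (at_right 0) (growth_exponent M ?a T m P) \<le> ereal u"
    by (subst Lim_growth_exponent) (auto intro!: SUP_least)
qed

text \<open>The image of a column and the next column have equal measure, so the two halves of their
  symmetric difference do too. The error is then twice the mass that leaves the cyclic order in one
  step, a quantity that involves no images.\<close>

lemma cyclic_error_eq:
  assumes "prob_space M" and imp: "invertible_measure_preserving M T" and c: "cyclic_process M q c"
  shows "cyclic_error M T q c = 2 * (\<Sum>i<q. measure M {x \<in> c i. T x \<notin> c (Suc i mod q)})"
proof -
  interpret prob_space M by fact
  have bij: "bij_betw T (space M) (space M)" and T [measurable]: "T \<in> M \<rightarrow>\<^sub>M M"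
    and T': "the_inv_into (space M) T \<in> M \<rightarrow>\<^sub>M M" and distr: "distr M M T = M"
    using imp by (auto simp: invertible_measure_preserving_def)
  have inj: "inj_on T (space M)" using bij by (rule bij_betw_imp_inj_on)
  have image: "T ` A \<in> sets M" "measure M (T ` A) = measure M A" if A: "A \<in> sets M" for A
  proof -
    have sub: "A \<subseteq> space M" using A by (rule sets.sets_into_space)
    have "T ` A = the_inv_into (space M) T -` A \<inter> space M"
    proof (intro subset_antisym subsetI)
      fix y assume "y \<in> T ` A"
      then obtain x where x: "x \<in> A" "y = T x" by blast
      then have "the_inv_into (space M) T y = x" using the_inv_into_f_f[OF inj] sub by blast
      moreover have "y \<in> space M" using x sub measurable_space[OF T] by blast
      ultimately show "y \<in> the_inv_into (space M) T -` A \<inter> space M" using x by simp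
    next
      fix y assume "y \<in> the_inv_into (space M) T -` A \<inter> space M"
      then show "y \<in> T ` A" using f_the_inv_into_f_bij_betw[OF bij, of y] by (metis IntE imageI vimageE)
    qed
    then show TA: "T ` A \<in> sets M" using T' A by simp
    have "measure M (T ` A) = measure (distr M M T) (T ` A)" by (simp add: distr)
    also have "\<dots> = measure M (T -` (T ` A) \<inter> space M)" using TA by (intro measure_distr) auto
    also have "T -` (T ` A) \<inter> space M = A" using sub inj by (auto dest: inj_onD)
    finally show "measure M (T ` A) = measure M A" .
  qed
  have "measure M (sym_diff (T ` c i) (c (Suc i mod q))) = 2 * measure M {x \<in> c i. T x \<notin> c (Suc i mod q)}"
    if i: "i < q" for i
  proof -
    let ?A = "c i" and ?B = "c (Suc i mod q)"
    have A: "?A \<in> sets M" and B: "?B \<in> sets M" and eq: "measure M ?A = measure M ?B"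
      using c i mod_less_divisor[of q "Suc i"] unfolding cyclic_process_def measurable_partition_def
      by blast+
    have TA: "T ` ?A \<in> sets M" using A by (rule image)
    have "?A \<subseteq> space M" using A by (rule sets.sets_into_space)
    then have "{x \<in> ?A. T x \<notin> ?B} = ?A - (T -` ?B \<inter> space M)" by auto
    then have D: "{x \<in> ?A. T x \<notin> ?B} \<in> sets M" using A B by simp
    have "T ` ?A - ?B = T ` {x \<in> ?A. T x \<notin> ?B}" by auto
    then have 1: "measure M (T ` ?A - ?B) = measure M {x \<in> ?A. T x \<notin> ?B}" using image[OF D] by simp
    have "measure M (T ` ?A - ?B) = measure M (T ` ?A) - measure M (T ` ?A \<inter> ?B)"
      using TA B by (rule finite_measure_Diff')
    moreover have "measure M (?B - T ` ?A) = measure M ?B - measure M (?B \<inter> T ` ?A)"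
      using B TA by (rule finite_measure_Diff')
    ultimately have 2: "measure M (?B - T ` ?A) = measure M (T ` ?A - ?B)"
      using image(2)[OF A] eq by (simp add: Int_commute)
    have "measure M (sym_diff (T ` ?A) ?B) = measure M (T ` ?A - ?B) + measure M (?B - T ` ?A)"
      using TA B by (intro finite_measure_Union) auto
    with 1 2 show ?thesis by simp
  qed
  then show ?thesis unfolding cyclic_error_def sum_distrib_left by (intro sum.cong) auto
qed

subsection \<open>Skew shifts of the torus\<close>

lemma borel_measurable_frac [measurable]: "(frac :: real \<Rightarrow> real) \<in> borel_measurable borel"
  unfolding frac_def[abs_def] by measurable

text \<open>The rotation by \<open>d = frac c\<close> is a translation by \<open>d\<close> before
  the wrap and by \<open>d - 1\<close> after it; the two images are the parts of \<open>C\<close> in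
  \<open>{d..<1}\<close> and \<open>{0..<d}\<close>.\<close>

lemma emeasure_frac_shift:
  fixes c :: real
  assumes C [measurable]: "C \<in> sets borel"
  shows "emeasure lborel {y \<in> {0..<1}. frac (y + c) \<in> C} = emeasure lborel (C \<inter> {0..<1})"
proof -
  define d where "d = frac c"
  have d: "0 \<le> d" "d < 1" by (auto simp: d_def frac_lt_1)
  have tr: "emeasure lborel {y. y + e \<in> S} = emeasure lborel S" if [measurable]: "S \<in> sets borel" for S and e :: real
  proof -
    have "emeasure lborel S = emeasure (distr lborel borel (\<lambda>y. e + y)) S" by (simp add: lborel_distr_plus)
    also have "\<dots> = emeasure lborel {y. y + e \<in> S}"
      by (subst emeasure_distr) (auto simp: vimage_def add.commute)
    finally show ?thesis by simp
  qed
  have fr: "frac (y + c) = frac (y + d)" for y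
    unfolding d_def by simp
  have fr1: "frac (y + d) = (if y + d < 1 then y + d else y + d - 1)" if "y \<in> {0..<1}" for y
    using that d by (simp add: frac_add frac_eq_id)
  have split: "{y \<in> {0..<1}. frac (y + c) \<in> C} =
      {y. y + d \<in> C \<inter> {d..<1}} \<union> {y. y + (d - 1) \<in> C \<inter> {0..<d}}"
    using d by (auto simp: fr fr1 algebra_simps split: if_splits)
  have "emeasure lborel ({y. y + d \<in> C \<inter> {d..<1}} \<union> {y. y + (d - 1) \<in> C \<inter> {0..<d}}) =
      emeasure lborel {y. y + d \<in> C \<inter> {d..<1}} + emeasure lborel {y. y + (d - 1) \<in> C \<inter> {0..<d}}"
    using d by (intro plus_emeasure[symmetric]) auto
  also have "\<dots> = emeasure lborel (C \<inter> {d..<1}) + emeasure lborel (C \<inter> {0..<d})"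
    by (subst (1 2) tr) auto
  also have "\<dots> = emeasure lborel (C \<inter> {d..<1} \<union> C \<inter> {0..<d})"
    by (rule plus_emeasure) auto
  also have "C \<inter> {d..<1} \<union> C \<inter> {0..<d} = C \<inter> {0..<1}" using d by auto
  finally show ?thesis unfolding split .
qed

lemma nn_integral_frac_shift:
  fixes c :: real
  assumes h [measurable]: "h \<in> borel_measurable borel"
  shows "(\<integral>\<^sup>+x. h (frac (x + c)) * indicator {0..<1} x \<partial>lborel) = (\<integral>\<^sup>+x. h x * indicator {0..<1} x \<partial>lborel)"
proof -
  let ?I = "restrict_space lborel {0..<1::real}"
  have [measurable]: "(\<lambda>x. frac (x + c)) \<in> ?I \<rightarrow>\<^sub>M ?I"
    by (intro measurable_restrict_space3) (auto simp: frac_lt_1)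
  have distr: "distr ?I ?I (\<lambda>x. frac (x + c)) = ?I"
  proof (rule measure_eqI)
    fix A assume "A \<in> sets (distr ?I ?I (\<lambda>x. frac (x + c)))"
    then have A: "A \<in> sets ?I" by simp
    then have [measurable]: "A \<in> sets borel" "A \<subseteq> {0..<1}" by (auto simp: sets_restrict_space_iff)
    have "emeasure (distr ?I ?I (\<lambda>x. frac (x + c))) A = emeasure ?I {y \<in> {0..<1}. frac (y + c) \<in> A}"
      using A by (subst emeasure_distr) (auto simp: vimage_def Int_def conj_commute)
    also have "\<dots> = emeasure lborel {y \<in> {0..<1}. frac (y + c) \<in> A}"
      by (subst emeasure_restrict_space) auto
    also have "\<dots> = emeasure ?I A"
      using \<open>A \<subseteq> {0..<1}\<close> emeasure_frac_shift[of A c] by (simp add: emeasure_restrict_space Int_absorb2)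
    finally show "emeasure (distr ?I ?I (\<lambda>x. frac (x + c))) A = emeasure ?I A" .
  qed simp
  have "(\<integral>\<^sup>+x. h x \<partial>?I) = (\<integral>\<^sup>+x. h x \<partial>distr ?I ?I (\<lambda>x. frac (x + c)))" by (simp only: distr)
  also have "\<dots> = (\<integral>\<^sup>+x. h (frac (x + c)) \<partial>?I)"
    by (rule nn_integral_distr) (auto intro!: measurable_restrict_space1)
  finally show ?thesis by (simp add: nn_integral_restrict_space)
qed

definition skew :: "real \<Rightarrow> (real \<Rightarrow> real) \<Rightarrow> real \<times> real \<Rightarrow> real \<times> real" where
  "skew a g w = (frac (fst w + a), frac (snd w + g (fst w)))"

lemma skew_in_torus [simp]: "skew a g w \<in> torus"
  by (simp add: skew_def torus_def frac_lt_1)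

lemma measurable_skew [measurable]:
  assumes [measurable]: "g \<in> borel_measurable borel"
  shows "skew a g \<in> borel \<rightarrow>\<^sub>M borel"
  unfolding skew_def[abs_def] borel_prod[symmetric] by measurable

lemma sets_torus [measurable, simp]: "torus \<in> sets borel"
  unfolding torus_def borel_prod[symmetric] by measurable

lemma emeasure_lborel_pair:
  fixes S :: "(real \<times> real) set"
  assumes "S \<in> sets borel"
  shows "emeasure lborel S = (\<integral>\<^sup>+x. emeasure lborel {y. (x, y) \<in> S} \<partial>lborel)"
    and "(\<lambda>x. emeasure lborel {y. (x, y) \<in> S}) \<in> borel_measurable borel"
proof -
  have S: "S \<in> sets (lborel \<Otimes>\<^sub>M lborel)" using assms unfolding lborel_prod by simp
  have "emeasure lborel S = emeasure (lborel \<Otimes>\<^sub>M lborel) S" by (simp add: lborel_prod)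
  also have "\<dots> = (\<integral>\<^sup>+x. emeasure lborel (Pair x -` S) \<partial>lborel)"
    by (rule lborel.emeasure_pair_measure_alt) fact
  finally show "emeasure lborel S = (\<integral>\<^sup>+x. emeasure lborel {y. (x, y) \<in> S} \<partial>lborel)"
    by (simp add: vimage_def)
  show "(\<lambda>x. emeasure lborel {y. (x, y) \<in> S}) \<in> borel_measurable borel"
    using lborel.measurable_emeasure_Pair[OF S] by (simp add: vimage_def)
qed

lemma emeasure_lborel_Times:
  "A \<in> sets borel \<Longrightarrow> B \<in> sets borel \<Longrightarrow>
    emeasure lborel (A \<times> B :: (real \<times> real) set) = emeasure lborel A * emeasure lborel B"
  using lborel.emeasure_pair_measure_Times[of A lborel B] by (simp add: lborel_prod)

lemma emeasure_torus [simp]: "emeasure lborel torus = 1"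
  unfolding torus_def by (subst emeasure_lborel_Times) auto

text \<open>Fubini: each vertical fibre is rotated by a constant, which preserves the measure of its
  section, and the base is rotated by \<open>a\<close>.\<close>

lemma emeasure_skew:
  assumes g [measurable]: "g \<in> borel_measurable borel" and B [measurable]: "B \<in> sets borel"
  shows "emeasure lborel {w \<in> torus. skew a g w \<in> B} = emeasure lborel (B \<inter> torus)"
proof -
  define h where "h x = emeasure lborel {y. (x, y) \<in> B \<inter> torus}" for x
  have h_meas [measurable]: "h \<in> borel_measurable borel"
    unfolding h_def by (rule emeasure_lborel_pair) auto
  have sec: "emeasure lborel {y. (x, y) \<in> {w \<in> torus. skew a g w \<in> B}} = h (frac (x + a)) * indicator {0..<1} x" for x
  proof (cases "x \<in> {0..<1}")
    case True
    have "{y. (frac (x + a), y) \<in> B} \<in> sets borel"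
    proof -
      have "(\<lambda>y. (frac (x + a), y)) \<in> borel \<rightarrow>\<^sub>M (borel :: (real \<times> real) measure)"
        unfolding borel_prod[symmetric] by measurable
      from measurable_sets[OF this B] show ?thesis by (simp add: vimage_def)
    qed
    note this[measurable]
    have "{y. (x, y) \<in> {w \<in> torus. skew a g w \<in> B}} =
        {y \<in> {0..<1}. frac (y + g x) \<in> {y. (frac (x + a), y) \<in> B}}"
      using True by (auto simp: torus_def skew_def)
    then have "emeasure lborel {y. (x, y) \<in> {w \<in> torus. skew a g w \<in> B}} =
        emeasure lborel ({y. (frac (x + a), y) \<in> B} \<inter> {0..<1})"
      by (simp only:) (rule emeasure_frac_shift, measurable)
    also have "{y. (frac (x + a), y) \<in> B} \<inter> {0..<1} = {y. (frac (x + a), y) \<in> B \<inter> torus}"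
      by (auto simp: torus_def frac_lt_1)
    finally show ?thesis using True by (simp add: h_def)
  next
    case False
    then have "{y. (x, y) \<in> {w \<in> torus. skew a g w \<in> B}} = {}" by (auto simp: torus_def)
    with False show ?thesis by (simp only: emeasure_empty) simp
  qed
  have h0: "h x = h x * indicator {0..<1} x" for x
    by (auto simp: h_def torus_def indicator_def)
  have "{w \<in> torus. skew a g w \<in> B} = torus \<inter> (skew a g -` B \<inter> space borel)" by auto
  then have "{w \<in> torus. skew a g w \<in> B} \<in> sets borel" by simp
  then have "emeasure lborel {w \<in> torus. skew a g w \<in> B} =
      (\<integral>\<^sup>+x. h (frac (x + a)) * indicator {0..<1} x \<partial>lborel)"
    by (simp only: emeasure_lborel_pair(1) sec)
  also have "\<dots> = (\<integral>\<^sup>+x. h x * indicator {0..<1} x \<partial>lborel)"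
    by (rule nn_integral_frac_shift) simp
  also have "\<dots> = (\<integral>\<^sup>+x. h x \<partial>lborel)" by (simp only: h0[symmetric])
  also have "\<dots> = emeasure lborel (B \<inter> torus)"
    unfolding h_def by (rule emeasure_lborel_pair(1)[symmetric]) auto
  finally show ?thesis .
qed

lemma skew_inverse:
  assumes "w \<in> torus"
  shows "skew (- a) (\<lambda>x. - g (frac (x - a))) (skew a g w) = w"
    and "skew a g (skew (- a) (\<lambda>x. - g (frac (x - a))) w) = w"
proof -
  have "frac (frac x - y) = frac (x - y)" for x y :: real
    using frac_add_simps(1)[of x "- y"] by simp
  then show "skew (- a) (\<lambda>x. - g (frac (x - a))) (skew a g w) = w"
    and "skew a g (skew (- a) (\<lambda>x. - g (frac (x - a))) w) = w"
    using assms by (auto simp: skew_def torus_def prod_eq_iff frac_eq)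
qed

subsection \<open>The transformation of the torus\<close>

text \<open>Comparison with a geometric series. The tail of such a series is determined by its first
  term up to a factor 2, which yields the estimates for \<open>s k\<close>, for
  \<open>\<beta>\<close> and for the tails over \<open>N\<close>.\<close>

lemma halving_tail:
  fixes a :: "nat \<Rightarrow> real"
  assumes "\<And>k. 0 \<le> a k" "\<And>k. 2 * a (Suc k) \<le> a k"
  shows "summable a" "(\<Sum>n. a (n + k)) \<le> 2 * a k" "a k \<le> (\<Sum>n. a (n + k))"
proof -
  have le: "a (n + k) \<le> a k * (1/2) ^ n" for n k
  proof (induction n)
    case (Suc n)
    then show ?case using assms(2)[of "n + k"] by simp
  qed simp
  show sum: "summable a"
    by (rule summable_comparison_test[where g="\<lambda>n. a 0 * (1/2) ^ n"])
      (use le[of _ 0] assms(1) in \<open>auto intro!: summable_mult summable_geometric exI[of _ 0]\<close>)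
  then have sum': "summable (\<lambda>n. a (n + k))" by (rule summable_ignore_initial_segment)
  have "(\<Sum>n. a (n + k)) \<le> (\<Sum>n. a k * (1/2) ^ n)"
    using le sum' by (intro suminf_le summable_mult summable_geometric) auto
  also have "\<dots> = 2 * a k" by (subst suminf_mult) (auto simp: suminf_geometric)
  finally show "(\<Sum>n. a (n + k)) \<le> 2 * a k" .
  show "a k \<le> (\<Sum>n. a (n + k))"
    using sum_le_suminf[OF sum', of "{0}"] assms(1) by simp
qed

text \<open>One parabola on each period, vanishing at the integers and hence continuous there.
  Within a period the second derivative is constant.\<close>

definition bump :: "real \<Rightarrow> real" where
  "bump z = frac z * (1 - frac z)"

lemma bump_add_int [simp]: "bump (z + of_int i) = bump z"
  by (simp add: bump_def)

lemma bump_frac_mult [simp]: "bump (real n * frac x + c) = bump (real n * x + c)"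
proof -
  have "real n * frac x + c = (real n * x + c) + of_int (- (int n * \<lfloor>x\<rfloor>))"
    by (simp add: frac_def algebra_simps)
  then show ?thesis by (simp only: bump_add_int)
qed

lemma borel_measurable_bump [measurable]: "bump \<in> borel_measurable borel"
  unfolding bump_def[abs_def] by measurable

text \<open>Within one period the difference quotient is \<open>1 - frac z - frac z'\<close>. Across
  one integer both values are bounded by the distance to it; with more than one integer in between
  the distance exceeds 1, while the values lie in \<open>{0..1/4}\<close>.\<close>

lemma bump_lipschitz: "\<bar>bump z - bump z'\<bar> \<le> \<bar>z - z'\<bar>"
proof -
  have bounds: "0 \<le> bump z" "bump z \<le> 1 / 4" "bump z \<le> frac z" "bump z \<le> 1 - frac z" for z
  proof -
    have f: "0 \<le> frac z" "frac z \<le> 1" using frac_lt_1[of z] by (auto intro: less_imp_le)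
    show "0 \<le> bump z" unfolding bump_def using f by simp
    have "0 \<le> (frac z - 1/2)\<^sup>2" by simp
    then show "bump z \<le> 1/4" by (simp add: bump_def power2_eq_square algebra_simps)
    show "bump z \<le> frac z" "bump z \<le> 1 - frac z"
      unfolding bump_def using f mult_left_mono[of "1 - frac z" 1 "frac z"] mult_right_mono[of "frac z" 1 "1 - frac z"] by auto
  qed
  have "\<bar>bump z - bump z'\<bar> \<le> z' - z" if "z \<le> z'" for z z' :: real
  proof -
    have mono: "\<lfloor>z\<rfloor> \<le> \<lfloor>z'\<rfloor>" using that by (rule floor_mono)
    have z: "z = of_int \<lfloor>z\<rfloor> + frac z" "z' = of_int \<lfloor>z'\<rfloor> + frac z'" by (auto simp: frac_def)
    consider "\<lfloor>z'\<rfloor> = \<lfloor>z\<rfloor>" | "\<lfloor>z'\<rfloor> = \<lfloor>z\<rfloor> + 1" | "\<lfloor>z'\<rfloor> \<ge> \<lfloor>z\<rfloor> + 2" using mono by linarith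
    then show ?thesis
    proof cases
      case 1
      have "bump z - bump z' = (frac z - frac z') * (1 - frac z - frac z')"
        by (simp add: bump_def algebra_simps)
      moreover have "\<bar>1 - frac z - frac z'\<bar> \<le> 1"
        using frac_ge_0[of z] frac_ge_0[of z'] frac_lt_1[of z] frac_lt_1[of z'] by linarith
      ultimately have "\<bar>bump z - bump z'\<bar> \<le> \<bar>frac z - frac z'\<bar>"
        by (simp add: abs_mult mult_left_le)
      also have "\<bar>frac z - frac z'\<bar> = z' - z" using 1 that by (auto simp: frac_def)
      finally show ?thesis .
    next
      case 2
      then show ?thesis using z bounds[of z] bounds[of z'] by linarith
    next
      case 3
      then have "of_int \<lfloor>z'\<rfloor> \<ge> (of_int \<lfloor>z\<rfloor> + 2 :: real)" by linarith
      then show ?thesis using z bounds[of z] bounds[of z'] frac_lt_1[of z] frac_ge_0[of z'] by linarith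
    qed
  qed
  from this[of z z'] this[of z' z] show ?thesis by (cases "z \<le> z'") (auto simp: abs_minus_commute)
qed

text \<open>The divisibility makes \<open>r k\<close> divide the quotient of consecutive
  denominators, as needed for \<open>\<beta>\<close>, and makes every prime factor of
  \<open>q (k + 1)\<close> a factor of \<open>A k * N k\<close>. The fourth power of
  \<open>r k\<close> leaves room for the speed of approximation and for the upper bound. The bounds
  on \<open>r\<close> and on its growth provide the numerical margins of the separation
  argument.\<close>

locale skew_parameters =
  fixes q A N r :: "nat \<Rightarrow> nat"
  assumes q_0: "q 0 = 1"
    and q_Suc: "q (Suc k) = q k * (A k * N k)"
    and A_pos: "0 < A k"
    and A_dvd: "q k * r k dvd A k"
    and N_ge: "q k * r k ^ 4 \<le> N k"
    and r_ge: "64 \<le> r k"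
    and r_Suc: "r (Suc k) \<le> 2 * r k"
    and r_lim: "filterlim r at_top sequentially"
begin

section \<open>Arithmetic of the parameters\<close>

lemma r_pos: "0 < r k"
  using r_ge[of k] by linarith

lemma q_pos: "0 < q k"
proof (induction k)
  case (Suc k)
  then have "0 < N k" using N_ge[of k] r_pos[of k] by (metis less_le_trans mult_pos_pos zero_less_power)
  with Suc show ?case by (simp add: q_Suc A_pos)
qed (simp add: q_0)

lemma r4_le_N: "r k ^ 4 \<le> N k"
proof -
  have "1 * r k ^ 4 \<le> q k * r k ^ 4" using q_pos[of k] by (intro mult_right_mono) auto
  with N_ge[of k] show ?thesis by linarith
qed

lemma r_le_r4: "262144 * r k \<le> r k ^ 4"
proof -
  have "64 ^ 3 * r k \<le> r k ^ 3 * r k" using r_ge[of k] by (intro mult_right_mono power_mono) auto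
  then show ?thesis by (simp add: power3_eq_cube power4_eq_xxxx)
qed

lemma N_large: "262144 * r k \<le> N k" "16777216 \<le> N k"
proof -
  show "262144 * r k \<le> N k" using r4_le_N[of k] r_le_r4[of k] by (rule le_trans[rotated])
  moreover have "16777216 \<le> 262144 * r k" using r_ge[of k] by simp
  ultimately show "16777216 \<le> N k" by linarith
qed

lemma N_pos: "0 < N k"
  using N_large(2)[of k] by linarith

lemma A_ge: "q k * r k \<le> A k" "64 \<le> A k" "q k \<le> A k"
proof -
  show 1: "q k * r k \<le> A k" using A_dvd A_pos by (auto intro: dvd_imp_le)
  have "1 * 64 \<le> q k * r k" using q_pos[of k] r_ge[of k] by (intro mult_mono) auto
  with 1 show "64 \<le> A k" by linarith
  have "q k * 1 \<le> q k * r k" using r_pos[of k] by (intro mult_left_mono) auto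
  with 1 show "q k \<le> A k" by linarith
qed

lemma AN_le_q_Suc: "A k * N k \<le> q (Suc k)"
  using q_pos[of k] by (simp add: q_Suc)

lemma q_Suc_ge: "2 * q k \<le> q (Suc k)"
proof -
  have "1 * 2 \<le> A k * N k" using A_ge(2)[of k] N_large(2)[of k] by (intro mult_mono) auto
  then have "q k * 2 \<le> q k * (A k * N k)" by (intro mult_left_mono) auto
  then show ?thesis by (simp add: q_Suc mult.commute)
qed

lemma N_Suc_ge: "64 * (A k * N k) \<le> N (Suc k)" "2 * N k \<le> N (Suc k)"
proof -
  have "64 * (A k * N k) \<le> r (Suc k) ^ 4 * q (Suc k)"
    using AN_le_q_Suc[of k] r_le_r4[of "Suc k"] r_ge[of "Suc k"] by (intro mult_mono) auto
  then show 1: "64 * (A k * N k) \<le> N (Suc k)" using N_ge[of "Suc k"] by (simp add: mult.commute)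
  have "2 * N k \<le> 64 * (A k * N k)" using A_pos[of k] by simp
  with 1 show "2 * N k \<le> N (Suc k)" by linarith
qed

text \<open>Numerators of the partial sums of \<open>\<alpha>\<close> and \<open>\<beta>\<close>
  over the denominators \<open>q k\<close> and \<open>q k * r k\<close>. The summand 1 is the newest
  term of the series and the source of coprimality.\<close>

primrec p :: "nat \<Rightarrow> nat" where
  "p 0 = 1"
| "p (Suc k) = p k * (A k * N k) + 1"

primrec b :: "nat \<Rightarrow> nat" where
  "b 0 = 1"
| "b (Suc k) = b k * (A k * N k div r k) * r (Suc k) + 1"

definition \<alpha> :: real where "\<alpha> = (\<Sum>k. 1 / real (q k))"
definition \<beta> :: real where "\<beta> = (\<Sum>k. 1 / real (q k * r k))"
definition s :: "nat \<Rightarrow> real" where "s k = real (q k) * \<alpha> - real (p k)"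

lemma coprime_mult_add_1: "coprime (a * m + 1) (m :: nat)"
  by (rule coprimeI) (metis dvd_add_right_iff dvd_mult)

text \<open>By its recursion \<open>p (j + 1)\<close> is 1 modulo \<open>A j * N j\<close>, and the
  remaining factor \<open>q j\<close> of the denominator divides that number.\<close>

lemma coprime_p_q: "coprime (p k) (q k)"
proof (cases k)
  case (Suc j)
  have 1: "coprime (p k) (A j * N j)"
    unfolding Suc p.simps by (rule coprime_mult_add_1)
  have "q j dvd A j * N j" using A_dvd[of j] by (metis dvd_mult2 dvd_mult_left)
  then have "coprime (p k) (q j)" using coprime_divisors[OF dvd_refl _ 1] by blast
  then have "coprime (p k) (q j * (A j * N j))" using 1 by (rule coprime_mult_right_iff[THEN iffD2, OF conjI])
  then show ?thesis by (simp only: Suc q_Suc)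
qed (simp add: q_0)

lemma coprime_b_r: "coprime (b k) (r k)"
proof (cases k)
  case (Suc j)
  show ?thesis unfolding Suc b.simps by (rule coprime_mult_add_1)
qed simp

lemma sum_inverse_q: "(\<Sum>j\<le>k. 1 / real (q j)) = p k / q k"
proof (induction k)
  case (Suc k)
  have "P / Q + 1 / (Q * e) = (P * e + 1) / (Q * e)" if "Q > 0" "e > 0" for P Q e :: real
    using that by (simp add: field_simps)
  from this[of "q k" "real (A k * N k)" "p k"] have "p k / q k + 1 / real (q (Suc k)) = p (Suc k) / q (Suc k)"
    using q_pos[of k] A_pos[of k] N_pos[of k] by (simp add: q_Suc)
  then show ?case using Suc by simp
qed (simp add: q_0)

lemma sum_inverse_qr: "(\<Sum>j\<le>k. 1 / real (q j * r j)) = b k / (q k * r k)"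
proof (induction k)
  case (Suc k)
  define e where "e = A k * N k div r k"
  have "r k dvd A k * N k" using A_dvd[of k] by (metis dvd_mult2 dvd_mult_right)
  then have e: "A k * N k = r k * e" by (simp add: e_def)
  then have "e > 0" using A_pos[of k] N_pos[of k] by (cases e) auto
  have "B / (Q * R) + 1 / (Q * (R * E) * R') = (B * E * R' + 1) / (Q * (R * E) * R')"
    if "Q > 0" "R > 0" "E > 0" "R' > 0" for B Q R E R' :: real
    using that by (simp add: field_simps)
  from this[of "q k" "r k" e "r (Suc k)" "b k"]
  have "b k / (q k * r k) + 1 / real (q (Suc k) * r (Suc k)) = b (Suc k) / (q (Suc k) * r (Suc k))"
    unfolding b.simps e_def[symmetric] q_Suc e
    using \<open>e > 0\<close> q_pos[of k] r_pos[of k] r_pos[of "Suc k"] by simp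
  then show ?case using Suc by simp
qed (simp add: q_0)

lemma inverse_q_halving: "2 * (1 / real (q (Suc k))) \<le> 1 / q k"
  using q_Suc_ge[of k] q_pos[of k] q_pos[of "Suc k"] by (simp add: field_simps flip: of_nat_mult)

lemma summable_inverse_q: "summable (\<lambda>k. 1 / real (q k))"
  by (rule halving_tail(1)) (use inverse_q_halving in auto)

text \<open>\<open>s k\<close> is \<open>q k\<close> times the tail of the series for
  \<open>\<alpha>\<close>, whose first term is \<open>1 / q (k + 1)\<close>. All terms are positive,
  so the approximation is from below at every level.\<close>

lemma s_bounds: "1 / (A k * N k) \<le> s k" "s k \<le> 2 / (A k * N k)"
proof -
  have "s k = q k * (\<Sum>n. 1 / q (n + Suc k))"
    using suminf_split_initial_segment[OF summable_inverse_q, of "Suc k"] sum_inverse_q[of k] q_pos[of k]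
    by (simp add: s_def \<alpha>_def lessThan_Suc_atMost field_simps)
  moreover have "q k * (1 / real (q (Suc k))) \<le> q k * (\<Sum>n. 1 / q (n + Suc k))"
    using halving_tail(3)[of "\<lambda>k. 1 / real (q k)" "Suc k"] inverse_q_halving by (intro mult_left_mono) auto
  moreover have "q k * (\<Sum>n. 1 / q (n + Suc k)) \<le> q k * (2 * (1 / real (q (Suc k))))"
    using halving_tail(2)[of "\<lambda>k. 1 / real (q k)" "Suc k"] inverse_q_halving by (intro mult_left_mono) auto
  moreover have "q k * (1 / real (q (Suc k))) = 1 / (A k * N k)" using q_pos[of k] by (simp add: q_Suc)
  moreover have "q k * (2 * (1 / real (q (Suc k)))) = 2 / (A k * N k)" using q_pos[of k] by (simp add: q_Suc)
  ultimately show "1 / (A k * N k) \<le> s k" "s k \<le> 2 / (A k * N k)" by simp_all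
qed

lemma s_pos: "0 < s k"
  using s_bounds(1)[of k] A_pos[of k] N_pos[of k] by (smt (verit) divide_pos_pos of_nat_0_less_iff mult_pos_pos)

lemma A_s_bounds: "1 / N k \<le> A k * s k" "A k * s k \<le> 2 / N k"
  using mult_left_mono[OF s_bounds(1), of "real (A k)" k] mult_left_mono[OF s_bounds(2), of "real (A k)" k] A_pos[of k]
  by auto

lemma q_\<alpha>: "q k * \<alpha> = p k + s k"
  by (simp add: s_def)

lemma \<beta>_bounds: "0 \<le> \<beta> - b k / (q k * r k)" "\<beta> - b k / (q k * r k) \<le> 1 / N k"
proof -
  have halving: "2 * (1 / real (q (Suc k) * r (Suc k))) \<le> 1 / real (q k * r k)" for k
  proof -
    have "r k \<le> A k * N k"
      using N_large(1)[of k] A_pos[of k] mult_mono[of 1 "A k" "r k" "N k"] by simp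
    then have "2 * (q k * r k) \<le> q (Suc k) * r (Suc k)"
      using r_ge[of "Suc k"] mult_mono[of "q k * r k" "q k * (A k * N k)" 2 "r (Suc k)"] by (simp add: q_Suc mult.commute)
    then show ?thesis
      using q_pos[of k] r_pos[of k] q_pos[of "Suc k"] r_pos[of "Suc k"] by (simp add: field_simps flip: of_nat_mult)
  qed
  have sm: "summable (\<lambda>k. 1 / real (q k * r k))"
    by (rule halving_tail(1)) (use halving in auto)
  have "\<beta> - b k / (q k * r k) = (\<Sum>n. 1 / real (q (n + Suc k) * r (n + Suc k)))"
    using suminf_split_initial_segment[OF sm, of "Suc k"] sum_inverse_qr[of k]
    by (simp add: \<beta>_def lessThan_Suc_atMost)
  moreover have "(\<Sum>n. 1 / real (q (n + Suc k) * r (n + Suc k))) \<le> 2 * (1 / real (q (Suc k) * r (Suc k)))"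
    "1 / real (q (Suc k) * r (Suc k)) \<le> (\<Sum>n. 1 / real (q (n + Suc k) * r (n + Suc k)))"
    using halving_tail(2,3)[of "\<lambda>k. 1 / real (q k * r k)" "Suc k"] halving by auto
  moreover have "2 * (1 / real (q (Suc k) * r (Suc k))) \<le> 1 / N k"
  proof -
    have "2 * N k \<le> r (Suc k) * q (Suc k)"
      using r_ge[of "Suc k"] AN_le_q_Suc[of k] A_pos[of k]
      by (intro mult_mono) (auto intro: order_trans[of _ "A k * N k"])
    then show ?thesis using N_pos[of k] q_pos[of "Suc k"] r_pos[of "Suc k"]
      by (simp add: field_simps flip: of_nat_mult)
  qed
  moreover have "0 \<le> 1 / real (q (Suc k) * r (Suc k))" by simp
  ultimately show "0 \<le> \<beta> - b k / (q k * r k)" "\<beta> - b k / (q k * r k) \<le> 1 / N k" by linarith+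
qed

text \<open>The functions \<open>A k * bump (q k * x)\<close> have a divergent sum, but their coboundaries \<open>f_term\<close> are summable.\<close>

definition f_term :: "nat \<Rightarrow> real \<Rightarrow> real" where
  "f_term k x = real (A k) * (bump (real (q k) * x + s k) - bump (real (q k) * x))"

definition f :: "real \<Rightarrow> real" where
  "f x = \<beta> + (\<Sum>k. f_term k x)"

definition \<Phi> :: "nat \<Rightarrow> real \<Rightarrow> real" where
  "\<Phi> k x = (\<Sum>j<k. real (A j) * bump (real (q j) * x))"

definition T :: "real \<times> real \<Rightarrow> real \<times> real" where
  "T = skew \<alpha> f"

lemma abs_A_bump_diff: "\<bar>real (A k) * (bump y - bump z)\<bar> \<le> real (A k) * \<bar>y - z\<bar>"
  using bump_lipschitz[of y z] by (simp add: abs_mult mult_left_mono)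

lemma abs_f_term: "\<bar>f_term k x\<bar> \<le> 2 / N k"
  using abs_A_bump_diff[of k "real (q k) * x + s k" "real (q k) * x"] A_s_bounds(2)[of k] s_pos[of k]
  by (simp add: f_term_def)

lemma inverse_N_halving: "2 * (2 / real (N (Suc k))) \<le> 2 / N k"
  using N_Suc_ge(2)[of k] N_pos[of k] N_pos[of "Suc k"] by (simp add: field_simps flip: of_nat_mult)

lemma summable_inverse_N: "summable (\<lambda>k. 2 / real (N k))"
  by (rule halving_tail(1)) (use inverse_N_halving in auto)

lemma inverse_N_tail: "(\<Sum>n. 2 / real (N (n + k))) \<le> 4 / N k"
  using halving_tail(2)[of "\<lambda>k. 2 / real (N k)" k] inverse_N_halving by auto

lemma summable_f_term: "summable (\<lambda>k. f_term k x)"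
  by (rule summable_comparison_test[OF _ summable_inverse_N]) (use abs_f_term in auto)

lemma borel_measurable_f [measurable]: "f \<in> borel_measurable borel"
  unfolding f_def[abs_def] f_term_def by measurable

lemma borel_measurable_\<Phi> [measurable]: "\<Phi> k \<in> borel_measurable borel"
  unfolding \<Phi>_def[abs_def] by measurable

lemma measurable_T [measurable]: "T \<in> borel \<rightarrow>\<^sub>M borel"
  unfolding T_def by measurable

lemma \<Phi>_frac [simp]: "\<Phi> k (frac x) = \<Phi> k x"
  unfolding \<Phi>_def using bump_frac_mult[of _ x 0] by simp

text \<open>Since \<open>q k * \<alpha>\<close> exceeds the integer \<open>p k\<close> by
  \<open>s k\<close>, the rotation is a slow shift by \<open>s k\<close> at the frequency
  \<open>q k\<close>.\<close>

lemma bump_rotate: "bump (real (q k) * (x + \<alpha>) + c) = bump (real (q k) * x + s k + c)"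
proof -
  have "real (q k) * (x + \<alpha>) + c = (real (q k) * x + s k + c) + of_int (int (p k))"
    using q_\<alpha>[of k] by (simp add: distrib_left)
  then show ?thesis by (simp only: bump_add_int)
qed

text \<open>The terms below \<open>k\<close> form the coboundary of \<open>\<Phi> k\<close>, and
  each later term has size at most \<open>A j * s j \<le> 2 / N j\<close>.\<close>

lemma f_minus_coboundary:
  "\<bar>f x - \<beta> - (\<Phi> k (x + \<alpha>) - \<Phi> k x)\<bar> \<le> 4 / N k"
proof -
  have "(\<Sum>j<k. f_term j x) = \<Phi> k (x + \<alpha>) - \<Phi> k x"
    unfolding \<Phi>_def f_term_def sum_subtractf[symmetric]
    using bump_rotate[of _ x 0] by (intro sum.cong) (auto simp: algebra_simps)
  then have "f x - \<beta> - (\<Phi> k (x + \<alpha>) - \<Phi> k x) = (\<Sum>n. f_term (n + k) x)"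
    using suminf_split_initial_segment[OF summable_f_term[of x], of k] by (simp add: f_def)
  also have "\<bar>\<dots>\<bar> \<le> (\<Sum>n. 2 / real (N (n + k)))"
    by (rule norm_suminf_le[where 'a=real, unfolded real_norm_def])
      (use abs_f_term summable_ignore_initial_segment[OF summable_inverse_N, of k] in auto)
  also have "\<dots> \<le> 4 / N k" by (rule inverse_N_tail)
  finally show ?thesis .
qed

text \<open>The last summand dominates, and \<open>q k\<close> exceeds it by a factor
  \<open>N (k - 1)\<close>, far above \<open>r k\<close>. As a Lipschitz constant for
  \<open>\<Phi> k\<close>, the bound says that \<open>\<Phi> k\<close> varies by at most
  \<open>1 / r k\<close> over the width \<open>1 / q k\<close> of a cell.\<close>

lemma sum_A_q_le: "(\<Sum>j<k. real (A j * q j)) \<le> q k / r k"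
proof (induction k)
  case (Suc k)
  have "2 * r (Suc k) \<le> N k" using r_Suc[of k] N_large(1)[of k] by linarith
  then have "2 * r (Suc k) * (A k * q k) \<le> N k * (A k * q k)" by (rule mult_right_mono) simp
  then have "2 * (A k * q k) * r (Suc k) \<le> q (Suc k)" by (simp add: q_Suc mult_ac)
  then have "2 * real (A k * q k) \<le> q (Suc k) / r (Suc k)"
    using r_pos[of "Suc k"] by (simp add: field_simps flip: of_nat_mult)
  moreover have "q k / r k \<le> real (A k * q k)"
  proof -
    have "q k \<le> A k * q k * r k" using A_pos[of k] r_pos[of k] by simp
    then show ?thesis using r_pos[of k] by (simp add: field_simps flip: of_nat_mult)
  qed
  ultimately show ?case using Suc by simp
qed (simp)

lemma \<Phi>_lipschitz: "\<bar>\<Phi> k x - \<Phi> k y\<bar> \<le> q k / r k * \<bar>x - y\<bar>"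
proof -
  have "\<bar>\<Phi> k x - \<Phi> k y\<bar> \<le> (\<Sum>j<k. \<bar>real (A j) * (bump (real (q j) * x) - bump (real (q j) * y))\<bar>)"
    unfolding \<Phi>_def sum_subtractf[symmetric] right_diff_distrib[symmetric] by (rule sum_abs)
  also have "\<dots> \<le> (\<Sum>j<k. real (A j * q j) * \<bar>x - y\<bar>)"
  proof (rule sum_mono)
    fix j
    have "\<bar>real (A j) * (bump (real (q j) * x) - bump (real (q j) * y))\<bar> \<le> real (A j) * \<bar>real (q j) * x - real (q j) * y\<bar>" by (rule abs_A_bump_diff)
    also have "\<dots> = real (A j * q j) * \<bar>x - y\<bar>" by (simp add: abs_mult flip: right_diff_distrib)
    finally show "\<bar>real (A j) * (bump (real (q j) * x) - bump (real (q j) * y))\<bar> \<le> real (A j * q j) * \<bar>x - y\<bar>" .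
  qed
  also have "\<dots> \<le> q k / r k * \<bar>x - y\<bar>"
    unfolding sum_distrib_right[symmetric] by (intro mult_right_mono sum_A_q_le) auto
  finally show ?thesis .
qed

end

subsection \<open>Cyclic approximation\<close>

text \<open>A multiple of \<open>1 / n\<close> that is smaller than \<open>1 / n\<close> in absolute
  value is 0. This is what separates different translates of a cell.\<close>

lemma frac_close_dvd:
  fixes a c :: real
  assumes "0 < n" "frac a < 1 / real n" "frac c < 1 / real n" "a - c = of_int m / real n"
  shows "int n dvd m"
proof -
  let ?z = "\<lfloor>a\<rfloor> - \<lfloor>c\<rfloor>"
  have "frac a - frac c = of_int m / n - of_int ?z" using assms(4) by (simp add: frac_def)
  then have "n * (frac a - frac c) = of_int (m - n * ?z)"
    using assms(1) by (simp add: field_simps)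
  moreover have "\<bar>frac a - frac c\<bar> < 1 / n" using assms(2,3) frac_ge_0[of a] frac_ge_0[of c] by linarith
  then have "n * \<bar>frac a - frac c\<bar> < 1" using assms(1) by (simp add: field_simps)
  then have "\<bar>n * (frac a - frac c)\<bar> < 1" by (simp add: abs_mult)
  ultimately have "\<bar>of_int (m - n * ?z) :: real\<bar> < 1" by simp
  then have "m - n * ?z = 0" by linarith
  then show ?thesis by (metis dvd_triv_left eq_iff_diff_eq_0)
qed

lemma exists_frac_shift_less:
  fixes x :: real and n p :: nat
  assumes "0 < n" "coprime p n"
  shows "\<exists>i<n. frac (x - real i * real p / real n) < 1 / real n"
proof -
  obtain i where i: "i < n" "[int (i * p) = \<lfloor>real n * x\<rfloor>] (mod int n)"
  proof -
    obtain y where y: "[int p * y = 1] (mod int n)"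
      using assms(2) cong_solve_coprime_int[of "int p" "int n"] by auto
    \<comment> \<open>\<open>y\<close> inverts \<open>p\<close> modulo \<open>n\<close>, so that
      \<open>i * p\<close> hits the index of the interval of length \<open>1 / n\<close> containing
      \<open>x\<close>.\<close>
    define i where "i = nat ((y * \<lfloor>real n * x\<rfloor>) mod int n)"
    have "int i = (y * \<lfloor>real n * x\<rfloor>) mod int n" using assms(1) by (simp add: i_def)
    then have "[int i * int p = y * \<lfloor>real n * x\<rfloor> * int p] (mod int n)" by (simp add: cong_def mod_mult_left_eq)
    also have "y * \<lfloor>real n * x\<rfloor> * int p = int p * y * \<lfloor>real n * x\<rfloor>" by simp
    also have "[int p * y * \<lfloor>real n * x\<rfloor> = 1 * \<lfloor>real n * x\<rfloor>] (mod int n)" by (rule cong_mult[OF y cong_refl])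
    finally have "[int (i * p) = \<lfloor>real n * x\<rfloor>] (mod int n)" by simp
    moreover have "i < n" using assms(1) unfolding i_def by (simp add: nat_less_iff)
    ultimately show thesis using that by blast
  qed
  then obtain z where z: "\<lfloor>real n * x\<rfloor> = int (i * p) + int n * z"
    by (metis cong_iff_lin)
  have "x - real i * real p / real n = of_int z + frac (real n * x) / n"
    using assms(1) arg_cong[OF z, of real_of_int] by (simp add: frac_def field_simps)
  moreover have "0 \<le> frac (real n * x) / n" "frac (real n * x) / n < 1 / real n" "1 / real n \<le> 1"
    using assms(1) frac_lt_1[of "real n * x"] by (auto simp: divide_strict_right_mono)
  ultimately have "frac (x - real i * real p / real n) = frac (real n * x) / n"
    by (simp add: frac_eq)
  with \<open>frac (real n * x) / n < 1 / real n\<close> i(1) show ?thesis by auto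
qed

context skew_parameters
begin

definition height :: "nat \<Rightarrow> nat" where
  "height k = q k * r k"

lemma height_pos: "0 < height k"
  using q_pos r_pos by (simp add: height_def)

text \<open>The conjugacy \<open>(x, y) \<mapsto> (x, y - \<Phi> k x)\<close> turns \<open>T\<close> almost into the translation by
  \<open>(p k / q k, b k / (q k * r k))\<close>, whose powers permute the translates of \<open>base k\<close> cyclically.\<close>

abbreviation rot_x :: "nat \<Rightarrow> nat \<Rightarrow> real" where
  "rot_x k i \<equiv> real i * real (p k) / real (q k)"

abbreviation rot_y :: "nat \<Rightarrow> nat \<Rightarrow> real" where
  "rot_y k i \<equiv> real i * real (b k) / real (q k * r k)"

text \<open>Straightens by \<open>\<Phi> k\<close> and undoes \<open>i\<close> steps of the rational
  translation. Writing this as a skew shift makes all cells preimages of \<open>base k\<close> under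
  measure preserving maps, so equality of their measures is immediate.\<close>

definition cell_map :: "nat \<Rightarrow> nat \<Rightarrow> real \<times> real \<Rightarrow> real \<times> real" where
  "cell_map k i = skew (- (rot_x k i))
     (\<lambda>x. - \<Phi> k x - rot_y k i)"

definition base :: "nat \<Rightarrow> (real \<times> real) set" where
  "base k = {0..<1 / real (q k)} \<times> {0..<1 / real (r k)}"

definition cell :: "nat \<Rightarrow> nat \<Rightarrow> (real \<times> real) set" where
  "cell k i = {w \<in> torus. cell_map k i w \<in> base k}"

lemma measurable_cell_map [measurable]: "cell_map k i \<in> borel \<rightarrow>\<^sub>M borel"
  unfolding cell_map_def by measurable

lemma sets_base [measurable]: "base k \<in> sets borel"
  unfolding base_def borel_prod[symmetric] by measurable

lemma sets_vimage_cell_map [measurable]: "B \<in> sets borel \<Longrightarrow> {w \<in> torus. cell_map k i w \<in> B} \<in> sets borel"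
proof -
  assume [measurable]: "B \<in> sets borel"
  have "{w \<in> torus. cell_map k i w \<in> B} = torus \<inter> (cell_map k i -` B \<inter> space borel)" by auto
  also have "\<dots> \<in> sets borel" by measurable
  finally show ?thesis .
qed

lemma sets_cell [measurable]: "cell k i \<in> sets borel"
  unfolding cell_def by measurable

lemma emeasure_cell_map:
  assumes [measurable]: "B \<in> sets borel"
  shows "emeasure lborel {w \<in> torus. cell_map k i w \<in> B} = emeasure lborel (B \<inter> torus)"
  unfolding cell_map_def by (rule emeasure_skew) measurable

lemma inverse_le_1: "1 / real (q k) \<le> 1" "1 / real (r k) \<le> 1"
  using q_pos[of k] r_pos[of k] by auto

lemma base_subset_torus: "base k \<subseteq> torus"
  using inverse_le_1[of k] by (auto simp: base_def torus_def intro: less_le_trans)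

lemma emeasure_cell: "emeasure lborel (cell k i) = 1 / height k"
proof -
  have "emeasure lborel (cell k i) = emeasure lborel (base k)"
    unfolding cell_def by (subst emeasure_cell_map) (auto simp: base_subset_torus Int_absorb2)
  also have "\<dots> = 1 / height k"
    unfolding base_def by (subst emeasure_lborel_Times) (auto simp: height_def ennreal_mult'[symmetric])
  finally show ?thesis .
qed

lemma mem_cell_iff:
  "w \<in> cell k i \<longleftrightarrow> w \<in> torus \<and> frac (fst w - rot_x k i) < 1 / real (q k) \<and>
    frac (snd w - \<Phi> k (fst w) - rot_y k i) < 1 / real (r k)"
  by (auto simp: cell_def cell_map_def skew_def base_def add_diff_eq)

lemma cell_height: "cell k (height k) = cell k 0"
proof -
  have "frac (x - real (height k) * real (p k) / real (q k)) = frac x" for x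
    using frac_add_of_int_right[of x "- int (r k * p k)"] q_pos[of k] by (simp add: height_def)
  moreover have "frac (x - real (height k) * real (b k) / real (q k * r k)) = frac x" for x
    using frac_add_of_int_right[of x "- int (b k)"] q_pos[of k] r_pos[of k] by (simp add: height_def)
  ultimately show ?thesis by (auto simp: mem_cell_iff)
qed

text \<open>Two stages: the first coordinate forces \<open>q k\<close> to divide
  \<open>j - i\<close>, by coprimality with \<open>p k\<close>. Over \<open>q k\<close> steps the
  vertical translation is by \<open>b k / r k\<close>, so the second coordinate forces
  \<open>r k\<close> to divide the quotient.\<close>

lemma cell_disjoint:
  assumes "w \<in> cell k i" "w \<in> cell k j" "i < height k" "j < height k"
  shows "i = j"
proof -
  have False if "i < j" "j < height k" "w \<in> cell k i" "w \<in> cell k j" for i j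
  proof -
    have "int (q k) dvd (int j - int i) * int (p k)"
      using that(3,4) q_pos[of k]
      by (intro frac_close_dvd[of "q k" "fst w - rot_x k i" "fst w - rot_x k j"])
        (auto simp: mem_cell_iff diff_divide_distrib left_diff_distrib)
    moreover have "coprime (int (q k)) (int (p k))" using coprime_p_q[of k] by (simp add: coprime_commute)
    ultimately have "int (q k) dvd int j - int i" by (simp add: coprime_dvd_mult_left_iff)
    then obtain d where d: "int j - int i = int (q k) * d" by auto
    then have dj: "real j = real i + real (q k) * of_int d"
      by (metis add_diff_cancel_left' diff_add_cancel of_int_add of_int_mult of_int_of_nat_eq add.commute)
    have "int (r k) dvd d * int (b k)"
      using that(3,4) r_pos[of k] q_pos[of k]
      by (intro frac_close_dvd[of "r k" "snd w - \<Phi> k (fst w) - rot_y k i"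
            "snd w - \<Phi> k (fst w) - rot_y k j"])
        (auto simp: mem_cell_iff dj field_simps)
    moreover have "coprime (int (r k)) (int (b k))" using coprime_b_r[of k] by (simp add: coprime_commute)
    ultimately have "int (r k) dvd d" by (simp add: coprime_dvd_mult_left_iff)
    moreover have "0 < d" using d that(1) q_pos[of k] by (smt (verit) mult_nonneg_nonpos of_nat_0_le_iff of_nat_less_iff)
    ultimately have "int (r k) \<le> d" by (rule zdvd_imp_le)
    then have "int (q k) * int (r k) \<le> int j - int i" unfolding d by (rule mult_left_mono) simp
    moreover have "int j < int (q k) * int (r k)" using that(2) unfolding height_def by (metis of_nat_less_iff of_nat_mult)
    ultimately show False by linarith
  qed
  then show ?thesis using assms by (metis linorder_neqE_nat)
qed

lemma cell_cover: "torus = (\<Union>i<height k. cell k i)"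
proof
  show "(\<Union>i<height k. cell k i) \<subseteq> torus" by (auto simp: cell_def)
  show "torus \<subseteq> (\<Union>i<height k. cell k i)"
  proof
    fix w assume w: "w \<in> torus"
    obtain i where i: "i < q k" "frac (fst w - rot_x k i) < 1 / q k"
      using exists_frac_shift_less[OF q_pos coprime_p_q] by blast
    obtain d where d: "d < r k"
      "frac (snd w - \<Phi> k (fst w) - rot_y k i - real d * real (b k) / real (r k)) < 1 / r k"
      using exists_frac_shift_less[OF r_pos coprime_b_r] by blast
    \<comment> \<open>The residue \<open>i\<close> is fixed by the first coordinate; adding
      multiples of \<open>q k\<close> does not disturb it and moves the second coordinate through
      all multiples of \<open>b k / r k\<close>.\<close>
    have h1: "frac (fst w - rot_x k (i + q k * d)) = frac (fst w - rot_x k i)"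
      using frac_add_of_int_right[of "fst w - rot_x k i" "- int (d * p k)"] q_pos[of k]
      by (simp add: field_simps)
    have h2: "snd w - \<Phi> k (fst w) - rot_y k (i + q k * d) =
        snd w - \<Phi> k (fst w) - rot_y k i - real d * real (b k) / real (r k)"
      using q_pos[of k] r_pos[of k] by (simp add: field_simps)
    have "w \<in> cell k (i + q k * d)" using w i d by (simp only: mem_cell_iff h1 h2 simp_thms)
    moreover have "i + q k * d < height k"
    proof -
      have "q k * Suc d \<le> q k * r k" using d(1) by (intro mult_left_mono) auto
      then show ?thesis using i(1) by (simp add: height_def)
    qed
    ultimately show "w \<in> (\<Union>i<height k. cell k i)" by auto
  qed
qed

text \<open>The part of \<open>base k\<close> from which one step may fail to reach the next cell.
  Horizontally \<open>T\<close> is ahead of the rational translation by \<open>s k / q k\<close>, so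
  only the right edge is critical. Vertically the deviation has either sign and is at most
  \<open>5 / N k\<close>: 4 from the levels above \<open>k - 1\<close> and 1 from
  \<open>\<beta>\<close>.\<close>

definition edge :: "nat \<Rightarrow> (real \<times> real) set" where
  "edge k = {1 / q k - s k / q k..<1 / q k} \<times> {0..<1 / r k} \<union>
     {0..<1 / q k} \<times> ({0..<5 / N k} \<union> {1 / r k - 5 / N k..<1 / r k})"

lemma sets_edge [measurable]: "edge k \<in> sets borel"
  unfolding edge_def borel_prod[symmetric] by measurable

lemma cell_step:
  assumes w: "w \<in> cell k i" and nT: "T w \<notin> cell k (Suc i)"
  shows "cell_map k i w \<in> edge k"
proof (rule ccontr)
  assume ne: "cell_map k i w \<notin> edge k"
  define x0 where "x0 = frac (fst w - rot_x k i)"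
  define y0 where "y0 = frac (snd w - \<Phi> k (fst w) - rot_y k i)"
  have cm: "cell_map k i w = (x0, y0)" by (simp add: cell_map_def skew_def x0_def y0_def add_diff_eq)
  have x0: "0 \<le> x0" "x0 < 1 / q k" and y0: "0 \<le> y0" "y0 < 1 / r k"
    using w by (auto simp: mem_cell_iff x0_def y0_def)
  have x1: "x0 + s k / q k < 1 / q k" and y1: "5 / N k \<le> y0" "y0 < 1 / r k - 5 / N k"
    using ne x0 y0 unfolding cm edge_def by auto
  have sq: "\<alpha> = p k / q k + s k / q k" using q_\<alpha>[of k] q_pos[of k] by (simp add: field_simps)
  have "frac (fst (T w) - rot_x k (Suc i)) = frac (fst w + \<alpha> - rot_x k (Suc i))"
    using frac_add_simps(1)[of "fst w + \<alpha>" "- (rot_x k (Suc i))"]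
    by (simp add: T_def skew_def)
  also have "fst w + \<alpha> - rot_x k (Suc i) = (fst w - rot_x k i) + s k / q k"
    by (subst sq) (simp add: add_divide_distrib algebra_simps)
  also have "frac \<dots> = frac (x0 + s k / q k)" by (simp add: x0_def)
  also have "\<dots> = x0 + s k / q k"
    using x0 x1 s_pos[of k] inverse_le_1(1)[of k] by (simp add: frac_eq)
  finally have 1: "frac (fst (T w) - rot_x k (Suc i)) < 1 / q k" using x1 by simp
  \<comment> \<open>In the coordinates straightened by \<open>\<Phi> k\<close>, this is the vertical
    deviation of one step of \<open>T\<close> from the rational translation.\<close>
  define \<zeta> where "\<zeta> = f (fst w) - (\<Phi> k (fst w + \<alpha>) - \<Phi> k (fst w)) - real (b k) / real (q k * r k)"
  have "\<bar>\<zeta>\<bar> \<le> 5 / N k"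
    using f_minus_coboundary[of "fst w" k] \<beta>_bounds[of k] unfolding \<zeta>_def
    by (simp add: abs_le_iff)
  have "frac (snd (T w) - \<Phi> k (fst (T w)) - rot_y k (Suc i)) =
      frac (snd w + f (fst w) - \<Phi> k (fst w + \<alpha>) - rot_y k (Suc i))"
    using frac_add_simps(1)[of "snd w + f (fst w)" "- \<Phi> k (fst w + \<alpha>) - rot_y k (Suc i)"]
    by (simp add: T_def skew_def algebra_simps)
  also have "snd w + f (fst w) - \<Phi> k (fst w + \<alpha>) - rot_y k (Suc i) =
      (snd w - \<Phi> k (fst w) - rot_y k i) + \<zeta>"
    by (simp add: \<zeta>_def add_divide_distrib algebra_simps)
  also have "frac \<dots> = frac (y0 + \<zeta>)" by (simp add: y0_def)
  also have "\<dots> = y0 + \<zeta>"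
    using y0 y1 \<open>\<bar>\<zeta>\<bar> \<le> 5 / N k\<close> inverse_le_1(2)[of k] by (subst frac_eq) linarith
  finally have 2: "frac (snd (T w) - \<Phi> k (fst (T w)) - rot_y k (Suc i)) < 1 / r k"
    using y1 \<open>\<bar>\<zeta>\<bar> \<le> 5 / N k\<close> by linarith
  have "T w \<in> cell k (Suc i)" using 1 2 by (simp add: mem_cell_iff T_def)
  with nT show False by simp
qed

lemma emeasure_edge: "emeasure lborel (edge k) \<le> ennreal (s k / height k + 10 / (N k * q k))"
proof -
  have pos: "0 \<le> s k / q k" "0 \<le> 5 / real (N k)" using s_pos[of k] by auto
  have "emeasure lborel (edge k) \<le> emeasure lborel ({1 / q k - s k / q k..<1 / q k} \<times> {0..<1 / real (r k)}) +
      emeasure lborel ({0..<1 / q k} \<times> ({0..<5 / N k} \<union> {1 / r k - 5 / N k..<1 / r k}))"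
    unfolding edge_def by (rule emeasure_subadditive) (auto simp: borel_prod[symmetric])
  also have "emeasure lborel ({1 / q k - s k / q k..<1 / q k} \<times> {0..<1 / real (r k)}) = ennreal (s k / height k)"
    using pos by (subst emeasure_lborel_Times) (auto simp: height_def ennreal_mult'[symmetric])
  also have "emeasure lborel ({0..<1 / q k} \<times> ({0..<5 / N k} \<union> {1 / r k - 5 / N k..<1 / r k})) =
      ennreal (1 / q k) * emeasure lborel ({0..<5 / real (N k)} \<union> {1 / r k - 5 / N k..<1 / r k})"
    by (subst emeasure_lborel_Times) auto
  also have "\<dots> \<le> ennreal (1 / q k) * (ennreal (5 / N k) + ennreal (5 / N k))"
    by (intro mult_left_mono order_trans[OF emeasure_subadditive] add_mono) auto
  also have "\<dots> = ennreal (10 / (N k * q k))"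
    by (simp add: ennreal_plus[symmetric] ennreal_mult'[symmetric] del: ennreal_plus)
  also have "ennreal (s k / height k) + ennreal (10 / (N k * q k)) = ennreal (s k / height k + 10 / (N k * q k))"
    using s_pos[of k] by (intro ennreal_plus[symmetric]) auto
  finally show ?thesis by simp
qed

lemma cell_error:
  assumes "i < height k"
  shows "measure lborel {w \<in> cell k i. T w \<notin> cell k (Suc i mod height k)} \<le> s k / height k + 10 / (N k * q k)"
proof -
  have eq: "cell k (Suc i mod height k) = cell k (Suc i)"
    using assms cell_height[of k] by (cases "Suc i = height k") auto
  have sub: "{w \<in> cell k i. T w \<notin> cell k (Suc i)} \<subseteq> {w \<in> torus. cell_map k i w \<in> edge k}"
    using cell_step by (auto simp: cell_def)
  have "emeasure lborel {w \<in> cell k i. T w \<notin> cell k (Suc i)} \<le> emeasure lborel {w \<in> torus. cell_map k i w \<in> edge k}"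
    by (rule emeasure_mono[OF sub]) simp
  also have "\<dots> \<le> emeasure lborel (edge k)"
    by (subst emeasure_cell_map) (auto intro!: emeasure_mono)
  also note emeasure_edge
  finally show ?thesis unfolding eq measure_def
    using s_pos[of k] by (intro enn2real_leI) (auto intro!: add_nonneg_nonneg divide_nonneg_nonneg)
qed

lemma sum_cell_error:
  "(\<Sum>i<height k. measure lborel {w \<in> cell k i. T w \<notin> cell k (Suc i mod height k)}) \<le> 11 * r k / N k"
proof -
  have "(\<Sum>i<height k. measure lborel {w \<in> cell k i. T w \<notin> cell k (Suc i mod height k)})
      \<le> (\<Sum>i<height k. s k / height k + 10 / (N k * q k))"
    by (intro sum_mono cell_error) auto
  also have "\<dots> = s k + 10 * r k / N k"
    using height_pos[of k] q_pos[of k] r_pos[of k] N_pos[of k] by (simp add: distrib_left) (simp add: height_def)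
  also have "s k \<le> r k / N k"
  proof -
    have "s k \<le> 2 / (A k * N k)" by (rule s_bounds)
    also have "\<dots> \<le> r k / N k"
      using A_ge(2)[of k] r_ge[of k] N_pos[of k] mult_mono[of 1 "real (A k)" 2 "real (r k)"]
      by (simp add: field_simps)
    finally show ?thesis .
  qed
  finally show ?thesis by simp
qed

text \<open>Everything is modulo 1, as a cell may wrap around the torus. Vertically,
  \<open>1 / r k\<close> comes from the base and another \<open>1 / r k\<close> from the variation
  of \<open>\<Phi> k\<close> over the width of the cell.\<close>

lemma cell_close:
  assumes w: "w \<in> cell k i" and w': "w' \<in> cell k i"
  shows "\<exists>m::int. \<bar>fst w - fst w' - of_int m\<bar> < 1 / q k" and "\<exists>m::int. \<bar>snd w - snd w' - of_int m\<bar> < 2 / r k"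
proof -
  have fr: "\<exists>m. \<bar>a - c - of_int m\<bar> < e" if "frac a < e" "frac c < e" for a c e :: real
  proof
    show "\<bar>a - c - of_int (\<lfloor>a\<rfloor> - \<lfloor>c\<rfloor>)\<bar> < e"
      using that frac_ge_0[of a] frac_ge_0[of c] by (simp add: frac_def) linarith
  qed
  have "\<exists>m::int. \<bar>(fst w - rot_x k i) - (fst w' - rot_x k i) - of_int m\<bar> < 1 / real (q k)"
    using w w' by (intro fr) (auto simp: mem_cell_iff)
  then obtain m :: int where m: "\<bar>fst w - fst w' - of_int m\<bar> < 1 / q k" by auto
  then show "\<exists>m::int. \<bar>fst w - fst w' - of_int m\<bar> < 1 / q k" by auto
  have "\<exists>m::int. \<bar>(snd w - \<Phi> k (fst w) - rot_y k i) -
      (snd w' - \<Phi> k (fst w') - rot_y k i) - of_int m\<bar> < 1 / real (r k)"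
    using w w' by (intro fr) (auto simp: mem_cell_iff)
  then obtain m' :: int where m': "\<bar>snd w - snd w' - (\<Phi> k (fst w) - \<Phi> k (fst w')) - of_int m'\<bar> < 1 / r k"
    by (auto simp: algebra_simps)
  have "\<Phi> k (fst w' + of_int m) = \<Phi> k (fst w')" using \<Phi>_frac[of k "fst w' + of_int m"] by simp
  then have "\<bar>\<Phi> k (fst w) - \<Phi> k (fst w')\<bar> \<le> q k / r k * \<bar>fst w - (fst w' + of_int m)\<bar>"
    using \<Phi>_lipschitz[of k "fst w" "fst w' + of_int m"] by simp
  also have "\<dots> \<le> q k / r k * (1 / q k)"
    using m by (intro mult_left_mono) (auto simp: algebra_simps)
  also have "\<dots> = 1 / r k" using q_pos[of k] by simp
  finally have "\<bar>snd w - snd w' - of_int m'\<bar> < 2 / r k" using m' by (simp add: abs_less_iff) linarith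
  then show "\<exists>m::int. \<bar>snd w - snd w' - of_int m\<bar> < 2 / r k" by auto
qed


section \<open>Approximation of measurable sets by unions of cells\<close>

lemma q_lim: "filterlim q at_top sequentially"
proof -
  have "k \<le> q k" for k
  proof (induction k)
    case (Suc k)
    then show ?case using q_Suc_ge[of k] q_pos[of k] by linarith
  qed simp
  then show ?thesis by (intro filterlim_at_top_mono[OF filterlim_ident]) auto
qed

text \<open>Up to a null set, \<open>B\<close> is squeezed between a compact set \<open>- V\<close>
  and an open set \<open>U\<close>. Once the cells are smaller than the distance between
  \<open>- V\<close> and the complement of \<open>U\<close>, those that meet \<open>- V\<close>
  cover it and stay inside \<open>U\<close>. Working in the open square keeps the compact set away
  from the lines where cells wrap.\<close>

lemma cells_approximate:
  fixes \<epsilon> :: real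
  assumes B [measurable]: "B \<in> sets borel" and sub: "B \<subseteq> torus" and \<epsilon>: "\<epsilon> > 0"
  shows "eventually (\<lambda>k. \<exists>J\<subseteq>{..<height k}. measure lborel (sym_diff B (\<Union>i\<in>J. cell k i)) < \<epsilon>) sequentially"
proof -
  let ?I = "{0<..<1} \<times> {0<..<1} :: (real \<times> real) set"
  define B' where "B' = B \<inter> ?I"
  have I_open: "open ?I" by (intro open_Times) auto
  then have [measurable]: "B' \<in> sets borel" unfolding B'_def by measurable
  have B'_leb: "B' \<in> sets lebesgue" using \<open>B' \<in> sets borel\<close> by (simp add: sets_completionI_sets)
  have half: "\<epsilon> / 2 > 0" using \<epsilon> by simp
  obtain U where U: "open U" "B' \<subseteq> U" "U - B' \<in> lmeasurable" "emeasure lebesgue (U - B') < ennreal (\<epsilon> / 2)"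
    by (rule sets_lebesgue_outer_open[OF B'_leb half])
  have "- B' \<in> sets lebesgue" using B'_leb by (simp add: Compl_in_sets_lebesgue)
  then obtain V where V: "open V" "- B' \<subseteq> V" "V - - B' \<in> lmeasurable" "emeasure lebesgue (V - - B') < ennreal (\<epsilon> / 2)"
    by (rule sets_lebesgue_outer_open[OF _ half])
  have K: "compact (- V)" "- V \<subseteq> B'"
  proof -
    show "- V \<subseteq> B'" using V by auto
    moreover have "bounded B'"
      by (rule bounded_subset[of "{0..1} \<times> {0..1}"]) (auto simp: B'_def intro: bounded_Times)
    ultimately show "compact (- V)" using V(1) by (metis bounded_subset compact_eq_bounded_closed closed_Compl)
  qed
  have "open (U \<inter> ?I)" "- V \<subseteq> U \<inter> ?I" using U K I_open by (auto simp: B'_def)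
  then obtain \<delta> where \<delta>: "\<delta> > 0" "(\<Union>z\<in>- V. ball z \<delta>) \<subseteq> U \<inter> ?I"
    using compact_subset_open_imp_ball_epsilon_subset[OF K(1)] by metis
  define e where "e = \<delta> / 2"
  have e: "e > 0" using \<delta> by (simp add: e_def)
  have ball: "z' \<in> U \<inter> ?I" if "z \<in> - V" "\<bar>fst z - fst z'\<bar> < e" "\<bar>snd z - snd z'\<bar> < e" for z z'
  proof -
    have "dist z z' \<le> \<bar>fst z - fst z'\<bar> + \<bar>snd z - snd z'\<bar>"
      unfolding dist_prod_def using sqrt_sum_squares_le_sum_abs[of "dist (fst z) (fst z')" "dist (snd z) (snd z')"]
      by (simp add: dist_real_def)
    then have "z' \<in> ball z \<delta>" using that by (simp add: e_def)
    then show ?thesis using \<delta>(2) that(1) by blast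
  qed
  \<comment> \<open>Cells are small only modulo 1; a coordinate at distance at least
    \<open>e\<close> from both ends of the unit interval rules out a wrap.\<close>
  have near: "\<bar>x - x'\<bar> < e" if "\<bar>x - x' - of_int m\<bar> < e" "e \<le> x" "x \<le> 1 - e" "0 \<le> x'" "x' < 1" for x x' m
  proof -
    have "\<bar>of_int m :: real\<bar> < 1" using that by linarith
    then have "m = 0" by linarith
    with that show ?thesis by simp
  qed
  have inner: "e \<le> fst z" "fst z \<le> 1 - e" "e \<le> snd z" "snd z \<le> 1 - e" if z: "z \<in> - V" for z
  proof -
    have in_I: "z + v \<in> ?I" if "norm v < \<delta>" for v
    proof -
      have "z + v \<in> ball z \<delta>" using that by (simp add: dist_norm)
      then show ?thesis using \<delta>(2) z by blast
    qed
    have "z + (e, 0) \<in> ?I" "z + (- e, 0) \<in> ?I" "z + (0, e) \<in> ?I" "z + (0, - e) \<in> ?I"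
      by (rule in_I, use \<delta>(1) in \<open>simp add: e_def norm_Pair\<close>)+
    then show "e \<le> fst z" "fst z \<le> 1 - e" "e \<le> snd z" "snd z \<le> 1 - e"
      by (auto simp: mem_Times_iff)
  qed
  have "eventually (\<lambda>k. 1 / e < real (q k)) sequentially"
    using filterlim_compose[OF filterlim_real_sequentially q_lim] by (simp add: filterlim_at_top_dense)
  moreover have "eventually (\<lambda>k. 2 / e < real (r k)) sequentially"
    using filterlim_compose[OF filterlim_real_sequentially r_lim] by (simp add: filterlim_at_top_dense)
  ultimately show ?thesis
  proof eventually_elim
    case (elim k)
    have qr: "1 / q k < e" "2 / r k < e"
      using elim e q_pos[of k] r_pos[of k] by (simp_all add: field_simps)
    define J where "J = {i. i < height k \<and> cell k i \<inter> - V \<noteq> {}}"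
    have J_fin: "finite J" by (simp add: J_def)
    have up: "(\<Union>i\<in>J. cell k i) \<subseteq> U"
    proof
      fix z' assume "z' \<in> (\<Union>i\<in>J. cell k i)"
      then obtain i z where i: "z' \<in> cell k i" "z \<in> cell k i" "z \<in> - V" unfolding J_def by blast
      obtain m m' :: int where "\<bar>fst z - fst z' - of_int m\<bar> < 1 / q k" "\<bar>snd z - snd z' - of_int m'\<bar> < 2 / r k"
        using cell_close[OF i(2,1)] by auto
      then have "\<bar>fst z - fst z' - of_int m\<bar> < e" "\<bar>snd z - snd z' - of_int m'\<bar> < e"
        using qr by linarith+
      moreover have "0 \<le> fst z'" "fst z' < 1" "0 \<le> snd z'" "snd z' < 1"
        using i(1) by (auto simp: cell_def torus_def)
      ultimately have "\<bar>fst z - fst z'\<bar> < e" "\<bar>snd z - snd z'\<bar> < e"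
        using near inner[OF i(3)] by blast+
      then show "z' \<in> U" using ball[OF i(3)] by blast
    qed
    have low: "- V \<subseteq> (\<Union>i\<in>J. cell k i)"
    proof
      fix z assume z: "z \<in> - V"
      then have "z \<in> torus" using K(2) sub by (auto simp: B'_def)
      then show "z \<in> (\<Union>i\<in>J. cell k i)" using z cell_cover[of k] unfolding J_def by blast
    qed
    have [measurable]: "(\<Union>i\<in>J. cell k i) \<in> sets borel" using J_fin by (intro sets.finite_UN) auto
    have null: "emeasure lborel (B - ?I) = 0"
    proof -
      have "B - ?I \<subseteq> {0} \<times> {0..<1} \<union> {0..<1} \<times> {0}"
        using sub by (auto simp: torus_def)
      then have "emeasure lborel (B - ?I) \<le> emeasure lborel ({0} \<times> {0..<1} \<union> {0..<1} \<times> {0} :: (real \<times> real) set)"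
        by (rule emeasure_mono) (auto simp: borel_prod[symmetric])
      also have "\<dots> \<le> emeasure lborel ({0} \<times> {0..<1} :: (real \<times> real) set) + emeasure lborel ({0..<1} \<times> {0} :: (real \<times> real) set)"
        by (rule emeasure_subadditive) (auto simp: borel_prod[symmetric])
      also have "\<dots> = 0" by (subst (1 2) emeasure_lborel_Times) auto
      finally show ?thesis by simp
    qed
    have "sym_diff B (\<Union>i\<in>J. cell k i) \<subseteq> (B - ?I) \<union> ((B' - - V) \<union> (U - B'))"
      using up low by (auto simp: B'_def)
    then have "emeasure lborel (sym_diff B (\<Union>i\<in>J. cell k i)) \<le> emeasure lborel ((B - ?I) \<union> ((B' - - V) \<union> (U - B')))"
      using U(1) V(1) I_open by (intro emeasure_mono) (auto intro!: sets.Un sets.Diff)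
    also have "\<dots> \<le> emeasure lborel (B - ?I) + (emeasure lborel (B' - - V) + emeasure lborel (U - B'))"
      using U(1) V(1) I_open
      by (intro order_trans[OF emeasure_subadditive] add_mono) (auto intro!: sets.Un sets.Diff)
    also have "B' - - V = V - - B'" by auto
    also have "emeasure lborel (V - - B') = emeasure lebesgue (V - - B')" using V(1) by (subst emeasure_completion) auto
    also have "emeasure lborel (U - B') = emeasure lebesgue (U - B')" using U(1) by (subst emeasure_completion) auto
    also have "emeasure lborel (B - ?I) + (emeasure lebesgue (V - - B') + emeasure lebesgue (U - B')) < ennreal (\<epsilon> / 2) + ennreal (\<epsilon> / 2)"
      using U(4) V(4) by (simp add: null add_strict_mono)
    also have "\<dots> = ennreal \<epsilon>" using \<epsilon> by (simp add: ennreal_plus[symmetric] del: ennreal_plus)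
    finally have lt: "emeasure lborel (sym_diff B (\<Union>i\<in>J. cell k i)) < ennreal \<epsilon>" .
    then have ne: "emeasure lborel (sym_diff B (\<Union>i\<in>J. cell k i)) \<noteq> top" by (metis top.extremum_strict)
    have "ennreal (measure lborel (sym_diff B (\<Union>i\<in>J. cell k i))) < ennreal \<epsilon>"
      using lt unfolding emeasure_eq_ennreal_measure[OF ne] .
    then have "measure lborel (sym_diff B (\<Union>i\<in>J. cell k i)) < \<epsilon>"
      by (simp only: ennreal_less_iff measure_nonneg)
    moreover have "J \<subseteq> {..<height k}" by (auto simp: J_def)
    ultimately show ?case by blast
  qed
qed

text \<open>For each \<open>k\<close> the best among the finitely many index sets is taken. Its
  error is below that of any other choice, so the approximation for every fixed
  \<open>\<epsilon>\<close> gives a single sequence with error tending to 0.\<close>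

lemma cells_exhaustive:
  assumes "B \<in> sets borel" "B \<subseteq> torus"
  shows "\<exists>J. (\<forall>k. J k \<subseteq> {..<height k}) \<and>
    (\<lambda>k. measure lborel (sym_diff B (\<Union>i\<in>J k. cell k i))) \<longlonglongrightarrow> 0"
proof -
  define d where "d k J = measure lborel (sym_diff B (\<Union>i\<in>J. cell k i))" for k J
  define J where "J k = arg_min_on (d k) (Pow {..<height k})" for k
  have J_in: "J k \<in> Pow {..<height k}" for k
    unfolding J_def by (rule arg_min_if_finite(1)) auto
  have J_le: "d k (J k) \<le> d k J'" if "J' \<subseteq> {..<height k}" for k J'
    unfolding J_def by (rule arg_min_least) (use that in auto)
  have "(\<lambda>k. d k (J k)) \<longlonglongrightarrow> 0"
  proof (rule order_tendstoI)
    fix e :: real assume "0 < e"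
    from cells_approximate[OF assms this] show "eventually (\<lambda>k. d k (J k) < e) sequentially"
    proof eventually_elim
      case (elim k)
      then obtain J' where "J' \<subseteq> {..<height k}" "d k J' < e" unfolding d_def by blast
      then show ?case using J_le[of J' k] by linarith
    qed
  next
    fix e :: real assume "e < 0"
    then have "e < d k (J k)" for k unfolding d_def by (rule less_le_trans) simp
    then show "eventually (\<lambda>k. e < d k (J k)) sequentially" by simp
  qed
  then show ?thesis unfolding d_def using J_in by (intro exI[of _ J]) auto
qed

end

subsection \<open>Separation of orbits\<close>

text \<open>Over \<open>3 * W\<close> steps each phase advances by less than 1 and crosses an
  integer at most once. Two phases spoil at most two of the three consecutive windows of length
  \<open>W\<close>.\<close>

lemma window_without_wrap:
  fixes z z' s :: real
  assumes "0 < s" "0 < W" "3 * real W * s \<le> 1"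
  obtains a where "t \<le> a" "a + W \<le> t + 3 * W"
    "\<And>m. a \<le> m \<Longrightarrow> m < a + W \<Longrightarrow> \<lfloor>z + real m * s\<rfloor> = \<lfloor>z + real a * s\<rfloor>"
    "\<And>m. a \<le> m \<Longrightarrow> m < a + W \<Longrightarrow> \<lfloor>z' + real m * s\<rfloor> = \<lfloor>z' + real a * s\<rfloor>"
proof -
  define F where "F z m = \<lfloor>z + real m * s\<rfloor>" for z m
  have mono: "F z m \<le> F z m'" if "m \<le> m'" for z m m'
    unfolding F_def using that assms(1) by (intro floor_mono add_left_mono mult_right_mono) auto
  have last: "F z (t + 2 * W + (W - 1)) \<le> F z t + 1" for z
  proof -
    have "real (t + 2 * W + (W - 1)) * s = real t * s + 3 * real W * s - s"
      using assms(2) by (simp add: of_nat_diff algebra_simps)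
    then show ?thesis unfolding F_def using assms(1,3) by linarith
  qed
  have ex: "\<exists>a\<in>{t, t + W, t + 2 * W}. F z (a + (W - 1)) = F z a \<and> F z' (a + (W - 1)) = F z' a"
  proof -
    have "t \<le> t + (W - 1)" "t + (W - 1) \<le> t + W" "t + W \<le> t + W + (W - 1)"
      "t + W + (W - 1) \<le> t + 2 * W" "t + 2 * W \<le> t + 2 * W + (W - 1)" by auto
    note chain = this[THEN mono]
    show ?thesis using chain[of z] chain[of z'] last[of z] last[of z']
      by simp linarith
  qed
  then obtain a where a: "a \<in> {t, t + W, t + 2 * W}" "F z (a + (W - 1)) = F z a" "F z' (a + (W - 1)) = F z' a"
    by blast
  have const: "F z'' m = F z'' a" if "a \<le> m" "m < a + W" "F z'' (a + (W - 1)) = F z'' a" for z'' m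
    using mono[of a m z''] mono[of m "a + (W - 1)" z''] that by auto
  have "t \<le> a" "a + W \<le> t + 3 * W" using a(1) by auto
  then show thesis using const[OF _ _ a(2)] const[OF _ _ a(3)] unfolding F_def by (rule that)
qed

text \<open>At least one twelfth of every block of length \<open>3 * W\<close> is counted, and the
  complete blocks fill at least half of the \<open>n\<close> steps; hence the factor 24.\<close>

lemma card_by_blocks:
  fixes P :: "nat \<Rightarrow> bool"
  assumes W: "0 < W" "3 * W \<le> n" and block: "\<And>t. W \<le> 4 * card {m. t \<le> m \<and> m < t + 3 * W \<and> P m}"
  shows "n \<le> 24 * card {m. m < n \<and> P m}"
proof -
  have blocks: "t * W \<le> 4 * card {m. m < t * (3 * W) \<and> P m}" for t
  proof (induction t)
    case (Suc t)
    let ?L = "{m. m < t * (3 * W) \<and> P m}" and ?R = "{m. t * (3 * W) \<le> m \<and> m < t * (3 * W) + 3 * W \<and> P m}"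
    have "finite ?L" by (rule finite_subset[of _ "{..<t * (3 * W)}"]) auto
    moreover have "finite ?R" by (rule finite_subset[of _ "{..<t * (3 * W) + 3 * W}"]) auto
    moreover have "?L \<inter> ?R = {}" by auto
    ultimately have "card (?L \<union> ?R) = card ?L + card ?R" by (rule card_Un_disjoint)
    moreover have "{m. m < Suc t * (3 * W) \<and> P m} = ?L \<union> ?R" by auto
    ultimately have "card {m. m < Suc t * (3 * W) \<and> P m} = card ?L + card ?R" by simp
    then show ?case using Suc block[of "t * (3 * W)"] by simp
  qed simp
  define t where "t = n div (3 * W)"
  have t: "t * (3 * W) \<le> n" "n < t * (3 * W) + 3 * W"
    unfolding t_def using div_mult_mod_eq[of n "3 * W"] mod_less_divisor[of "3 * W" n] W(1) by linarith+
  have "1 \<le> t" unfolding t_def using W by (simp add: div_greater_zero_iff Suc_le_eq)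
  then have "1 * W \<le> t * W" by (rule mult_right_mono) simp
  moreover have "t * (3 * W) = 3 * (t * W)" by simp
  ultimately have "n \<le> 6 * (t * W)" using t(2) by linarith
  also have "\<dots> \<le> 24 * card {m. m < t * (3 * W) \<and> P m}" using blocks[of t] by linarith
  also have "\<dots> \<le> 24 * card {m. m < n \<and> P m}"
    using t(1) by (intro mult_left_mono card_mono) auto
  finally show ?thesis .
qed

section \<open>Vertical differences of two orbits, level by level\<close>

context skew_parameters
begin

definition code :: "real \<times> real \<Rightarrow> nat \<Rightarrow> nat" where
  "code w m = nat \<lfloor>8 * snd ((T ^^ m) w)\<rfloor>"

abbreviation phase :: "nat \<Rightarrow> real \<Rightarrow> nat \<Rightarrow> real" where
  "phase k x m \<equiv> real (q k) * x + real m * s k"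

text \<open>The Birkhoff sum of \<open>f - \<beta>\<close> over \<open>m\<close> steps, telescoped
  within each level. The levels can be summed because \<open>m\<close> steps change level
  \<open>k\<close> by at most \<open>2 * m / N k\<close>.\<close>

definition \<Psi> :: "nat \<Rightarrow> real \<Rightarrow> real" where
  "\<Psi> m x = (\<Sum>k. real (A k) * (bump (phase k x m) - bump (real (q k) * x)))"

lemma summable_\<Psi>:
  "summable (\<lambda>k. real (A k) * (bump (phase k x m) - bump (real (q k) * x)))"
proof (rule summable_comparison_test[where g="\<lambda>k. real m * (2 / N k)"])
  have "\<bar>real (A k) * (bump (phase k x m) - bump (real (q k) * x))\<bar> \<le> real m * (2 / N k)" for k
  proof -
    have "\<bar>real (A k) * (bump (phase k x m) - bump (real (q k) * x))\<bar> \<le> real m * (A k * s k)"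
      using abs_A_bump_diff[of k "phase k x m" "real (q k) * x"] s_pos[of k]
      by (simp add: abs_mult mult_ac)
    also have "\<dots> \<le> real m * (2 / N k)" using A_s_bounds(2)[of k] by (intro mult_left_mono) auto
    finally show ?thesis .
  qed
  then show "\<exists>n. \<forall>k\<ge>n. norm (real (A k) * (bump (phase k x m) - bump (real (q k) * x))) \<le> real m * (2 / N k)"
    by auto
  show "summable (\<lambda>k. real m * (2 / real (N k)))" by (rule summable_mult) (rule summable_inverse_N)
qed

lemma bump_rotate_n: "bump (real (q k) * (x + real m * \<alpha>) + c) = bump (phase k x m + c)"
proof (induction m arbitrary: x)
  case (Suc m)
  have "bump (real (q k) * (x + real (Suc m) * \<alpha>) + c) = bump (real (q k) * ((x + \<alpha>) + real m * \<alpha>) + c)"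
    by (simp add: algebra_simps)
  also have "\<dots> = bump (real (q k) * (x + \<alpha>) + (real m * s k + c))" by (subst Suc) (simp add: add.assoc)
  also have "\<dots> = bump (phase k x (Suc m) + c)" by (subst bump_rotate) (simp add: algebra_simps)
  finally show ?case .
qed simp

lemma \<Psi>_Suc: "\<Psi> m x + f (frac (x + real m * \<alpha>)) = \<beta> + \<Psi> (Suc m) x"
proof -
  have "f_term k (frac (x + real m * \<alpha>)) =
      real (A k) * (bump (phase k x (Suc m)) - bump (real (q k) * x)) -
      real (A k) * (bump (phase k x m) - bump (real (q k) * x))" for k
  proof -
    have "bump (real (q k) * frac (x + real m * \<alpha>)) = bump (phase k x m)"
      using bump_frac_mult[of "q k" "x + real m * \<alpha>" 0] bump_rotate_n[of k x m 0] by simp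
    moreover have "bump (real (q k) * frac (x + real m * \<alpha>) + s k) = bump (phase k x (Suc m))"
      unfolding bump_frac_mult bump_rotate_n by (simp add: algebra_simps)
    ultimately show ?thesis by (simp only: f_term_def) (simp add: right_diff_distrib)
  qed
  then have "(\<Sum>k. f_term k (frac (x + real m * \<alpha>))) = \<Psi> (Suc m) x - \<Psi> m x"
    unfolding \<Psi>_def by (simp only:) (rule suminf_diff[OF summable_\<Psi> summable_\<Psi>, symmetric])
  then show ?thesis by (simp add: f_def)
qed

lemma funpow_T:
  assumes "w \<in> torus"
  shows "(T ^^ m) w = (frac (fst w + real m * \<alpha>), frac (snd w + real m * \<beta> + \<Psi> m (fst w)))"
proof (induction m)
  case 0
  then show ?case using assms by (auto simp: \<Psi>_def torus_def frac_eq)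
next
  case (Suc m)
  have "snd w + real m * \<beta> + \<Psi> m (fst w) + f (frac (fst w + real m * \<alpha>)) = snd w + real (Suc m) * \<beta> + \<Psi> (Suc m) (fst w)"
    using \<Psi>_Suc[of m "fst w"] by (simp add: algebra_simps)
  then show ?case using Suc by (simp add: T_def skew_def algebra_simps)
qed

text \<open>Equal codes put both points in one strip of height \<open>1 / 8\<close>. The drift
  \<open>m * \<beta>\<close> is common to both orbits and cancels.\<close>

lemma code_eq_imp_close:
  assumes "w \<in> torus" "w' \<in> torus" "code w m = code w' m"
  shows "\<exists>i::int. \<bar>(snd w' + \<Psi> m (fst w')) - (snd w + \<Psi> m (fst w)) - i\<bar> < 1 / 8"
proof -
  let ?y = "\<lambda>w. snd w + real m * \<beta> + \<Psi> m (fst w)"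
  have "nat \<lfloor>8 * frac (?y w)\<rfloor> = nat \<lfloor>8 * frac (?y w')\<rfloor>"
    using assms by (simp add: code_def funpow_T)
  moreover have "\<lfloor>8 * frac (?y w)\<rfloor> \<ge> 0" "\<lfloor>8 * frac (?y w')\<rfloor> \<ge> 0" by auto
  ultimately have "\<lfloor>8 * frac (?y w)\<rfloor> = \<lfloor>8 * frac (?y w')\<rfloor>" by linarith
  then have "\<bar>frac (?y w') - frac (?y w)\<bar> < 1 / 8" by linarith
  then have "\<bar>?y w' - ?y w - of_int (\<lfloor>?y w'\<rfloor> - \<lfloor>?y w\<rfloor>)\<bar> < 1 / 8" by (simp add: frac_def algebra_simps)
  then show ?thesis by (intro exI[of _ "\<lfloor>?y w'\<rfloor> - \<lfloor>?y w\<rfloor>"]) (simp add: algebra_simps)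
qed

text \<open>The contribution of level \<open>k\<close> to the vertical difference at time
  \<open>m\<close>. These contributions need not be summable over \<open>k\<close>, but their
  increments in time are; therefore all estimates compare two times.\<close>

definition \<Delta> :: "real \<Rightarrow> real \<Rightarrow> nat \<Rightarrow> nat \<Rightarrow> real" where
  "\<Delta> x x' k m = real (A k) * (bump (phase k x' m) - bump (phase k x m))"

lemma \<Psi>_diff:
  "summable (\<lambda>k. \<Delta> x x' k (m + d) - \<Delta> x x' k m)"
  "(\<Psi> (m + d) x' - \<Psi> (m + d) x) - (\<Psi> m x' - \<Psi> m x) = (\<Sum>k. \<Delta> x x' k (m + d) - \<Delta> x x' k m)"
proof -
  let ?a = "\<lambda>m x k. real (A k) * (bump (phase k x m) - bump (real (q k) * x))"
  have eq: "\<Delta> x x' k (m + d) - \<Delta> x x' k m = (?a (m + d) x' k - ?a (m + d) x k) - (?a m x' k - ?a m x k)" for k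
    by (simp add: \<Delta>_def algebra_simps)
  show "summable (\<lambda>k. \<Delta> x x' k (m + d) - \<Delta> x x' k m)"
    unfolding eq by (intro summable_diff summable_\<Psi>)
  show "(\<Psi> (m + d) x' - \<Psi> (m + d) x) - (\<Psi> m x' - \<Psi> m x) = (\<Sum>k. \<Delta> x x' k (m + d) - \<Delta> x x' k m)"
    unfolding eq \<Psi>_def
    by (simp only: suminf_diff[OF summable_diff[OF summable_\<Psi> summable_\<Psi>] summable_diff[OF summable_\<Psi> summable_\<Psi>], symmetric]
        suminf_diff[OF summable_\<Psi> summable_\<Psi>, symmetric])
qed

text \<open>Over times below \<open>1 / s j\<close> the lower levels are insensitive to a displacement below
  \<open>1 / q j\<close> and the higher levels hardly move, so only level \<open>j\<close> contributes.\<close>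

lemma \<Psi>_diff_level:
  assumes close: "\<bar>x' - x\<bar> \<le> 1 / q j" and d: "3 * real d * s j \<le> 1"
  shows "\<bar>(\<Psi> (m + d) x' - \<Psi> (m + d) x) - (\<Psi> m x' - \<Psi> m x) - (\<Delta> x x' j (m + d) - \<Delta> x x' j m)\<bar> \<le> 3 / 16"
proof -
  let ?g = "\<lambda>k. \<Delta> x x' k (m + d) - \<Delta> x x' k m"
  have "(\<Sum>k. ?g k) = (\<Sum>n. ?g (n + Suc j)) + (\<Sum>k<Suc j. ?g k)"
    by (rule suminf_split_initial_segment) (rule \<Psi>_diff)
  then have split: "(\<Sum>k. ?g k) - ?g j = (\<Sum>k<j. ?g k) + (\<Sum>n. ?g (n + Suc j))" by simp
  have low: "\<bar>\<Sum>k<j. ?g k\<bar> \<le> 1 / 32"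
  proof -
    have "\<bar>?g k\<bar> \<le> real (A k * q k) * (2 * \<bar>x' - x\<bar>)" for k
    proof -
      have "\<bar>\<Delta> x x' k m\<bar> \<le> real (A k * q k) * \<bar>x' - x\<bar>" for m
        using abs_A_bump_diff[of k "phase k x' m" "phase k x m"]
        by (simp add: \<Delta>_def abs_mult flip: right_diff_distrib)
      from this[of m] this[of "m + d"] show ?thesis by (simp add: abs_le_iff)
    qed
    then have "\<bar>\<Sum>k<j. ?g k\<bar> \<le> (\<Sum>k<j. real (A k * q k) * (2 * \<bar>x' - x\<bar>))"
      by (intro order_trans[OF sum_abs] sum_mono)
    also have "\<dots> \<le> q j / r j * (2 * (1 / q j))"
      unfolding sum_distrib_right[symmetric] using close
      by (intro mult_mono sum_A_q_le) auto
    also have "\<dots> = 2 / r j" using q_pos[of j] by simp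
    also have "\<dots> \<le> 1 / 32" using r_ge[of j] by (simp add: field_simps)
    finally show ?thesis .
  qed
  have high: "\<bar>\<Sum>n. ?g (n + Suc j)\<bar> \<le> 1 / 8"
  proof -
    have g: "\<bar>?g k\<bar> \<le> (2 * real d) * (2 / N k)" for k
    proof -
      have "\<bar>real (A k) * (bump (phase k y (m + d)) - bump (phase k y m))\<bar> \<le> real d * (2 / N k)" for y
      proof -
        have "\<bar>real (A k) * (bump (phase k y (m + d)) - bump (phase k y m))\<bar> \<le> real d * (A k * s k)"
          using abs_A_bump_diff[of k "phase k y (m + d)" "phase k y m"] s_pos[of k]
          by (simp add: abs_mult distrib_right mult_ac)
        also have "\<dots> \<le> real d * (2 / N k)" using A_s_bounds(2)[of k] by (intro mult_left_mono) auto
        finally show ?thesis .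
      qed
      note step = this
      have "?g k = real (A k) * (bump (phase k x' (m + d)) - bump (phase k x' m)) -
          real (A k) * (bump (phase k x (m + d)) - bump (phase k x m))"
        by (simp add: \<Delta>_def right_diff_distrib)
      then show ?thesis using step[of x] step[of x'] unfolding mult.assoc by linarith
    qed
    have "\<bar>\<Sum>n. ?g (n + Suc j)\<bar> \<le> (\<Sum>n. (2 * real d) * (2 / N (n + Suc j)))"
      by (rule norm_suminf_le[where 'a=real, unfolded real_norm_def])
        (rule g, rule summable_mult, rule summable_ignore_initial_segment[OF summable_inverse_N])
    also have "\<dots> = (2 * real d) * (\<Sum>n. 2 / N (n + Suc j))"
      by (rule suminf_mult) (rule summable_ignore_initial_segment[OF summable_inverse_N])
    also have "\<dots> \<le> (2 * real d) * (4 / N (Suc j))"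
      by (intro mult_left_mono inverse_N_tail) auto
    \<comment> \<open>The bound on \<open>d\<close> and \<open>s j \<ge> 1 / (A j * N j)\<close>
      give \<open>3 * d \<le> A j * N j\<close>, and \<open>N (j + 1)\<close> is at least 64 times
      that product.\<close>
    also have "\<dots> \<le> 1 / 8"
    proof -
      have "real d * (1 / (A j * N j)) \<le> real d * s j" using s_bounds(1)[of j] by (intro mult_left_mono) auto
      moreover have "3 * (real d * s j) \<le> 1" using d by (simp only: mult.assoc)
      ultimately have "real d * (1 / real (A j * N j)) \<le> 1 / 3" by linarith
      then have "real d / real (A j * N j) \<le> 1 / 3" by (simp only: times_divide_eq_right mult_1_right)
      moreover have "0 < real (A j * N j)" using A_pos[of j] N_pos[of j] by simp
      ultimately have "3 * real d \<le> real (A j * N j)" by (simp add: pos_divide_le_eq)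
      moreover have "64 * real (A j * N j) \<le> real (N (Suc j))"
        using N_Suc_ge(1)[of j] by (simp flip: of_nat_mult)
      ultimately have "64 * real d \<le> N (Suc j)" by linarith
      then show ?thesis using N_pos[of "Suc j"] by (simp add: field_simps)
    qed
    finally show ?thesis .
  qed
  show ?thesis unfolding \<Psi>_diff(2) split using low high by linarith
qed

text \<open>Without a wrap both fractional parts grow by \<open>h = d * s j\<close>. In the second
  difference of \<open>z * (1 - z)\<close> the terms in \<open>h\<close> alone and in the square of
  \<open>h\<close> cancel; the mixed term remains and is linear in \<open>d\<close>.\<close>

lemma \<Delta>_diff_window:
  assumes "\<lfloor>phase j x (m + d)\<rfloor> = \<lfloor>phase j x m\<rfloor>"
    and "\<lfloor>phase j x' (m + d)\<rfloor> = \<lfloor>phase j x' m\<rfloor>"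
  shows "\<Delta> x x' j (m + d) - \<Delta> x x' j m =
    - (2 * A j * s j * d) * (frac (phase j x' m) - frac (phase j x m))"
proof -
  have "frac (phase j y (m + d)) = frac (phase j y m) + real d * s j"
    if "\<lfloor>phase j y (m + d)\<rfloor> = \<lfloor>phase j y m\<rfloor>" for y
    using that by (simp add: frac_def algebra_simps)
  from this[OF assms(1)] this[OF assms(2)] show ?thesis
    by (simp add: \<Delta>_def bump_def) (simp add: algebra_simps)
qed

text \<open>The vertical difference drifts at constant speed \<open>\<theta>\<close>, up to an error
  of \<open>3 / 16\<close>. After the time \<open>d\<close> in which it moves by about one half, it
  cannot again be close to an integer, so the codes differ at one of the times \<open>m\<close> and
  \<open>m + d\<close>.\<close>

lemma codes_differ_in_window:
  assumes w: "w \<in> torus" "w' \<in> torus" and close: "\<bar>fst w' - fst w\<bar> \<le> 1 / q j"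
    and W: "0 < W" "3 * real W * s j \<le> 1"
    and far: "\<And>i::int. 1 / (2 * A j * s j * W) < \<bar>real (q j) * (fst w' - fst w) - i\<bar>"
    and const: "\<And>m. a \<le> m \<Longrightarrow> m < a + W \<Longrightarrow> \<lfloor>phase j (fst w) m\<rfloor> = \<lfloor>phase j (fst w) a\<rfloor>"
      "\<And>m. a \<le> m \<Longrightarrow> m < a + W \<Longrightarrow> \<lfloor>phase j (fst w') m\<rfloor> = \<lfloor>phase j (fst w') a\<rfloor>"
  shows "W \<le> 4 * card {m. a \<le> m \<and> m < a + W \<and> code w m \<noteq> code w' m}"
proof -
  let ?x = "fst w" and ?x' = "fst w'"
  define i where "i = \<lfloor>phase j ?x' a\<rfloor> - \<lfloor>phase j ?x a\<rfloor>"
  define \<gamma> where "\<gamma> = real (q j) * (?x' - ?x) - of_int i"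
  define \<theta> where "\<theta> = 2 * A j * s j * \<bar>\<gamma>\<bar>"
  have frac_diff: "frac (phase j ?x' m) - frac (phase j ?x m) = \<gamma>"
    if "a \<le> m" "m < a + W" for m
    using const(1)[OF that] const(2)[OF that] by (simp add: frac_def \<gamma>_def i_def algebra_simps)
  have As: "0 < A j * s j" using A_pos[of j] s_pos[of j] by simp
  have "\<bar>\<gamma>\<bar> \<le> 1"
    using frac_diff[of a] W(1) frac_ge_0[of "phase j ?x' a"] frac_ge_0[of "phase j ?x a"]
      frac_lt_1[of "phase j ?x' a"] frac_lt_1[of "phase j ?x a"] by linarith
  then have "\<theta> \<le> 2 * (A j * s j) * 1" unfolding \<theta>_def using As mult_left_mono[of "\<bar>\<gamma>\<bar>" 1 "2 * (A j * s j)"] by (simp add: mult.assoc)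
  also have "\<dots> \<le> 1 / 16"
  proof -
    have "2 / real (N j) \<le> 1 / 32" using N_large(2)[of j] by (simp add: field_simps)
    then show ?thesis using A_s_bounds(2)[of j] by linarith
  qed
  finally have \<theta>_le: "\<theta> \<le> 1 / 16" .
  have "1 / (2 * (A j * s j * W)) < \<bar>\<gamma>\<bar>" using far[of i] by (simp add: \<gamma>_def mult.assoc)
  then have \<theta>W: "1 < \<theta> * W" unfolding \<theta>_def using As W(1) by (simp add: field_simps)
  then have \<theta>_pos: "0 < \<theta>" by (smt (verit) W(1) of_nat_0_less_iff mult_nonpos_nonneg)
  \<comment> \<open>The largest time with drift at most \<open>1 / 2\<close>. Because
    \<open>\<theta> \<le> 1 / 16\<close> the drift over \<open>d\<close> steps is also at least
    \<open>7 / 16\<close>, and \<open>1 < \<theta> * W\<close> leaves room for \<open>d\<close> in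
    half of the window.\<close>
  define d where "d = nat \<lfloor>1 / (2 * \<theta>)\<rfloor>"
  have "real d = of_int \<lfloor>1 / (2 * \<theta>)\<rfloor>" using \<theta>_pos by (simp add: d_def)
  then have d: "real d \<le> 1 / (2 * \<theta>)" "1 / (2 * \<theta>) < real d + 1" by linarith+
  then have d\<theta>: "d * \<theta> \<le> 1 / 2" "1 / 2 < d * \<theta> + \<theta>" using \<theta>_pos by (auto simp: field_simps)
  have dW: "2 * d \<le> W"
  proof -
    have "2 * (d * \<theta>) < \<theta> * W" using d\<theta> \<theta>W by linarith
    then have "2 * real d < W" using \<theta>_pos by (simp add: mult.commute mult.left_commute)
    then show ?thesis by linarith
  qed
  define D where "D = {m. a \<le> m \<and> m < a + W \<and> code w m \<noteq> code w' m}"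
  have D_fin: "finite D" unfolding D_def by (rule finite_subset[of _ "{..<a + W}"]) auto
  have "m \<in> D \<or> m + d \<in> D" if m: "a \<le> m" "m < a + (W - d)" for m
  proof (rule ccontr)
    assume "\<not> (m \<in> D \<or> m + d \<in> D)"
    then have same: "code w m = code w' m" "code w (m + d) = code w' (m + d)"
      using m by (auto simp: D_def)
    obtain i1 i2 :: int where
      "\<bar>(snd w' + \<Psi> m ?x') - (snd w + \<Psi> m ?x) - i1\<bar> < 1 / 8"
      "\<bar>(snd w' + \<Psi> (m + d) ?x') - (snd w + \<Psi> (m + d) ?x) - i2\<bar> < 1 / 8"
      using code_eq_imp_close[OF w same(1)] code_eq_imp_close[OF w same(2)] by blast
    then have i12: "\<bar>(\<Psi> (m + d) ?x' - \<Psi> (m + d) ?x) - (\<Psi> m ?x' - \<Psi> m ?x) - of_int (i2 - i1)\<bar> < 1 / 4"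
      unfolding of_int_diff by linarith
    have "3 * real d * s j \<le> 3 * real W * s j" using dW s_pos[of j] by (intro mult_right_mono) auto
    then have "3 * real d * s j \<le> 1" using W(2) by linarith
    note level = \<Psi>_diff_level[OF close this, of m]
    have "\<lfloor>phase j ?x (m + d)\<rfloor> = \<lfloor>phase j ?x m\<rfloor>"
      "\<lfloor>phase j ?x' (m + d)\<rfloor> = \<lfloor>phase j ?x' m\<rfloor>"
      using const(1)[of m] const(1)[of "m + d"] const(2)[of m] const(2)[of "m + d"] m by simp_all
    then have "\<Delta> ?x ?x' j (m + d) - \<Delta> ?x ?x' j m = - (2 * A j * s j * d) * \<gamma>"
      by (subst \<Delta>_diff_window) (use frac_diff[of m] m in auto)
    then have "\<bar>\<Delta> ?x ?x' j (m + d) - \<Delta> ?x ?x' j m\<bar> = d * \<theta>"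
      using s_pos[of j] by (simp add: \<theta>_def abs_mult mult_ac)
    then have "\<bar>\<bar>(\<Psi> (m + d) ?x' - \<Psi> (m + d) ?x) - (\<Psi> m ?x' - \<Psi> m ?x)\<bar> - d * \<theta>\<bar> \<le> 3 / 16"
      using level by linarith
    \<comment> \<open>The true change lies between \<open>7 / 16 - 3 / 16\<close> and
      \<open>1 / 2 + 3 / 16\<close>, hence at distance at least \<open>1 / 4\<close> from all
      integers, whereas equal codes at both times would put it strictly closer to one.\<close>
    then have *: "1 / 4 \<le> \<bar>(\<Psi> (m + d) ?x' - \<Psi> (m + d) ?x) - (\<Psi> m ?x' - \<Psi> m ?x)\<bar>"
      "\<bar>(\<Psi> (m + d) ?x' - \<Psi> (m + d) ?x) - (\<Psi> m ?x' - \<Psi> m ?x)\<bar> \<le> 3 / 4"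
      using d\<theta> \<theta>_le by linarith+
    have "i2 - i1 = 0 \<or> \<bar>of_int (i2 - i1) :: real\<bar> \<ge> 1" by linarith
    then show False using * i12 by (elim disjE) linarith+
  qed
  \<comment> \<open>Each of the \<open>W - d \<ge> W / 2\<close> starting times is charged to a time
    in \<open>D\<close>, and each time in \<open>D\<close> is charged at most twice.\<close>
  then have sub: "{a..<a + (W - d)} \<subseteq> D \<union> (\<lambda>m. m - d) ` D" by force
  have "W - d = card {a..<a + (W - d)}" by simp
  also have "\<dots> \<le> card (D \<union> (\<lambda>m. m - d) ` D)" using sub D_fin by (intro card_mono) auto
  also have "\<dots> \<le> card D + card ((\<lambda>m. m - d) ` D)" by (rule card_Un_le)
  also have "\<dots> \<le> 2 * card D" using card_image_le[OF D_fin, of "\<lambda>m. m - d"] by simp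
  finally show ?thesis using dW unfolding D_def by linarith
qed

text \<open>If the phases stay apart modulo 1, a window without wraps in every block of
  \<open>3 * W\<close> steps produces enough differing codes; adding up the blocks exceeds the
  frequency \<open>1 / 24\<close>.\<close>

lemma level_separation:
  assumes w: "w \<in> torus" "w' \<in> torus" and close: "\<bar>fst w' - fst w\<bar> \<le> 1 / q j"
    and W: "0 < W" "3 * real W * s j \<le> 1" "3 * W \<le> n"
    and near: "hamming_dist n (code w) (code w') < 1 / 24"
  shows "\<exists>i::int. \<bar>real (q j) * (fst w' - fst w) - i\<bar> \<le> 1 / (2 * A j * s j * W)"
proof (rule ccontr)
  assume "\<not> ?thesis"
  then have far: "\<And>i::int. 1 / (2 * A j * s j * W) < \<bar>real (q j) * (fst w' - fst w) - i\<bar>"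
    by (simp add: not_le)
  have "W \<le> 4 * card {m. t \<le> m \<and> m < t + 3 * W \<and> code w m \<noteq> code w' m}" for t
  proof -
    obtain a where a: "t \<le> a" "a + W \<le> t + 3 * W"
      and const: "\<And>m. a \<le> m \<Longrightarrow> m < a + W \<Longrightarrow> \<lfloor>phase j (fst w) m\<rfloor> = \<lfloor>phase j (fst w) a\<rfloor>"
      "\<And>m. a \<le> m \<Longrightarrow> m < a + W \<Longrightarrow> \<lfloor>phase j (fst w') m\<rfloor> = \<lfloor>phase j (fst w') a\<rfloor>"
      using window_without_wrap[OF s_pos[of j] W(1,2)] by blast
    have "W \<le> 4 * card {m. a \<le> m \<and> m < a + W \<and> code w m \<noteq> code w' m}"
      by (rule codes_differ_in_window[OF w close W(1,2) far const])
    also have "\<dots> \<le> 4 * card {m. t \<le> m \<and> m < t + 3 * W \<and> code w m \<noteq> code w' m}"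
      using a by (intro mult_left_mono card_mono) auto
    finally show ?thesis .
  qed
  then have "n \<le> 24 * card {m. m < n \<and> code w m \<noteq> code w' m}" by (rule card_by_blocks[OF W(1,3)])
  then have "real n \<le> 24 * real (card {m. m < n \<and> code w m \<noteq> code w' m})" by linarith
  moreover have "0 < n" using W by linarith
  ultimately show False using near by (simp add: hamming_dist_def field_simps)
qed

end

section \<open>Covering sets of first coordinates by short intervals\<close>

definition covered :: "real set \<Rightarrow> nat \<Rightarrow> real \<Rightarrow> bool" where
  "covered E n l \<longleftrightarrow> (\<exists>C. finite C \<and> card C \<le> n \<and> E \<subseteq> (\<Union>c\<in>C. {c..c + l}))"

lemma covered_unit:
  assumes "0 < n" "E \<subseteq> {0..<1}"
  shows "covered E n (1 / real n)"
  unfolding covered_def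
proof (intro exI[of _ "(\<lambda>i. real i / real n) ` {..<n}"] conjI)
  show "card ((\<lambda>i. real i / real n) ` {..<n}) \<le> n" using card_image_le[of "{..<n}"] by fastforce
  show "E \<subseteq> (\<Union>c\<in>(\<lambda>i. real i / real n) ` {..<n}. {c..c + 1 / real n})"
  proof
    fix x assume "x \<in> E"
    then have x: "0 \<le> x" "x < 1" using assms(2) by auto
    define i where "i = nat \<lfloor>real n * x\<rfloor>"
    have i: "real i \<le> real n * x" "real n * x < real i + 1"
      using x by (auto simp: i_def)
    have "real n * x < real n * 1" using x assms(1) by (intro mult_strict_left_mono) auto
    then have "i < n" using i by linarith
    moreover have "x \<in> {real i / real n..real i / real n + 1 / real n}"
      using i assms(1) by (simp add: field_simps)
    ultimately show "x \<in> (\<Union>c\<in>(\<lambda>i. real i / real n) ` {..<n}. {c..c + 1 / real n})" by blast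
  qed
qed simp

text \<open>Inside one interval, every point of \<open>E\<close> lies within
  \<open>\<rho> / Q\<close> of a multiple of \<open>1 / Q\<close> counted from a reference point of
  \<open>E\<close>. The interval is at most \<open>1 / Q\<close> long, so only the multiples -1, 0
  and 1 occur.\<close>

lemma covered_refine:
  assumes "covered E n l" and Q: "0 < Q" "Q * l \<le> 1" "\<rho> < 1"
    and sep: "\<And>x x'. x \<in> E \<Longrightarrow> x' \<in> E \<Longrightarrow> \<bar>x' - x\<bar> \<le> l \<Longrightarrow> \<exists>i::int. \<bar>Q * (x' - x) - i\<bar> \<le> \<rho>"
  shows "covered E (3 * n) (2 * \<rho> / Q)"
proof -
  obtain C where C: "finite C" "card C \<le> n" "E \<subseteq> (\<Union>c\<in>C. {c..c + l})"
    using assms(1) unfolding covered_def by blast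
  define z where "z c = (SOME x. x \<in> E \<inter> {c..c + l})" for c
  have z: "z c \<in> E \<inter> {c..c + l}" if "x \<in> E \<inter> {c..c + l}" for x c
    unfolding z_def using that by (rule someI)
  define h where "h = (\<lambda>(c, i::int). z c + (of_int i - \<rho>) / Q)"
  have "card (h ` (C \<times> {-1..1})) \<le> card (C \<times> {-1..1::int})" by (rule card_image_le) (use C in auto)
  also have "\<dots> \<le> 3 * n" using C by (simp add: card_cartesian_product)
  finally have "card (h ` (C \<times> {-1..1})) \<le> 3 * n" .
  moreover have "E \<subseteq> (\<Union>c\<in>h ` (C \<times> {-1..1}). {c..c + 2 * \<rho> / Q})"
  proof
    fix x assume x: "x \<in> E"
    then obtain c where c: "c \<in> C" "x \<in> {c..c + l}" using C by blast
    then have zc: "z c \<in> E" "z c \<in> {c..c + l}" using z[of x c] x by auto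
    have zx: "\<bar>x - z c\<bar> \<le> l" using c(2) zc(2) by auto
    then obtain i :: int where i: "\<bar>Q * (x - z c) - i\<bar> \<le> \<rho>" using sep[OF zc(1) x] by blast
    have "\<bar>Q * (x - z c)\<bar> \<le> Q * l" using zx Q by (simp add: abs_mult)
    then have "\<bar>real_of_int i\<bar> < 2" using i Q by linarith
    then have "i \<in> {-1..1}" by simp linarith
    moreover have "x \<in> {h (c, i)..h (c, i) + 2 * \<rho> / Q}"
    proof -
      have "of_int i - \<rho> \<le> Q * (x - z c)" "Q * (x - z c) \<le> of_int i + \<rho>" using i by linarith+
      then have "(of_int i - \<rho>) / Q \<le> x - z c" "x - z c \<le> (of_int i + \<rho>) / Q"
        using Q(1) by (simp_all add: pos_divide_le_eq pos_le_divide_eq mult.commute)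
      then show ?thesis by (simp add: h_def add_divide_distrib diff_divide_distrib)
    qed
    ultimately show "x \<in> (\<Union>c\<in>h ` (C \<times> {-1..1}). {c..c + 2 * \<rho> / Q})" using c(1) by blast
  qed
  ultimately show ?thesis unfolding covered_def using C(1) by (intro exI[of _ "h ` (C \<times> {-1..1})"]) auto
qed

lemma covered_split:
  assumes "covered E n (real m * l)" "0 < l" "0 < m"
  shows "covered E (n * m) l"
proof -
  obtain C where C: "finite C" "card C \<le> n" "E \<subseteq> (\<Union>c\<in>C. {c..c + real m * l})"
    using assms(1) unfolding covered_def by blast
  define h where "h = (\<lambda>(c, j). c + real j * l)"
  have "card (h ` (C \<times> {..<m})) \<le> card (C \<times> {..<m})" by (rule card_image_le) (use C in auto)
  also have "\<dots> \<le> n * m" using C by (simp add: card_cartesian_product)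
  finally have "card (h ` (C \<times> {..<m})) \<le> n * m" .
  moreover have "E \<subseteq> (\<Union>c\<in>h ` (C \<times> {..<m}). {c..c + l})"
  proof
    fix x assume "x \<in> E"
    then obtain c where c: "c \<in> C" "c \<le> x" "x \<le> c + real m * l" using C by auto
    \<comment> \<open>The cap at \<open>m - 1\<close> assigns the right endpoint of the closed long
      interval to the last short one.\<close>
    define j where "j = min (nat \<lfloor>(x - c) / l\<rfloor>) (m - 1)"
    have fl: "real (nat \<lfloor>(x - c) / l\<rfloor>) \<le> (x - c) / l" "(x - c) / l < real (nat \<lfloor>(x - c) / l\<rfloor>) + 1"
      using c(2) assms(2) by auto
    have m: "(x - c) / l \<le> real m" using c(3) assms(2) by (simp add: pos_divide_le_eq)
    have "real j \<le> (x - c) / l" using fl(1) by (simp add: j_def min_def)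
    moreover have "(x - c) / l \<le> real j + 1"
      using fl(2) m assms(3) by (simp add: j_def min_def of_nat_diff)
    ultimately have "real j * l \<le> x - c" "x - c \<le> (real j + 1) * l"
      using assms(2) by (simp_all add: pos_divide_le_eq pos_le_divide_eq)
    then have "x \<in> {h (c, j)..h (c, j) + l}" by (simp add: h_def algebra_simps)
    moreover have "j < m" using assms(3) by (simp add: j_def)
    ultimately show "x \<in> (\<Union>c\<in>h ` (C \<times> {..<m}). {c..c + l})" using c(1) by blast
  qed
  ultimately show ?thesis unfolding covered_def using C(1) by (intro exI[of _ "h ` (C \<times> {..<m})"]) auto
qed

lemma covered_measure:
  assumes "covered E n l" "0 \<le> l"
  shows "\<exists>B\<in>sets borel. {w \<in> torus. fst w \<in> E} \<subseteq> B \<and> emeasure lborel B \<le> ennreal (real n * l)"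
proof -
  obtain C where C: "finite C" "card C \<le> n" "E \<subseteq> (\<Union>c\<in>C. {c..c + l})"
    using assms(1) unfolding covered_def by blast
  define B where "B = (\<Union>c\<in>C. {c..c + l} \<times> {0..<1::real})"
  have [measurable]: "{c..c + l} \<times> {0..<1::real} \<in> sets borel" for c
    unfolding borel_prod[symmetric] by measurable
  have "B \<in> sets borel" unfolding B_def using C(1) by (intro sets.finite_UN) auto
  moreover have "{w \<in> torus. fst w \<in> E} \<subseteq> B" using C(3) by (force simp: torus_def B_def)
  moreover have "emeasure lborel B \<le> ennreal (real n * l)"
  proof -
    have "emeasure lborel B \<le> (\<Sum>c\<in>C. emeasure lborel ({c..c + l} \<times> {0..<1::real}))"
      unfolding B_def using C(1) by (intro emeasure_subadditive_finite) auto
    also have "\<dots> = ennreal (real (card C) * l)"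
      using assms(2) by (subst emeasure_lborel_Times) (auto simp: ennreal_of_nat_eq_real_of_nat ennreal_mult')
    also have "\<dots> \<le> ennreal (real n * l)"
      using C(2) assms(2) by (intro ennreal_leI mult_right_mono) auto
    finally show ?thesis .
  qed
  ultimately show ?thesis by blast
qed

context skew_parameters
begin

lemma level_separation_time:
  assumes w: "w \<in> torus" "w' \<in> torus" and close: "\<bar>fst w' - fst w\<bar> \<le> 1 / q j"
    and v: "24 \<le> v" "v \<le> A j * N j" "v \<le> n"
    and near: "hamming_dist n (code w) (code w') < 1 / 24"
  shows "\<exists>i::int. \<bar>real (q j) * (fst w' - fst w) - i\<bar> \<le> 4 * N j / v"
proof -
  \<comment> \<open>\<open>s j \<le> 2 / (A j * N j)\<close> allows windows of length up to
    \<open>A j * N j / 6\<close>. Rounding down costs little as \<open>v \<ge> 24\<close>, whence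
    \<open>v \<le> 8 * W\<close>.\<close>
  define W where "W = v div 6"
  have W: "0 < W" "6 * W \<le> v" "v \<le> 8 * W" using v(1) unfolding W_def by linarith+
  have "3 * real W * s j \<le> 3 * real W * (2 / (A j * N j))"
    using s_bounds(2)[of j] by (intro mult_left_mono) auto
  also have "\<dots> = real (6 * W) / real (A j * N j)" by simp
  also have "\<dots> \<le> 1" using W(2) v(2) A_pos[of j] N_pos[of j] by (simp add: pos_divide_le_eq flip: of_nat_mult)
  finally have "3 * real W * s j \<le> 1" .
  moreover have "3 * W \<le> n" using W v by linarith
  ultimately obtain i :: int where i: "\<bar>real (q j) * (fst w' - fst w) - i\<bar> \<le> 1 / (2 * A j * s j * W)"
    using level_separation[OF w close W(1) _ _ near] by blast
  have "v * (1 / N j) \<le> (8 * W) * (A j * s j)"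
    using W(3) A_s_bounds(1)[of j] by (intro mult_mono) (auto simp flip: of_nat_mult)
  then have "v \<le> 8 * (A j * s j * W) * N j" using N_pos[of j] by (simp add: field_simps)
  moreover have "0 < A j * s j * W" using A_pos[of j] s_pos[of j] W(1) by simp
  ultimately have "1 / (2 * (A j * s j * W)) \<le> 4 * N j / v"
    using v(1) by (simp add: field_simps)
  with i show ?thesis by (intro exI[of _ i]) (simp add: mult.assoc)
qed

text \<open>Level \<open>k\<close> at time \<open>A k * N k\<close> confines the first coordinates
  of a ball to \<open>3 * q k\<close> intervals of total length \<open>24 / A k\<close>. Cut to
  length \<open>1 / q (k + 1)\<close>, these can be refined by level \<open>k + 1\<close> at time
  \<open>n\<close>, which gains a further factor \<open>24 * N (k + 1) / n\<close>; the product of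
  the constants is 576. The radius \<open>1 / 48\<close> makes any two members closer than
  \<open>1 / 24\<close>.\<close>

lemma hamming_ball_small:
  assumes w: "w \<in> torus" and n: "A k * N k \<le> n" "n \<le> A (Suc k) * N (Suc k)"
  shows "\<exists>B\<in>sets borel. {w' \<in> torus. hamming_dist n (code w) (code w') < 1 / 48} \<subseteq> B \<and>
    emeasure lborel B \<le> ennreal (576 / A k * min 1 (N (Suc k) / n))"
proof -
  \<comment> \<open>No measurability of this projection is claimed; it is only ever covered by
    intervals.\<close>
  define E where "E = fst ` {w' \<in> torus. hamming_dist n (code w) (code w') < 1 / 48}"
  have pos: "0 < q k" "0 < q (Suc k)" "0 < A k" "0 < N k" "0 < N (Suc k)"
    by (rule q_pos q_pos A_pos N_pos N_pos)+
  have AN: "24 \<le> A k * N k"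
    using mult_mono[of 24 "A k" 1 "N k"] A_ge(2)[of k] pos by simp
  have sep: "\<exists>i::int. \<bar>real (q j) * (x' - x) - i\<bar> \<le> 4 * N j / v"
    if x: "x \<in> E" "x' \<in> E" "\<bar>x' - x\<bar> \<le> 1 / q j" and v: "24 \<le> v" "v \<le> A j * N j" "v \<le> n" for x x' j v
  proof -
    obtain w1 w2 where 12: "w1 \<in> torus" "hamming_dist n (code w) (code w1) < 1 / 48" "x = fst w1"
      "w2 \<in> torus" "hamming_dist n (code w) (code w2) < 1 / 48" "x' = fst w2"
      using x(1,2) unfolding E_def by blast
    have "hamming_dist n (code w1) (code w2) < 1 / 24"
      using hamming_dist_triangle[of n "code w1" "code w2" "code w"] 12 by linarith
    then show ?thesis using level_separation_time[OF 12(1,4) _ v] x(3) 12 by blast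
  qed
  have sub: "{w' \<in> torus. hamming_dist n (code w) (code w') < 1 / 48} \<subseteq> {w \<in> torus. fst w \<in> E}"
    by (auto simp: E_def)
  have "E \<subseteq> {0..<1}" by (auto simp: E_def torus_def)
  then have "covered E (q k) (1 / q k)" using pos by (intro covered_unit)
  then have "covered E (3 * q k) (2 * (4 * N k / (A k * N k)) / q k)"
  proof (rule covered_refine)
    show "4 * N k / (A k * N k) < 1" using A_ge(2)[of k] pos by simp
  qed (use sep[of _ _ k "A k * N k"] AN n pos in auto)
  also have "2 * (4 * N k / (A k * N k)) / q k = real (8 * N k) * (1 / q (Suc k))"
    using pos by (simp add: q_Suc)
  finally have cov: "covered E (3 * q k * (8 * N k)) (1 / q (Suc k))"
    by (rule covered_split) (use pos in auto)
  have len: "real (3 * q k * (8 * N k)) * (1 / q (Suc k)) = 24 / A k"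
    using pos by (simp add: q_Suc)
  have n_pos: "0 < n" using n AN by linarith
  show ?thesis
  \<comment> \<open>Up to this time the error term \<open>4 * N (k + 1) / n\<close> is at least 1
    and level \<open>k + 1\<close> says nothing, but then the minimum is at least
    \<open>1 / 4\<close> and the cover from level \<open>k\<close> is good enough.\<close>
  proof (cases "n \<le> 4 * N (Suc k)")
    case True
    have "1 / 4 \<le> N (Suc k) / n" using True n_pos by (simp add: field_simps flip: of_nat_mult)
    then have "576 / real (A k) * (1 / 4) \<le> 576 / A k * min 1 (N (Suc k) / n)"
      by (intro mult_left_mono) auto
    moreover have "24 / real (A k) \<le> 576 / real (A k) * (1 / 4)"
      using pos by (simp add: divide_right_mono)
    ultimately have le: "24 / real (A k) \<le> 576 / A k * min 1 (N (Suc k) / n)"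
      by (rule order_trans[rotated])
    obtain B where B: "B \<in> sets borel" "{w \<in> torus. fst w \<in> E} \<subseteq> B" "emeasure lborel B \<le> ennreal (24 / A k)"
      using covered_measure[OF cov] unfolding len by auto
    have "emeasure lborel B \<le> ennreal (576 / A k * min 1 (N (Suc k) / n))"
      using B(3) ennreal_leI[OF le] by (rule order_trans)
    with B(1,2) sub show ?thesis by blast
  next
    case False
    have "covered E (3 * (3 * q k * (8 * N k))) (2 * (4 * N (Suc k) / n) / q (Suc k))"
      using cov
    proof (rule covered_refine)
      show "4 * N (Suc k) / n < 1" using False n_pos by (simp add: field_simps)
    qed (use sep[of _ _ "Suc k" n] AN n pos in auto)
    from covered_measure[OF this]
    obtain B where B: "B \<in> sets borel" "{w \<in> torus. fst w \<in> E} \<subseteq> B"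
      "emeasure lborel B \<le> ennreal (real (3 * (3 * q k * (8 * N k))) * (2 * (4 * N (Suc k) / n) / q (Suc k)))"
      using pos by auto
    have "real (3 * (3 * q k * (8 * N k))) * (2 * (4 * N (Suc k) / n) / q (Suc k)) = 576 / A k * (N (Suc k) / n)"
      using pos n_pos by (simp add: q_Suc)
    also have "N (Suc k) / n = min 1 (N (Suc k) / n)" using False n_pos by simp
    finally show ?thesis using B sub by (intro bexI[of _ B]) (simp_all only: subset_trans[OF sub B(2)] simp_thms)
  qed
qed

end

subsection \<open>Transport to a surface\<close>

locale surface =
  fixes X :: "(real \<times> real) set"
  assumes X_borel [measurable]: "X \<in> sets borel"
    and X_pos: "emeasure lborel X \<noteq> 0" and X_finite: "emeasure lborel X \<noteq> top"
begin

abbreviation M where "M \<equiv> normalized_lebesgue X"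

lemma space_M [simp]: "space M = X"
  using X_borel by (simp add: normalized_lebesgue_def space_restrict_space)

lemma X_lebesgue: "X \<in> sets lebesgue"
  using X_borel by (simp add: sets_completionI_sets)

lemma sets_M_iff: "A \<in> sets M \<longleftrightarrow> A \<in> sets lebesgue \<and> A \<subseteq> X"
  unfolding normalized_lebesgue_def using X_lebesgue by (subst sets_restrict_space_iff) auto

lemma borel_in_M: "A \<in> sets borel \<Longrightarrow> A \<subseteq> X \<Longrightarrow> A \<in> sets M"
  by (simp add: sets_M_iff sets_completionI_sets)

lemma emeasure_M:
  assumes "A \<in> sets M"
  shows "emeasure M A = emeasure lebesgue A / emeasure lborel X"
proof -
  have AL: "A \<in> sets lebesgue" "A \<subseteq> X" using assms by (auto simp: sets_M_iff)
  have "emeasure M A = emeasure (uniform_measure lebesgue X) A"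
    unfolding normalized_lebesgue_def by (rule emeasure_restrict_space) (use X_lebesgue AL in auto)
  also have "\<dots> = emeasure lebesgue A / emeasure lebesgue X"
    using X_lebesgue AL by (simp add: Int_absorb1)
  finally show ?thesis using X_borel by simp
qed

lemma emeasure_M_borel: "A \<in> sets borel \<Longrightarrow> A \<subseteq> X \<Longrightarrow> emeasure M A = emeasure lborel A / emeasure lborel X"
  by (simp add: emeasure_M borel_in_M)

lemma prob_space_M: "prob_space M"
proof
  show "emeasure M (space M) = 1"
    using X_borel X_pos X_finite by (simp add: emeasure_M_borel ennreal_divide_self less_top zero_less_iff_neq_zero)
qed

lemma null_sets_MI:
  assumes "Z \<subseteq> B" "B \<in> sets borel" "B \<subseteq> X" "emeasure M B = 0"
  shows "Z \<in> null_sets M"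
proof -
  have "emeasure lborel B = 0"
    using assms X_finite by (simp add: emeasure_M_borel ennreal_divide_eq_0_iff)
  then have "B \<in> null_sets lborel" using assms(2) by auto
  then have Z: "Z \<in> null_sets lebesgue" using assms(1) null_sets_completion_iff2 by blast
  then have "Z \<in> sets M" using assms by (auto simp: sets_M_iff)
  with Z show ?thesis by (auto simp: null_sets_def emeasure_M)
qed

text \<open>The sets of \<open>M\<close> are Lebesgue measurable. The Borel hull \<open>B\<close> of
  the null part is kept because preimages under Borel maps are controlled for Borel sets
  only.\<close>

lemma sets_M_obtain:
  assumes "A \<in> sets M"
  obtains S Z B where "S \<in> sets borel" "S \<subseteq> X" "A = S \<union> Z" "Z \<in> null_sets M"
    "B \<in> sets borel" "Z \<subseteq> B" "B \<subseteq> X" "emeasure M B = 0"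
proof -
  have A: "A \<in> sets (completion lborel)" "A \<subseteq> X" using assms by (auto simp: sets_M_iff)
  obtain S Z N' where *: "A = S \<union> Z" "Z \<subseteq> N'" "N' \<in> null_sets lborel" "S \<in> sets lborel"
    using A(1) by (rule sets_completionE)
  have N': "N' \<inter> X \<in> sets borel" "Z \<subseteq> N' \<inter> X" "emeasure lborel (N' \<inter> X) = 0"
  proof -
    show "N' \<inter> X \<in> sets borel" using *(3) X_borel by auto
    show "Z \<subseteq> N' \<inter> X" using * A by auto
    have "N' \<inter> X \<in> null_sets lborel" using *(3) X_borel by (intro null_set_Int2) auto
    then show "emeasure lborel (N' \<inter> X) = 0" by auto
  qed
  then have N'': "emeasure M (N' \<inter> X) = 0" by (subst emeasure_M_borel) auto
  then have "Z \<in> null_sets M" using N' by (intro null_sets_MI[of Z "N' \<inter> X"]) auto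
  moreover have "S \<in> sets borel" "S \<subseteq> X" using * A by auto
  ultimately show thesis using * N' N'' by (intro that[of S Z "N' \<inter> X"]) auto
qed

text \<open>Borel measurability alone does not suffice on the completed space: preimages of null
  sets must be null. This follows from the preservation of the measure of Borel hulls.\<close>

lemma measurable_M:
  assumes g [measurable]: "g \<in> borel \<rightarrow>\<^sub>M borel" and g_X: "g ` X \<subseteq> X"
    and g_pres: "\<And>B. B \<in> sets borel \<Longrightarrow> emeasure M (g -` B \<inter> X) = emeasure M (B \<inter> X)"
  shows "g \<in> M \<rightarrow>\<^sub>M M"
    and "distr M M g = M"
proof -
  have pre: "g -` B \<inter> X \<in> sets borel" if "B \<in> sets borel" for B
  proof -
    have "g -` B \<inter> space borel \<in> sets borel" using g that by (rule measurable_sets)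
    then show ?thesis by simp
  qed
  have A: "g -` A \<inter> X \<in> sets M \<and> emeasure M (g -` A \<inter> X) = emeasure M A" if AM: "A \<in> sets M" for A
  proof -
    obtain S Z B where SZ: "S \<in> sets borel" "S \<subseteq> X" "A = S \<union> Z" "Z \<in> null_sets M"
      and B: "B \<in> sets borel" "Z \<subseteq> B" "B \<subseteq> X" "emeasure M B = 0"
      using AM by (rule sets_M_obtain)
    have "emeasure M (g -` B \<inter> X) = 0" using g_pres[OF B(1)] B by (simp add: Int_absorb2)
    then have null: "g -` Z \<inter> X \<in> null_sets M"
      using B pre[OF B(1)] by (intro null_sets_MI[of _ "g -` B \<inter> X"]) auto
    have S: "g -` S \<inter> X \<in> sets M" using pre[OF SZ(1)] by (intro borel_in_M) auto
    have SM: "S \<in> sets M" using SZ by (intro borel_in_M)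
    have split: "g -` A \<inter> X = (g -` S \<inter> X) \<union> (g -` Z \<inter> X)" using SZ by auto
    have "emeasure M (g -` A \<inter> X) = emeasure M (g -` S \<inter> X)"
      unfolding split using S null by (rule emeasure_Un_null_set)
    also have "\<dots> = emeasure M S" using g_pres[OF SZ(1)] SZ(2) by (simp add: Int_absorb2)
    also have "\<dots> = emeasure M A" unfolding SZ(3) using SM SZ(4) by (rule emeasure_Un_null_set[symmetric])
    finally show ?thesis using split S null by auto
  qed
  then show m: "g \<in> M \<rightarrow>\<^sub>M M" using g_X by (intro measurableI) auto
  show "distr M M g = M"
    by (rule measure_eqI) (use A m in \<open>auto simp: emeasure_distr\<close>)
qed

end

text \<open>A chart need only be defined almost everywhere. The open interval leaves room for the surfaces
  on which one vertical line of the torus has no counterpart.\<close>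

locale chart = surface X for X +
  fixes \<phi> \<psi> :: "real \<times> real \<Rightarrow> real \<times> real"
  assumes \<phi>_meas [measurable]: "\<phi> \<in> borel \<rightarrow>\<^sub>M borel" and \<psi>_meas [measurable]: "\<psi> \<in> borel \<rightarrow>\<^sub>M borel"
    and \<psi>_in: "w \<in> {0<..<1} \<times> {0..<1} \<Longrightarrow> \<psi> w \<in> X" and \<phi>_\<psi>: "w \<in> {0<..<1} \<times> {0..<1} \<Longrightarrow> \<phi> (\<psi> w) = w"
    and area: "B \<in> sets borel \<Longrightarrow> B \<subseteq> {0<..<1} \<times> {0..<1} \<Longrightarrow>
      emeasure lborel {z \<in> X. \<phi> z \<in> B \<and> \<psi> (\<phi> z) = z} = emeasure lborel B * emeasure lborel X"

section \<open>The transformation carried over to the surface\<close>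

locale transported_skew = chart X \<phi> \<psi> + skew_parameters q A N r for X \<phi> \<psi> q A N r
begin

definition T_inv :: "real \<times> real \<Rightarrow> real \<times> real" where
  "T_inv = skew (- \<alpha>) (\<lambda>x. - f (frac (x - \<alpha>)))"

text \<open>All integer translates of the line over 0 are removed, giving a set of full measure that
  is invariant in both time directions and on which the chart is defined.\<close>

definition Y :: "(real \<times> real) set" where
  "Y = {w \<in> torus. \<forall>k::int. frac (fst w + of_int k * \<alpha>) \<noteq> 0}"

definition S :: "(real \<times> real) set" where
  "S = {z \<in> X. \<phi> z \<in> Y \<and> \<psi> (\<phi> z) = z}"

text \<open>The identity off \<open>S\<close> makes the result a bijection of all of
  \<open>X\<close>, as invertibility is required at every point.\<close>

definition transport :: "(real \<times> real \<Rightarrow> real \<times> real) \<Rightarrow> real \<times> real \<Rightarrow> real \<times> real" where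
  "transport R z = (if z \<in> S then \<psi> (R (\<phi> z)) else z)"

lemma measurable_T_inv [measurable]: "T_inv \<in> borel \<rightarrow>\<^sub>M borel"
  unfolding T_inv_def by measurable

lemma Y_subset: "Y \<subseteq> {0<..<1} \<times> {0..<1}" "Y \<subseteq> torus"
proof -
  show "Y \<subseteq> torus" by (auto simp: Y_def)
  show "Y \<subseteq> {0<..<1} \<times> {0..<1}"
  proof
    fix w assume "w \<in> Y"
    then have w: "w \<in> torus" "frac (fst w + of_int 0 * \<alpha>) \<noteq> 0" unfolding Y_def by blast+
    then have "0 < fst w" by (auto simp: torus_def frac_eq less_le)
    then show "w \<in> {0<..<1} \<times> {0..<1}" using w(1) by (auto simp: torus_def mem_Times_iff)
  qed
qed

lemma Y_borel [measurable]: "Y \<in> sets borel"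
proof -
  have "{w. frac (fst w + of_int k * \<alpha>) \<noteq> 0} \<in> sets (borel :: (real \<times> real) measure)" for k :: int
  proof -
    have "(\<lambda>w. frac (fst w + of_int k * \<alpha>)) \<in> borel_measurable (borel :: (real \<times> real) measure)"
      unfolding borel_prod[symmetric] by measurable
    from measurable_sets_borel[OF this, of "- {0}"] show ?thesis by (simp add: vimage_def)
  qed
  then have "torus \<inter> (\<Inter>k::int. {w. frac (fst w + of_int k * \<alpha>) \<noteq> 0}) \<in> sets borel"
    by (intro sets.Int sets_torus sets.countable_INT') auto
  also have "torus \<inter> (\<Inter>k::int. {w. frac (fst w + of_int k * \<alpha>) \<noteq> 0}) = Y" by (auto simp: Y_def)
  finally show ?thesis .
qed

lemma Y_full: "torus - Y \<in> null_sets lborel"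
proof (rule null_sets_subset)
  have "{frac (- (of_int k * \<alpha>))} \<times> {0..<1::real} \<in> null_sets lborel" for k :: int
  proof -
    have "{frac (- (of_int k * \<alpha>))} \<times> {0..<1::real} \<in> sets borel" by (simp add: borel_prod[symmetric])
    moreover have "emeasure lborel ({frac (- (of_int k * \<alpha>))} \<times> {0..<1::real}) = 0"
      by (subst emeasure_lborel_Times) auto
    ultimately show ?thesis by (simp only: null_sets_def sets_lborel mem_Collect_eq simp_thms)
  qed
  then show "(\<Union>k::int. {frac (- (of_int k * \<alpha>))} \<times> {0..<1::real}) \<in> null_sets lborel"
    by (intro null_sets_UN) auto
  show "torus - Y \<in> sets lborel" by simp
  show "torus - Y \<subseteq> (\<Union>k::int. {frac (- (of_int k * \<alpha>))} \<times> {0..<1::real})"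
  proof
    fix w assume w: "w \<in> torus - Y"
    then obtain k :: int where "frac (fst w + of_int k * \<alpha>) = 0" unfolding Y_def by blast
    then have "fst w + of_int k * \<alpha> \<in> \<int>" by simp
    then have "frac (- (of_int k * \<alpha>) + (fst w + of_int k * \<alpha>)) = frac (- (of_int k * \<alpha>))"
      by (rule frac_add_int_right)
    then have "fst w = frac (- (of_int k * \<alpha>))" using w by (simp add: torus_def mem_Times_iff frac_eq)
    then show "w \<in> (\<Union>k::int. {frac (- (of_int k * \<alpha>))} \<times> {0..<1::real})"
      using w by (auto simp: torus_def mem_Times_iff)
  qed
qed

lemma emeasure_Int_Y:
  assumes [measurable]: "B \<in> sets borel"
  shows "emeasure lborel (B \<inter> Y) = emeasure lborel (B \<inter> torus)"
proof -
  have "emeasure lborel (B \<inter> torus) = emeasure lborel (B \<inter> torus - (torus - Y))"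
    by (rule emeasure_Diff_null_set[symmetric]) (use Y_full in auto)
  also have "B \<inter> torus - (torus - Y) = B \<inter> Y" using Y_subset by auto
  finally show ?thesis by simp
qed

lemma skew_Y:
  assumes w: "w \<in> Y" shows "skew (of_int i * \<alpha>) g w \<in> Y"
proof -
  have "frac (fst (skew (of_int i * \<alpha>) g w) + of_int k * \<alpha>) = frac (fst w + of_int (i + k) * \<alpha>)" for k :: int
    by (simp add: skew_def algebra_simps)
  moreover have "frac (fst w + of_int (i + k) * \<alpha>) \<noteq> 0" for k :: int using w unfolding Y_def by blast
  ultimately have "frac (fst (skew (of_int i * \<alpha>) g w) + of_int k * \<alpha>) \<noteq> 0" for k :: int by metis
  then show ?thesis unfolding Y_def using skew_in_torus by blast
qed

lemma T_Y: "w \<in> Y \<Longrightarrow> T w \<in> Y" and T_inv_Y: "w \<in> Y \<Longrightarrow> T_inv w \<in> Y"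
  using skew_Y[of w 1 f] skew_Y[of w "- 1" "\<lambda>x. - f (frac (x - \<alpha>))"] by (simp_all add: T_def T_inv_def)

lemma T_inverse: "w \<in> Y \<Longrightarrow> T_inv (T w) = w" "w \<in> Y \<Longrightarrow> T (T_inv w) = w"
  using skew_inverse[of w \<alpha> f] Y_subset(2) by (auto simp: T_def T_inv_def)

lemma S_subset: "S \<subseteq> X"
  by (auto simp: S_def)

lemma \<psi>_S: "w \<in> Y \<Longrightarrow> \<psi> w \<in> S"
  using Y_subset(1) \<phi>_\<psi>[of w] \<psi>_in[of w] by (auto simp: S_def)

lemma \<phi>_\<psi>_Y: "w \<in> Y \<Longrightarrow> \<phi> (\<psi> w) = w"
  using Y_subset(1) \<phi>_\<psi>[of w] by auto

lemma \<phi>_S: "z \<in> S \<Longrightarrow> \<phi> z \<in> Y" and \<psi>_\<phi>: "z \<in> S \<Longrightarrow> \<psi> (\<phi> z) = z"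
  by (auto simp: S_def)

lemma borel_\<phi>_preimage:
  assumes [measurable]: "B \<in> sets borel"
  shows "{z \<in> X. \<phi> z \<in> B \<and> \<psi> (\<phi> z) = z} \<in> sets borel"
proof -
  have 1: "\<phi> -` B \<inter> space borel \<in> sets borel" by measurable
  have "(\<lambda>z. \<psi> (\<phi> z) - z) \<in> borel_measurable borel" by measurable
  from measurable_sets_borel[OF this, of "{0}"] have 2: "{z \<in> space borel. \<psi> (\<phi> z) = z} \<in> sets borel"
    by (simp add: vimage_def)
  have "{z \<in> X. \<phi> z \<in> B \<and> \<psi> (\<phi> z) = z} = X \<inter> (\<phi> -` B \<inter> space borel) \<inter> {z \<in> space borel. \<psi> (\<phi> z) = z}" by auto
  also have "\<dots> \<in> sets borel" by (rule sets.Int[OF sets.Int[OF X_borel 1] 2])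
  finally show ?thesis .
qed

lemma S_borel [measurable]: "S \<in> sets borel"
  unfolding S_def by (rule borel_\<phi>_preimage) measurable

lemma borel_S_preimage:
  assumes "B \<in> sets borel" shows "{z \<in> S. \<phi> z \<in> B} \<in> sets borel"
proof -
  have "B \<inter> Y \<in> sets borel" using assms by simp
  from borel_\<phi>_preimage[OF this] have "{z \<in> X. \<phi> z \<in> B \<inter> Y \<and> \<psi> (\<phi> z) = z} \<in> sets borel" .
  also have "{z \<in> X. \<phi> z \<in> B \<inter> Y \<and> \<psi> (\<phi> z) = z} = {z \<in> S. \<phi> z \<in> B}" by (auto simp: S_def)
  finally show ?thesis .
qed

lemma emeasure_S_preimage:
  assumes [measurable]: "B \<in> sets borel"
  shows "emeasure M {z \<in> S. \<phi> z \<in> B} = emeasure lborel (B \<inter> torus)"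
proof -
  have "B \<inter> Y \<in> sets borel" "B \<inter> Y \<subseteq> {0<..<1} \<times> {0..<1}" using Y_subset by auto
  from area[OF this] have "emeasure lborel {z \<in> X. \<phi> z \<in> B \<inter> Y \<and> \<psi> (\<phi> z) = z} =
      emeasure lborel (B \<inter> torus) * emeasure lborel X"
    by (simp only: emeasure_Int_Y assms)
  also have "{z \<in> X. \<phi> z \<in> B \<inter> Y \<and> \<psi> (\<phi> z) = z} = {z \<in> S. \<phi> z \<in> B}" by (auto simp: S_def)
  finally have "emeasure lborel {z \<in> S. \<phi> z \<in> B} = emeasure lborel (B \<inter> torus) * emeasure lborel X" .
  moreover have "emeasure M {z \<in> S. \<phi> z \<in> B} = emeasure lborel {z \<in> S. \<phi> z \<in> B} / emeasure lborel X"
    using borel_S_preimage[OF assms] S_subset by (intro emeasure_M_borel) auto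
  ultimately show ?thesis using X_pos X_finite
    by (simp add: ennreal_mult_divide_eq)
qed

lemma emeasure_S: "emeasure M S = 1"
proof -
  have "S = {z \<in> S. \<phi> z \<in> torus}" using Y_subset(2) \<phi>_S by auto
  then have "emeasure M S = emeasure M {z \<in> S. \<phi> z \<in> torus}" by simp
  also have "\<dots> = 1" by (subst emeasure_S_preimage) auto
  finally show ?thesis .
qed

lemma null_outside_S: "X - S \<in> null_sets M"
proof -
  interpret prob_space M by (rule prob_space_M)
  have "S \<in> sets M" by (rule borel_in_M) (use S_subset in auto)
  moreover have "prob S = 1" unfolding measure_def emeasure_S by simp
  ultimately have "prob (space M - S) = 0" by (simp only: prob_compl)
  then have "emeasure M (X - S) = 0" by (simp add: emeasure_eq_measure)
  then show ?thesis using S_subset by (intro null_sets_MI[of _ "X - S"]) auto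
qed

text \<open>Stated for a general skew shift because it serves twice: for \<open>T\<close>, and for
  \<open>T_inv\<close> to obtain measurability of the inverse.\<close>

lemma transport_preserves:
  assumes g [measurable]: "g \<in> borel_measurable borel" and R: "R = skew a g" and R_Y: "\<And>w. w \<in> Y \<Longrightarrow> R w \<in> Y"
  shows "transport R \<in> M \<rightarrow>\<^sub>M M" "distr M M (transport R) = M"
proof -
  have [measurable]: "R \<in> borel \<rightarrow>\<^sub>M borel" unfolding R by measurable
  have meas: "transport R \<in> borel \<rightarrow>\<^sub>M borel" unfolding transport_def[abs_def] by measurable
  have into: "transport R ` X \<subseteq> X"
    using \<psi>_S[OF R_Y[OF \<phi>_S]] S_subset by (auto simp: transport_def)
  have "emeasure M (transport R -` B \<inter> X) = emeasure M (B \<inter> X)" if [measurable]: "B \<in> sets borel" for B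
  proof -
    define C where "C = \<psi> -` B \<inter> Y"
    have [measurable]: "C \<in> sets borel" unfolding C_def by (intro sets.Int Y_borel measurable_sets_borel[OF \<psi>_meas]) simp
    have "R -` C \<inter> torus \<in> sets borel" using measurable_sets_borel[of R borel C] by simp
    have null: "(transport R -` B \<inter> X) \<inter> (X - S) \<in> null_sets M" "(B \<inter> X) \<inter> (X - S) \<in> null_sets M"
    proof -
      have e: "emeasure M (X - S) = 0" "X - S \<in> sets borel" using null_outside_S by auto
      show "(transport R -` B \<inter> X) \<inter> (X - S) \<in> null_sets M" "(B \<inter> X) \<inter> (X - S) \<in> null_sets M"
        by (rule null_sets_MI[of _ "X - S"]; use e in auto)+
    qed
    have RC: "{w \<in> torus. R w \<in> C} \<in> sets borel"
    proof -
      have "{w \<in> torus. R w \<in> C} = R -` C \<inter> torus" by auto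
      with \<open>R -` C \<inter> torus \<in> sets borel\<close> show ?thesis by simp
    qed
    have 1: "transport R -` B \<inter> X = {z \<in> S. \<phi> z \<in> {w \<in> torus. R w \<in> C}} \<union> (transport R -` B \<inter> X) \<inter> (X - S)"
      using S_subset R_Y[OF \<phi>_S] subsetD[OF Y_subset(2) \<phi>_S] by (auto simp: transport_def C_def split: if_splits)
    have 2: "B \<inter> X = {z \<in> S. \<phi> z \<in> C} \<union> (B \<inter> X) \<inter> (X - S)"
      using S_subset \<phi>_S \<psi>_\<phi> by (auto simp: C_def)
    have "emeasure M (transport R -` B \<inter> X) = emeasure M {z \<in> S. \<phi> z \<in> {w \<in> torus. R w \<in> C}}"
      by (subst 1, rule emeasure_Un_null_set) (use null borel_S_preimage[OF RC] S_subset in \<open>auto intro!: borel_in_M\<close>)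
    also have "\<dots> = emeasure lborel ({w \<in> torus. R w \<in> C} \<inter> torus)" by (rule emeasure_S_preimage[OF RC])
    also have "{w \<in> torus. R w \<in> C} \<inter> torus = {w \<in> torus. skew a g w \<in> C}" by (auto simp: R)
    also have "emeasure lborel {w \<in> torus. skew a g w \<in> C} = emeasure lborel (C \<inter> torus)" by (rule emeasure_skew) auto
    also have "\<dots> = emeasure M {z \<in> S. \<phi> z \<in> C}" by (rule emeasure_S_preimage[symmetric]) simp
    also have "\<dots> = emeasure M (B \<inter> X)"
      by (subst 2, rule emeasure_Un_null_set[symmetric])
        (use null borel_S_preimage[of C] S_subset in \<open>auto intro!: borel_in_M\<close>)
    finally show ?thesis .
  qed
  from measurable_M[OF meas into this]
  show "transport R \<in> M \<rightarrow>\<^sub>M M" "distr M M (transport R) = M" by auto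
qed

abbreviation \<tau> where "\<tau> \<equiv> transport T"

lemma \<tau>_S: "z \<in> S \<Longrightarrow> \<tau> z \<in> S" "z \<in> S \<Longrightarrow> \<phi> (\<tau> z) = T (\<phi> z)"
  using \<psi>_S[OF T_Y[OF \<phi>_S]] \<phi>_\<psi>_Y[OF T_Y[OF \<phi>_S]] by (auto simp: transport_def)

lemma transport_inverse: "transport T_inv (\<tau> z) = z" "\<tau> (transport T_inv z) = z"
proof -
  have "transport T_inv z \<in> S" "\<phi> (transport T_inv z) = T_inv (\<phi> z)" if "z \<in> S"
    using \<psi>_S[OF T_inv_Y[OF \<phi>_S]] \<phi>_\<psi>_Y[OF T_inv_Y[OF \<phi>_S]] that by (auto simp: transport_def)
  then show "transport T_inv (\<tau> z) = z" "\<tau> (transport T_inv z) = z"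
    using \<tau>_S[of z] T_inverse \<phi>_S[of z] \<psi>_\<phi>[of z] by (cases "z \<in> S"; simp add: transport_def)+
qed

lemma invertible_\<tau>: "invertible_measure_preserving M \<tau>"
proof -
  have 1: "\<tau> \<in> M \<rightarrow>\<^sub>M M" "distr M M \<tau> = M"
    by (rule transport_preserves[OF borel_measurable_f T_def T_Y]; assumption)+
  have 2: "transport T_inv \<in> M \<rightarrow>\<^sub>M M"
    by (rule transport_preserves[OF _ T_inv_def T_inv_Y]) measurable
  have bij: "bij_betw \<tau> X X"
    by (rule bij_betw_byWitness[where f'="transport T_inv"])
      (use transport_inverse measurable_space[OF 1(1)] measurable_space[OF 2] in auto)
  have "the_inv_into X \<tau> z = transport T_inv z" if "z \<in> X" for z
    using that bij measurable_space[OF 2, of z] transport_inverse(2)[of z]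
    by (intro the_inv_into_f_eq) (auto simp: bij_betw_def)
  then have "the_inv_into X \<tau> \<in> M \<rightarrow>\<^sub>M M"
    using 2 by (subst measurable_cong[where g="transport T_inv"]) auto
  with 1 bij show ?thesis by (simp add: invertible_measure_preserving_def)
qed


text \<open>Exceptional points are sent to an arbitrary point of the torus. In this way partitions
  of the torus lift to exact partitions of \<open>X\<close>, including its null set outside
  \<open>S\<close>.\<close>

definition \<phi>' :: "real \<times> real \<Rightarrow> real \<times> real" where
  "\<phi>' z = (if z \<in> S then \<phi> z else (0, 0))"

definition lift :: "(real \<times> real) set \<Rightarrow> (real \<times> real) set" where
  "lift B = {z \<in> X. \<phi>' z \<in> B}"

lemma \<phi>'_torus: "\<phi>' z \<in> torus"
  using subsetD[OF Y_subset(2) \<phi>_S] by (auto simp: \<phi>'_def torus_def)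

lemma lift_subset: "lift B \<subseteq> X"
  by (auto simp: lift_def)

lemma lift_iff: "z \<in> S \<Longrightarrow> z \<in> lift B \<longleftrightarrow> \<phi> z \<in> B"
  using S_subset by (auto simp: lift_def \<phi>'_def)

lemma borel_lift [measurable]: "B \<in> sets borel \<Longrightarrow> lift B \<in> sets borel"
proof -
  assume B [measurable]: "B \<in> sets borel"
  have "\<phi>' \<in> borel \<rightarrow>\<^sub>M borel" unfolding \<phi>'_def[abs_def] by measurable
  from measurable_sets_borel[OF this B] have "X \<inter> \<phi>' -` B \<in> sets borel" by (rule sets.Int[OF X_borel])
  also have "X \<inter> \<phi>' -` B = lift B" by (auto simp: lift_def)
  finally show ?thesis .
qed

lemma lift_in_M: "B \<in> sets borel \<Longrightarrow> lift B \<in> sets M"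
  by (intro borel_in_M borel_lift lift_subset)

lemma measure_eq_mod_S:
  assumes "C \<in> sets M" "D \<in> sets M" "C \<inter> S = D \<inter> S"
  shows "measure M C = measure M D"
proof -
  interpret prob_space M by (rule prob_space_M)
  have "AE z in M. z \<notin> X - S" using null_outside_S by (rule AE_not_in)
  then show ?thesis
  proof (intro measure_eq_AE)
    show "AE z in M. z \<in> C \<longleftrightarrow> z \<in> D"
      using \<open>AE z in M. z \<notin> X - S\<close> AE_space by eventually_elim (use assms(3) in auto)
  qed (use assms in auto)
qed

lemma measure_lift:
  assumes B: "B \<in> sets borel" "B \<subseteq> torus"
  shows "measure M (lift B) = measure lborel B"
proof -
  have "measure M (lift B) = measure M {z \<in> S. \<phi> z \<in> B}"
    using B lift_in_M borel_S_preimage[OF B(1)] S_subset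
    by (intro measure_eq_mod_S) (auto intro!: borel_in_M simp: lift_def \<phi>'_def)
  also have "\<dots> = measure lborel (B \<inter> torus)" unfolding measure_def by (simp only: emeasure_S_preimage[OF B(1)])
  finally show ?thesis using B(2) by (simp add: Int_absorb2)
qed

section \<open>Cyclic processes on the surface\<close>

lemma cell_subset: "cell k i \<subseteq> torus"
  by (auto simp: cell_def)

lemma partition_lift:
  assumes "\<And>i. i < m \<Longrightarrow> P i \<in> sets borel" "disjoint_family_on P {..<m}" "(\<Union>i<m. P i) \<supseteq> torus"
  shows "measurable_partition M m (\<lambda>i. lift (P i))"
  unfolding measurable_partition_def
proof (intro conjI allI impI)
  show "lift (P i) \<in> sets M" if "i < m" for i using assms(1)[OF that] by (rule lift_in_M)
  show "disjoint_family_on (\<lambda>i. lift (P i)) {..<m}"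
    using assms(2) unfolding disjoint_family_on_def lift_def by blast
  show "(\<Union>i<m. lift (P i)) = space M"
  proof (intro equalityI subsetI)
    fix z assume "z \<in> space M"
    then show "z \<in> (\<Union>i<m. lift (P i))" using subsetD[OF assms(3) \<phi>'_torus[of z]] by (auto simp: lift_def)
  qed (auto simp: lift_def)
qed

lemma cyclic_process_cells: "cyclic_process M (height k) (\<lambda>i. lift (cell k i))"
  unfolding cyclic_process_def
proof (intro conjI)
  show "measurable_partition M (height k) (\<lambda>i. lift (cell k i))"
  proof (rule partition_lift)
    show "disjoint_family_on (cell k) {..<height k}"
      using cell_disjoint unfolding disjoint_family_on_def by blast
    show "torus \<subseteq> (\<Union>i<height k. cell k i)" using cell_cover by simp
  qed (rule sets_cell)
  have "measure M (lift (cell k i)) = enn2real (ennreal (1 / height k))" for i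
    unfolding measure_lift[OF sets_cell cell_subset] unfolding measure_def emeasure_cell ..
  then show "\<forall>i<height k. \<forall>j<height k. measure M (lift (cell k i)) = measure M (lift (cell k j))" by simp
qed (rule height_pos)

text \<open>A set of \<open>M\<close> is replaced by its Borel part and moved to the torus by
  \<open>\<psi>\<close>; both changes affect null sets only, so the approximation found on the torus
  is inherited.\<close>

lemma exhaustive_cells: "exhaustive M height (\<lambda>k i. lift (cell k i))"
  unfolding exhaustive_def
proof
  interpret prob_space M by (rule prob_space_M)
  fix E assume E: "E \<in> sets M"
  obtain C Z D where C: "C \<in> sets borel" "C \<subseteq> X" "E = C \<union> Z" "Z \<in> null_sets M"
    and D: "D \<in> sets borel" "Z \<subseteq> D" "D \<subseteq> X" "emeasure M D = 0"
    using E by (rule sets_M_obtain)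
  define B where "B = \<psi> -` C \<inter> Y"
  have B: "B \<in> sets borel" "B \<subseteq> torus"
    unfolding B_def using measurable_sets_borel[OF \<psi>_meas C(1)] Y_borel Y_subset(2) by auto
  obtain J where J: "\<And>k. J k \<subseteq> {..<height k}"
    "(\<lambda>k. measure lborel (sym_diff B (\<Union>i\<in>J k. cell k i))) \<longlonglongrightarrow> 0"
    using cells_exhaustive[OF B] by blast
  have "measure M (sym_diff E (\<Union>i\<in>J k. lift (cell k i))) = measure lborel (sym_diff B (\<Union>i\<in>J k. cell k i))" for k
  proof -
    have fin: "finite (J k)" using J(1) by (rule finite_subset) simp
    have U: "(\<Union>i\<in>J k. cell k i) \<in> sets borel" "(\<Union>i\<in>J k. cell k i) \<subseteq> torus"
      using fin cell_subset by (auto intro: sets.finite_UN)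
    have lift_U: "(\<Union>i\<in>J k. lift (cell k i)) = lift (\<Union>i\<in>J k. cell k i)" by (auto simp: lift_def)
    have C_M: "C \<in> sets M" using C by (intro borel_in_M)
    have "measure M (sym_diff E (lift (\<Union>i\<in>J k. cell k i))) = measure M (sym_diff C (lift (\<Union>i\<in>J k. cell k i)))"
    proof (rule measure_eq_AE)
      have "AE z in M. z \<notin> Z" using C(4) by (rule AE_not_in)
      then show "AE z in M. z \<in> sym_diff E (lift (\<Union>i\<in>J k. cell k i)) \<longleftrightarrow> z \<in> sym_diff C (lift (\<Union>i\<in>J k. cell k i))"
        by eventually_elim (auto simp: C(3))
    qed (use E C_M lift_in_M[OF U(1)] in auto)
    also have "\<dots> = measure M (lift (sym_diff B (\<Union>i\<in>J k. cell k i)))"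
    proof (rule measure_eq_mod_S)
      show "lift (sym_diff B (\<Union>i\<in>J k. cell k i)) \<in> sets M" using B U by (intro lift_in_M) auto
      have "z \<in> C \<longleftrightarrow> \<phi> z \<in> B" if "z \<in> S" for z
        using \<phi>_S[OF that] \<psi>_\<phi>[OF that] by (simp add: B_def)
      then show "sym_diff C (lift (\<Union>i\<in>J k. cell k i)) \<inter> S = lift (sym_diff B (\<Union>i\<in>J k. cell k i)) \<inter> S"
        using S_subset by (auto simp: lift_def \<phi>'_def)
    qed (use C_M lift_in_M[OF U(1)] in auto)
    also have "\<dots> = measure lborel (sym_diff B (\<Union>i\<in>J k. cell k i))"
      using B U by (intro measure_lift) auto
    finally show ?thesis by (simp only: lift_U)
  qed
  then show "\<exists>J. (\<forall>k. J k \<subseteq> {..<height k}) \<and>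
      (\<lambda>k. measure M (sym_diff E (\<Union>i\<in>J k. lift (cell k i)))) \<longlonglongrightarrow> 0"
    using J by (intro exI[of _ J]) simp
qed

lemma sum_lift_cell_error:
  "(\<Sum>i<height k. measure M {z \<in> lift (cell k i). \<tau> z \<notin> lift (cell k (Suc i mod height k))}) \<le> 11 * r k / N k"
proof -
  interpret prob_space M by (rule prob_space_M)
  have \<tau>_meas: "\<tau> \<in> M \<rightarrow>\<^sub>M M" using invertible_\<tau> by (simp add: invertible_measure_preserving_def)
  have "measure M {z \<in> lift (cell k i). \<tau> z \<notin> lift (cell k j)} = measure lborel {w \<in> cell k i. T w \<notin> cell k j}" for i j
  proof -
    have "cell k i - T -` cell k j \<in> sets borel"
      by (intro sets.Diff sets_cell measurable_sets_borel[OF measurable_T])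
    also have "cell k i - T -` cell k j = {w \<in> cell k i. T w \<notin> cell k j}" by auto
    finally have 1: "{w \<in> cell k i. T w \<notin> cell k j} \<in> sets borel" .
    have "{z \<in> lift (cell k i). \<tau> z \<notin> lift (cell k j)} = lift (cell k i) - (\<tau> -` lift (cell k j) \<inter> space M)"
      using lift_subset by auto
    then have "{z \<in> lift (cell k i). \<tau> z \<notin> lift (cell k j)} \<in> sets M"
      by (simp only:) (intro sets.Diff measurable_sets[OF \<tau>_meas] lift_in_M sets_cell)
    then have "measure M {z \<in> lift (cell k i). \<tau> z \<notin> lift (cell k j)} = measure M (lift {w \<in> cell k i. T w \<notin> cell k j})"
      using lift_in_M[OF 1]
    proof (rule measure_eq_mod_S)
      show "{z \<in> lift (cell k i). \<tau> z \<notin> lift (cell k j)} \<inter> S = lift {w \<in> cell k i. T w \<notin> cell k j} \<inter> S"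
        by (auto simp: lift_iff \<tau>_S)
    qed
    also have "\<dots> = measure lborel {w \<in> cell k i. T w \<notin> cell k j}"
      using 1 cell_subset by (intro measure_lift) auto
    finally show ?thesis .
  qed
  then show ?thesis using sum_cell_error[of k] by simp
qed

lemma cyclic_error_cells: "cyclic_error M \<tau> (height k) (\<lambda>i. lift (cell k i)) \<le> 22 * r k / N k"
  unfolding cyclic_error_eq[OF prob_space_M invertible_\<tau> cyclic_process_cells] using sum_lift_cell_error[of k] by simp

section \<open>Speed of approximation and the upper bound\<close>

lemma r_lim_real: "filterlim (\<lambda>k. real (r k)) at_top sequentially"
  by (rule filterlim_compose[OF filterlim_real_sequentially r_lim])

lemma inverse_r_lim: "(\<lambda>k. c / real (r k)) \<longlonglongrightarrow> 0"
  by (rule real_tendsto_divide_at_top[OF tendsto_const r_lim_real])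

lemma N_ge_real: "real (q k) * real (r k) ^ 4 \<le> real (N k)"
  using N_ge[of k] by (metis of_nat_le_iff of_nat_mult of_nat_power)

lemma r_div_N: "real (height k) * (r k / N k) \<le> 1 / r k" "r k / N k \<le> 1 / r k"
proof -
  have pos: "1 \<le> real (q k)" "1 \<le> real (r k)" "0 < real (N k)" using q_pos[of k] r_pos[of k] N_pos[of k] by auto
  have "real (q k) * real (r k) ^ 3 \<le> real (q k) * real (r k) ^ 4"
    using pos by (intro mult_left_mono power_increasing) auto
  then have *: "real (q k) * real (r k) * real (r k) * real (r k) \<le> N k"
    using N_ge_real[of k] by (simp add: power3_eq_cube mult_ac)
  then show "real (height k) * (r k / N k) \<le> 1 / r k"
    using pos by (simp add: height_def field_simps)
  have "1 * (1 * real (r k) * real (r k)) \<le> real (q k) * (real (r k) * real (r k) * real (r k))"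
    using pos by (intro mult_mono) (auto intro: mult_mono)
  then have "real (r k) * real (r k) \<le> N k" using * by (simp add: mult_ac)
  then show "r k / N k \<le> 1 / r k" using pos by (simp add: field_simps)
qed

lemma good_cyclic_approximation_\<tau>: "good_cyclic_approximation M \<tau>"
  unfolding good_cyclic_approximation_def
proof (intro exI conjI)
  \<comment> \<open>The error bound has the constant 22; 23 makes the inequality strict. It holds
    for all \<open>k\<close>, so the whole sequence serves as the subsequence.\<close>
  let ?c = "\<lambda>k i. lift (cell k i)" and ?g = "\<lambda>k. 23 * (real (r k) / real (N k))"
  have err: "cyclic_error M \<tau> (height k) (?c k) < ?g k" for k
  proof -
    have "0 < real (r k) / real (N k)" using r_pos[of k] N_pos[of k] by simp
    moreover have "real (22 * r k) / real (N k) = 22 * (real (r k) / real (N k))" by simp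
    ultimately show ?thesis using cyclic_error_cells[of k] by linarith
  qed
  have nonneg: "0 \<le> cyclic_error M \<tau> (height k) (?c k)" for k
    by (simp add: cyclic_error_def sum_nonneg)
  show "cyclic_approximation M \<tau> height ?c"
    unfolding cyclic_approximation_def
  proof (intro conjI allI cyclic_process_cells exhaustive_cells)
    show "(\<lambda>k. cyclic_error M \<tau> (height k) (?c k)) \<longlonglongrightarrow> 0"
    proof (rule tendsto_sandwich[OF _ _ tendsto_const inverse_r_lim[of 23]])
      show "\<forall>\<^sub>F k in sequentially. cyclic_error M \<tau> (height k) (?c k) \<le> 23 / real (r k)"
      proof (intro always_eventually allI)
        fix k show "cyclic_error M \<tau> (height k) (?c k) \<le> 23 / real (r k)"
          using err[of k] r_div_N(2)[of k] by simp
      qed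
    qed (use nonneg in auto)
  qed
  show "?g \<in> o(\<lambda>k. 1 / real (height k))"
  proof (rule smalloI_tendsto)
    show "\<forall>\<^sub>F k in sequentially. 1 / real (height k) \<noteq> 0" using height_pos by (simp add: less_imp_neq[symmetric])
    show "(\<lambda>k. ?g k / (1 / real (height k))) \<longlonglongrightarrow> 0"
    proof (rule tendsto_sandwich[OF _ _ tendsto_const inverse_r_lim[of 23]])
      show "\<forall>\<^sub>F k in sequentially. ?g k / (1 / real (height k)) \<le> 23 / real (r k)"
      proof (intro always_eventually allI)
        fix k
        have "?g k / (1 / real (height k)) = 23 * (real (height k) * (r k / N k))" by simp
        also have "\<dots> \<le> 23 * (1 / r k)" by (intro mult_left_mono r_div_N) auto
        finally show "?g k / (1 / real (height k)) \<le> 23 / real (r k)" by simp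
      qed
    qed auto
  qed
  show "has_speed M \<tau> height ?c ?g"
    unfolding has_speed_def using err by (intro exI[of _ "\<lambda>k. k"]) (auto simp: strict_mono_def)
qed

text \<open>The escape per step is at most \<open>11 * r k / N k\<close>. Shortening the time from
  \<open>N k\<close> by the square of \<open>r k\<close> makes the total escape at most
  \<open>11 / r k\<close>, which vanishes, while the exponent is unaffected.\<close>

lemma lower_slow_entropy_\<tau>_le:
  assumes u: "0 \<le> u" and growth: "\<And>t. t > u \<Longrightarrow> (\<lambda>k. real (height k) / real (N k div r k ^ 2) powr t) \<longlonglongrightarrow> 0"
  shows "lower_slow_entropy M (\<lambda>n t. real n powr t) \<tau> \<le> ereal u"
proof -
  interpret prob_space M by (rule prob_space_M)
  have \<tau>_meas: "\<tau> \<in> M \<rightarrow>\<^sub>M M" and \<tau>_pres: "distr M M \<tau> = M"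
    using invertible_\<tau> by (auto simp: invertible_measure_preserving_def)
  show ?thesis
  proof (rule lower_slow_entropy_le[OF \<tau>_meas _ height_pos _ exhaustive_cells _ _ u growth])
    show "measure M (\<tau> -` E \<inter> space M) = measure M E" if "E \<in> sets M" for E
      using measure_distr[OF \<tau>_meas that] by (simp add: \<tau>_pres)
    show "measurable_partition M (height k) (\<lambda>i. lift (cell k i))" for k
      using cyclic_process_cells[of k] by (simp add: cyclic_process_def)
    show "filterlim (\<lambda>k. N k div r k ^ 2) at_top sequentially"
    proof (rule filterlim_at_top_mono[OF r_lim])
      have "r k \<le> N k div r k ^ 2" for k
      proof -
        have "r k * r k ^ 2 \<le> r k ^ 4" using r_pos[of k] power_increasing[of 3 4 "r k"] by (simp add: power_Suc numeral_eq_Suc)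
        then have "r k * r k ^ 2 \<le> N k" using r4_le_N[of k] by linarith
        then show ?thesis using r_pos[of k] by (simp add: less_eq_div_iff_mult_less_eq)
      qed
      then show "\<forall>\<^sub>F k in sequentially. r k \<le> N k div r k ^ 2" by simp
    qed
    let ?e = "\<lambda>k. \<Sum>i<height k. measure M {z \<in> lift (cell k i). \<tau> z \<notin> lift (cell k (Suc i mod height k))}"
    show "(\<lambda>k. real (N k div r k ^ 2) * ?e k) \<longlonglongrightarrow> 0"
    proof (rule tendsto_sandwich[OF _ _ tendsto_const inverse_r_lim[of 11]])
      have "real (N k div r k ^ 2) * ?e k \<le> 11 / r k" for k
      proof -
        have "real (N k div r k ^ 2) \<le> N k / real (r k) ^ 2" using of_nat_div_le_of_nat[of "N k" "r k ^ 2", where 'a=real] by simp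
        then have "real (N k div r k ^ 2) * ?e k \<le> N k / real (r k) ^ 2 * (11 * r k / N k)"
          using sum_lift_cell_error[of k] by (intro mult_mono) (auto intro: sum_nonneg)
        also have "\<dots> = 11 / r k" using N_pos[of k] r_pos[of k] by (simp add: power2_eq_square)
        finally show ?thesis .
      qed
      then show "\<forall>\<^sub>F k in sequentially. real (N k div r k ^ 2) * ?e k \<le> 11 / r k" by simp
    qed (auto intro!: always_eventually mult_nonneg_nonneg sum_nonneg)
  qed
qed

section \<open>The lower bound from eight horizontal strips\<close>

definition strip :: "nat \<Rightarrow> (real \<times> real) set" where
  "strip i = {w \<in> torus. nat \<lfloor>8 * snd w\<rfloor> = i}"

abbreviation strips :: "nat \<Rightarrow> (real \<times> real) set" where
  "strips \<equiv> \<lambda>i. lift (strip i)"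

lemma partition_strips: "measurable_partition M 8 strips"
proof (rule partition_lift)
  show "strip i \<in> sets borel" for i
  proof -
    have "(\<lambda>w. real (nat \<lfloor>8 * snd w\<rfloor>)) \<in> borel_measurable (borel :: (real \<times> real) measure)"
      unfolding borel_prod[symmetric] by measurable
    from measurable_sets_borel[OF this, of "{real i}"] have "torus \<inter> (\<lambda>w. real (nat \<lfloor>8 * snd w\<rfloor>)) -` {real i} \<in> sets borel"
      by (intro sets.Int sets_torus) auto
    also have "torus \<inter> (\<lambda>w. real (nat \<lfloor>8 * snd w\<rfloor>)) -` {real i} = strip i" by (auto simp: strip_def)
    finally show ?thesis .
  qed
  show "disjoint_family_on strip {..<8}" by (auto simp: disjoint_family_on_def strip_def)
  show "torus \<subseteq> (\<Union>i<8. strip i)"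
  proof
    fix w assume w: "w \<in> torus"
    then have "nat \<lfloor>8 * snd w\<rfloor> < 8" by (auto simp: torus_def) linarith
    with w show "w \<in> (\<Union>i<8. strip i)" by (auto simp: strip_def)
  qed
qed

lemma funpow_\<tau>: "z \<in> S \<Longrightarrow> (\<tau> ^^ m) z \<in> S \<and> \<phi> ((\<tau> ^^ m) z) = (T ^^ m) (\<phi> z)"
  by (induction m) (auto simp: \<tau>_S)

sublocale strip_names: partitioned_system M \<tau> 8 strips
proof -
  interpret prob_space M by (rule prob_space_M)
  show "partitioned_system M \<tau> 8 strips"
    by unfold_locales (use partition_strips invertible_\<tau> in \<open>auto simp: invertible_measure_preserving_def\<close>)
qed

lemma name_strips:
  assumes z: "z \<in> S"
  shows "name 8 strips \<tau> z m = code (\<phi> z) m"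
proof -
  have zX: "z \<in> space M" using z S_subset by auto
  have "(\<tau> ^^ m) z \<in> lift (strip (name 8 strips \<tau> z m))" by (rule strip_names.name_in[OF zX])
  then show ?thesis using funpow_\<tau>[OF z, of m] by (auto simp: lift_def \<phi>'_def strip_def code_def)
qed

lemma name_eq: "z \<in> S \<Longrightarrow> name 8 strips \<tau> z = code (\<phi> z)"
  by (rule ext) (rule name_strips)

text \<open>Points in a common ball of radius \<open>1 / 96\<close> have names closer than
  \<open>1 / 48\<close>, the radius at which the area of Hamming balls is bounded. Restricting to
  \<open>S\<close> identifies names with codes.\<close>

lemma covering_number_strips:
  assumes n: "A k * N k \<le> n" "n \<le> A (Suc k) * N (Suc k)"
  shows "(1 - 1 / 96) / (576 / A k * min 1 (N (Suc k) / n)) \<le> covering_number M 8 strips \<tau> n (1 / 96)"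
proof (rule strip_names.le_covering_number[where Y=S])
  have "0 < n" using n(1) A_pos[of k] N_pos[of k] by (meson less_le_trans nat_0_less_mult_iff)
  then show "0 < 576 / A k * min 1 (N (Suc k) / n)" using A_pos[of k] N_pos[of "Suc k"] by simp
  show "S \<in> sets M" by (intro borel_in_M S_borel S_subset)
  show "measure M S = 1" using emeasure_S by (simp add: measure_def)
  fix y assume y: "y \<in> S"
  have "\<phi> y \<in> torus" using \<phi>_S[OF y] Y_subset(2) by auto
  from hamming_ball_small[OF this n] obtain B where B: "B \<in> sets borel"
    "{w' \<in> torus. hamming_dist n (code (\<phi> y)) (code w') < 1 / 48} \<subseteq> B"
    "emeasure lborel B \<le> ennreal (576 / A k * min 1 (N (Suc k) / n))" by blast
  have "emeasure M {z \<in> S. \<phi> z \<in> B} \<le> ennreal (576 / A k * min 1 (N (Suc k) / n))"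
  proof -
    have "emeasure M {z \<in> S. \<phi> z \<in> B} \<le> emeasure lborel B"
      unfolding emeasure_S_preimage[OF B(1)] using B(1) by (intro emeasure_mono) auto
    then show ?thesis using B(3) by (rule order_trans)
  qed
  then have "measure M {z \<in> S. \<phi> z \<in> B} \<le> 576 / A k * min 1 (N (Suc k) / n)"
    unfolding measure_def by (intro enn2real_leI) auto
  moreover have "{z \<in> S. \<phi> z \<in> B} \<in> sets M" using borel_S_preimage[OF B(1)] S_subset by (intro borel_in_M) auto
  moreover have "{y' \<in> S. hamming_dist n (name 8 strips \<tau> y) (name 8 strips \<tau> y') < 2 * (1 / 96)}
      \<subseteq> {z \<in> S. \<phi> z \<in> B}"
  proof
    fix y' assume "y' \<in> {y' \<in> S. hamming_dist n (name 8 strips \<tau> y) (name 8 strips \<tau> y') < 2 * (1 / 96)}"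
    then have y': "y' \<in> S" "hamming_dist n (code (\<phi> y)) (code (\<phi> y')) < 1 / 48"
      unfolding mem_Collect_eq name_eq[OF y] by (auto simp: name_eq)
    moreover have "\<phi> y' \<in> torus" using \<phi>_S[OF y'(1)] Y_subset(2) by auto
    ultimately show "y' \<in> {z \<in> S. \<phi> z \<in> B}" using B(2) by blast
  qed
  ultimately show "\<exists>B\<in>sets M. measure M B \<le> 576 / A k * min 1 (N (Suc k) / n) \<and>
      {y' \<in> S. hamming_dist n (name 8 strips \<tau> y) (name 8 strips \<tau> y') < 2 * (1 / 96)} \<subseteq> B"
    by blast
qed simp

lemma le_lower_slow_entropy_\<tau>:
  assumes u: "u \<le> 1" and growth: "\<And>t. 0 < t \<Longrightarrow> t < u \<Longrightarrow> eventually (\<lambda>k. real (N (Suc k)) powr t \<le> A k) sequentially"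
  shows "ereal u \<le> lower_slow_entropy M (\<lambda>n t. real n powr t) \<tau>"
proof (rule strip_names.le_lower_slow_entropy[where \<epsilon>="1 / 96"])
  fix t assume t: "0 < t" "t < u"
  obtain K where K: "\<And>k. K \<le> k \<Longrightarrow> real (N (Suc k)) powr t \<le> A k"
    using growth[OF t] unfolding eventually_sequentially by blast
  define c where "c = (1 - 1 / 96) / (576 :: real)"
  have "c * real n powr t \<le> covering_number M 8 strips \<tau> n (1 / 96)" if n: "A K * N K \<le> n" for n
  proof -
    \<comment> \<open>The times \<open>A k * N k\<close> are unbounded, so consecutive ones enclose
      every \<open>n\<close> beyond the first.\<close>
    have "\<exists>k\<ge>K. A k * N k \<le> n \<and> n < A (Suc k) * N (Suc k)"
    proof (rule ccontr)
      assume neg: "\<not> ?thesis"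
      have *: "A k * N k \<le> n" if "K \<le> k" for k
        using that
      proof (induction k rule: dec_induct)
        case (step k)
        then show ?case using neg by (meson not_le)
      qed (rule n)
      have "2 ^ k \<le> N k" for k
      proof (induction k)
        case (Suc k)
        then show ?case using N_Suc_ge(2)[of k] by simp
      qed (use N_pos[of 0] in simp)
      then have "2 ^ k \<le> A k * N k" for k using A_pos[of k] mult_mono[of 1 "A k" "2 ^ k" "N k"] by simp
      then have "2 ^ (n + K) \<le> n" using *[of "n + K"] by (meson le_add2 le_trans)
      then show False using less_exp[of "n + K"] by linarith
    qed
    then obtain k where k: "K \<le> k" "A k * N k \<le> n" "n < A (Suc k) * N (Suc k)" by blast
    let ?N = "real (N (Suc k))"
    have pos: "0 < real n" "0 < ?N" "0 < real (A k)"
      using k(2) A_pos[of k] N_pos[of k] N_pos[of "Suc k"] by (auto intro: less_le_trans[of _ "A k * N k"])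
    have "real n powr t * min 1 (?N / n) \<le> ?N powr t"
    \<comment> \<open>The worst time is \<open>N (k + 1)\<close>: below it \<open>n powr t\<close>
      increases, above it \<open>n powr (t - 1)\<close> decreases because
      \<open>t < u \<le> 1\<close>.\<close>
    proof (cases "real n \<le> ?N")
      case True
      then have "real n powr t \<le> ?N powr t" using t pos by (intro powr_mono2) auto
      moreover have "real n powr t * min 1 (?N / n) \<le> real n powr t * 1" by (intro mult_left_mono) auto
      ultimately show ?thesis by linarith
    next
      case False
      have "real n powr t * min 1 (?N / n) \<le> real n powr t * (?N / n)" by (intro mult_left_mono) auto
      also have "\<dots> = ?N * real n powr (t - 1)" using pos by (simp add: powr_diff)
      also have "\<dots> \<le> ?N * ?N powr (t - 1)"
        using False t u pos by (intro mult_left_mono powr_mono2') auto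
      also have "\<dots> = ?N powr t" using pos by (simp add: powr_diff)
      finally show ?thesis .
    qed
    also have "\<dots> \<le> A k" by (rule K) fact
    finally have "c * real n powr t \<le> (1 - 1 / 96) / (576 / A k * min 1 (?N / n))"
      using pos by (simp add: c_def field_simps)
    also have "\<dots> \<le> covering_number M 8 strips \<tau> n (1 / 96)"
      using k by (intro covering_number_strips) auto
    finally show ?thesis .
  qed
  then show "\<exists>c>0. eventually (\<lambda>n. c * real n powr t \<le> covering_number M 8 strips \<tau> n (1 / 96)) sequentially"
    unfolding eventually_sequentially by (intro exI[of _ c]) (auto simp: c_def)
qed simp

end

subsection \<open>Choice of the parameters\<close>

text \<open>The exponent tends to infinity, so the amplitude outgrows every fixed power of
  \<open>Q * (k + 64)\<close>. For a fixed time exponent the next denominator then equals the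
  amplitude up to a power arbitrarily close to 1.\<close>

definition amplitude :: "nat \<Rightarrow> nat \<Rightarrow> nat" where
  "amplitude k Q = (Q * (k + 64)) ^ (k + 1)"

text \<open>The power of \<open>Q\<close> sets the entropy, eventually with
  \<open>v k = 1 / u\<close>; the other factor is the fourth power of \<open>r k = k + 64\<close>
  demanded of the parameters.\<close>

definition time_scale :: "(nat \<Rightarrow> real) \<Rightarrow> nat \<Rightarrow> nat \<Rightarrow> nat" where
  "time_scale v k Q = nat \<lceil>real Q powr v k\<rceil> * (k + 64) ^ 4"

primrec denominator :: "(nat \<Rightarrow> real) \<Rightarrow> nat \<Rightarrow> nat" where
  "denominator v 0 = 1"
| "denominator v (Suc k) = denominator v k * (amplitude k (denominator v k) * time_scale v k (denominator v k))"

lemma le_ceiling_powr: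
  assumes "1 \<le> Q" "1 \<le> v"
  shows "Q \<le> nat \<lceil>real Q powr v\<rceil>" "real (nat \<lceil>real Q powr v\<rceil>) \<le> 2 * real Q powr v"
    "real Q powr v \<le> real (nat \<lceil>real Q powr v\<rceil>)"
proof -
  have "real Q powr 1 \<le> real Q powr v" using assms by (intro powr_mono) auto
  then have Q: "real Q \<le> real Q powr v" using assms(1) by simp
  then show "Q \<le> nat \<lceil>real Q powr v\<rceil>" "real Q powr v \<le> real (nat \<lceil>real Q powr v\<rceil>)" by linarith+
  show "real (nat \<lceil>real Q powr v\<rceil>) \<le> 2 * real Q powr v" using Q assms(1) by linarith
qed

lemma denominator_pos:
  assumes "\<And>k. 1 \<le> v k"
  shows "1 \<le> denominator v k"
proof (induction k)
  case (Suc k)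
  have "1 \<le> nat \<lceil>real (denominator v k) powr v k\<rceil>"
    using le_ceiling_powr(1)[OF Suc assms, of k] Suc by linarith
  with Suc show ?case by (simp add: amplitude_def time_scale_def)
qed simp

lemma skew_parameters_denominator:
  assumes v: "\<And>k. 1 \<le> v k"
  shows "skew_parameters (denominator v) (\<lambda>k. amplitude k (denominator v k))
    (\<lambda>k. time_scale v k (denominator v k)) (\<lambda>k. k + 64)"
proof
  fix k
  note pos = denominator_pos[of v k, OF v]
  show "0 < amplitude k (denominator v k)" using pos by (simp add: amplitude_def)
  show "denominator v k * (k + 64) dvd amplitude k (denominator v k)"
    unfolding amplitude_def by (rule dvd_power) simp
  show "denominator v k * (k + 64) ^ 4 \<le> time_scale v k (denominator v k)"
    unfolding time_scale_def using le_ceiling_powr(1)[OF pos v] by (rule mult_right_mono) simp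
  show "filterlim (\<lambda>k. k + 64) at_top sequentially"
    by (rule filterlim_at_top_mono[OF filterlim_ident]) auto
qed simp_all

text \<open>The time exceeds \<open>Q powr v k\<close>, so the quotient is at most
  \<open>(k + 64) / Q powr \<delta>\<close>, and \<open>Q\<close> grows at least like
  \<open>2 ^ k\<close>.\<close>

lemma height_over_time:
  assumes v: "\<And>k. 1 \<le> v k" and t: "0 < t" and \<delta>: "0 < \<delta>" "eventually (\<lambda>k. 1 + \<delta> \<le> v k * t) sequentially"
  shows "(\<lambda>k. real (denominator v k * (k + 64)) / real (time_scale v k (denominator v k) div (k + 64) ^ 2) powr t) \<longlonglongrightarrow> 0"
proof -
  interpret skew_parameters "denominator v" "\<lambda>k. amplitude k (denominator v k)"
    "\<lambda>k. time_scale v k (denominator v k)" "\<lambda>k. k + 64"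
    by (rule skew_parameters_denominator) (rule v)
  have two: "2 ^ k \<le> denominator v k" for k
  proof (induction k)
    case (Suc k)
    then have "2 * 2 ^ k \<le> 2 * denominator v k" by simp
    also have "\<dots> \<le> denominator v (Suc k)" by (rule q_Suc_ge)
    finally show ?case by (simp only: power_Suc)
  qed simp
  have bound: "real (denominator v k * (k + 64)) / real (time_scale v k (denominator v k) div (k + 64) ^ 2) powr t
      \<le> (real k + 64) / (2 powr real k) powr \<delta>" if k: "1 + \<delta> \<le> v k * t" for k
  proof -
    let ?Q = "denominator v k"
    have Q: "1 \<le> ?Q" by (rule denominator_pos) (rule v)
    have "time_scale v k ?Q div (k + 64) ^ 2 = nat \<lceil>real ?Q powr v k\<rceil> * (k + 64) ^ 2"
    proof -
      have "time_scale v k ?Q = nat \<lceil>real ?Q powr v k\<rceil> * (k + 64) ^ 2 * (k + 64) ^ 2"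
        unfolding time_scale_def mult.assoc power_add[symmetric] by simp
      then show ?thesis by simp
    qed
    also have "real (nat \<lceil>real ?Q powr v k\<rceil> * (k + 64) ^ 2) \<ge> real ?Q powr v k"
    proof -
      have "nat \<lceil>real ?Q powr v k\<rceil> * 1 \<le> nat \<lceil>real ?Q powr v k\<rceil> * (k + 64) ^ 2"
        by (intro mult_left_mono) auto
      then show ?thesis using le_ceiling_powr(3)[OF Q v, of k] by linarith
    qed
    finally have "(real ?Q powr v k) powr t \<le> real (time_scale v k ?Q div (k + 64) ^ 2) powr t"
      using t by (intro powr_mono2) auto
    moreover have "real ?Q powr (1 + \<delta>) \<le> (real ?Q powr v k) powr t"
      unfolding powr_powr using k Q by (intro powr_mono) auto
    ultimately have "real ?Q powr (1 + \<delta>) \<le> real (time_scale v k ?Q div (k + 64) ^ 2) powr t" by linarith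
    then have "real (?Q * (k + 64)) / real (time_scale v k ?Q div (k + 64) ^ 2) powr t \<le> real (?Q * (k + 64)) / real ?Q powr (1 + \<delta>)"
      using Q by (intro frac_le) auto
    also have "\<dots> = (real k + 64) / real ?Q powr \<delta>" using Q by (simp add: powr_add)
    also have "\<dots> \<le> (real k + 64) / (2 powr real k) powr \<delta>"
    proof -
      have "2 powr real k \<le> real ?Q" using two[of k] by (simp add: powr_realpow)
      then have "(2 powr real k) powr \<delta> \<le> real ?Q powr \<delta>" using \<delta> by (intro powr_mono2) auto
      then show ?thesis by (intro frac_le) auto
    qed
    finally show ?thesis .
  qed
  have lim: "(\<lambda>k::nat. (real k + 64) / (2 powr real k) powr \<delta>) \<longlonglongrightarrow> 0"
    using \<delta>(1) by real_asymp
  show ?thesis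
    by (rule tendsto_sandwich[OF _ _ tendsto_const lim]) (use \<delta>(2) bound in \<open>auto elim!: eventually_mono\<close>)
qed

lemma time_scale_le_amplitude:
  assumes v: "1 \<le> v" and t: "0 < t" "t * v < 1"
  shows "eventually (\<lambda>k. real (time_scale (\<lambda>_. v) (Suc k) (denominator (\<lambda>_. v) (Suc k))) powr t
    \<le> amplitude k (denominator (\<lambda>_. v) k)) sequentially"
proof -
  \<comment> \<open>Let \<open>R = Q * (k + 64)\<close>. The amplitude is \<open>R\<close> to the
    power \<open>k + 1\<close>, the next denominator is at most \<open>R powr (k + 7 + v)\<close>,
    and the next time scale at most \<open>R\<close> to the power multiplied by \<open>t\<close>
    here. The coefficient of \<open>k\<close> on the left is \<open>t * v < 1\<close>.\<close>
  have "eventually (\<lambda>k. t * (9 + v * (real k + 7 + v)) \<le> real k + 1) sequentially"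
  proof -
    have "filterlim (\<lambda>k. (1 - t * v) * real k) at_top sequentially"
      using t by (intro filterlim_tendsto_pos_mult_at_top[OF tendsto_const] filterlim_real_sequentially) auto
    then have "eventually (\<lambda>k. t * 9 + t * v * (7 + v) - 1 \<le> (1 - t * v) * real k) sequentially"
      by (simp add: filterlim_at_top)
    then show ?thesis by eventually_elim (simp add: algebra_simps)
  qed
  then show ?thesis
  proof eventually_elim
    case (elim k)
    let ?v = "\<lambda>_::nat. v"
    define Q where "Q = denominator ?v k"
    define R where "R = real (Q * (k + 64))"
    define Q' where "Q' = denominator ?v (Suc k)"
    have Q: "1 \<le> Q" "1 \<le> Q'" unfolding Q_def Q'_def using v by (rule denominator_pos)+
    have "1 * 64 \<le> Q * (k + 64)" using Q by (intro mult_mono) auto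
    then have R: "64 \<le> R" unfolding R_def by linarith
    have QR: "real Q \<le> R" and rR: "real k + 64 \<le> R"
      unfolding R_def using Q by (auto simp: mult_le_cancel_left1 mult_le_cancel_right1)
    have R_pow: "R ^ n = R powr real n" for n using R by (simp add: powr_realpow)
    have ts: "real (time_scale ?v j P) \<le> R * P powr v * (real j + 64) ^ 4" if "1 \<le> P" for j P
    proof -
      have "real (time_scale ?v j P) \<le> 2 * real P powr v * (real j + 64) ^ 4"
        unfolding time_scale_def using le_ceiling_powr(2)[OF that v] by (simp add: mult_right_mono)
      also have "\<dots> \<le> R * P powr v * (real j + 64) ^ 4" using R by (intro mult_right_mono) auto
      finally show ?thesis .
    qed
    have "real (time_scale ?v k Q) \<le> R * R powr v * R ^ 4"
      using v QR rR R by (intro order_trans[OF ts[OF Q(1)]] mult_mono powr_mono2 power_mono) auto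
    also have "\<dots> = R powr 1 * R powr v * R powr 4" using R R_pow[of 4] by simp
    also have "\<dots> = R powr (1 + v + 4)" by (simp only: powr_add)
    also have "1 + v + 4 = v + 5" by simp
    finally have N: "real (time_scale ?v k Q) \<le> R powr (v + 5)" .
    have A: "real (amplitude k Q) = R powr (real k + 1)"
      using R_pow[of "k + 1"] by (simp add: amplitude_def R_def add.commute)
    have "real Q' = Q * (real (amplitude k Q) * real (time_scale ?v k Q))" by (simp add: Q'_def Q_def)
    also have "\<dots> \<le> R * (R powr (real k + 1) * R powr (v + 5))"
      unfolding A using QR N R by (intro mult_mono) auto
    also have "\<dots> = R powr 1 * (R powr (real k + 1) * R powr (v + 5))" using R by simp
    also have "\<dots> = R powr (1 + (real k + 1 + (v + 5)))" by (simp only: powr_add)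
    also have "1 + (real k + 1 + (v + 5)) = real k + 7 + v" by simp
    finally have Q': "real Q' \<le> R powr (real k + 7 + v)" .
    have "real (Suc k) + 64 \<le> 2 * (real k + 64)" by simp
    also have "\<dots> \<le> R * R" using R rR by (intro mult_mono) auto
    finally have r': "(real (Suc k) + 64) ^ 4 \<le> (R * R) ^ 4" by (intro power_mono) auto
    have "real (time_scale ?v (Suc k) Q') \<le> R * (R powr (real k + 7 + v)) powr v * (R * R) ^ 4"
      using v Q' r' R by (intro order_trans[OF ts[OF Q(2)]] mult_mono powr_mono2) auto
    also have "(R * R) ^ 4 = R powr 8"
      using R_pow[of 8] by (simp add: power_mult_distrib power_add[symmetric])
    also have "R * (R powr (real k + 7 + v)) powr v * R powr 8 = R powr 1 * R powr ((real k + 7 + v) * v) * R powr 8"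
      using R by (simp add: powr_powr)
    also have "\<dots> = R powr (1 + (real k + 7 + v) * v + 8)" by (simp only: powr_add)
    also have "1 + (real k + 7 + v) * v + 8 = 9 + v * (real k + 7 + v)" by simp
    finally have "real (time_scale ?v (Suc k) Q') powr t \<le> (R powr (9 + v * (real k + 7 + v))) powr t"
      using t by (intro powr_mono2) auto
    also have "\<dots> = R powr (t * (9 + v * (real k + 7 + v)))" by (simp add: powr_powr mult.commute)
    also have "\<dots> \<le> R powr (real k + 1)" using elim R by (intro powr_mono) auto
    finally show ?case unfolding A[symmetric] Q_def Q'_def .
  qed
qed

subsection \<open>The disc\<close>

definition semicircle :: "real \<Rightarrow> real" where
  "semicircle x = sqrt (max 0 (1 - x\<^sup>2))"

text \<open>\<open>semicircle\<close> is extended by 0 and the integral starts at -2, so that the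
  derivative is two-sided at both ends of \<open>{-1..1}\<close>.\<close>

definition half_area :: "real \<Rightarrow> real" where
  "half_area x = integral {-2..x} semicircle"

definition area_fraction :: "real \<Rightarrow> real" where
  "area_fraction x = half_area x / half_area 1"

lemma continuous_semicircle: "continuous_on D semicircle"
  unfolding semicircle_def[abs_def] by (intro continuous_intros)

lemma semicircle_nonneg [simp]: "0 \<le> semicircle x"
  by (simp add: semicircle_def)

lemma semicircle_pos_iff: "0 < semicircle x \<longleftrightarrow> x \<in> {-1<..<1}"
  by (auto simp: semicircle_def abs_square_less_1 less_max_iff_disj abs_less_iff)

lemma semicircle_eq_0: "x \<notin> {-1<..<1} \<Longrightarrow> semicircle x = 0"
  using semicircle_pos_iff[of x] semicircle_nonneg[of x] by linarith

lemma borel_measurable_semicircle [measurable]: "semicircle \<in> borel_measurable borel"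
  by (intro borel_measurable_continuous_onI continuous_semicircle)

lemma mem_disc_iff: "(x, y) \<in> disc \<longleftrightarrow> \<bar>x\<bar> \<le> 1 \<and> \<bar>y\<bar> \<le> semicircle x"
proof -
  have "(x, y) \<in> disc \<longleftrightarrow> x\<^sup>2 + y\<^sup>2 \<le> 1"
    by (simp add: disc_def dist_norm norm_Pair)
  also have "\<dots> \<longleftrightarrow> x\<^sup>2 \<le> 1 \<and> y\<^sup>2 \<le> max 0 (1 - x\<^sup>2)"
    using zero_le_power2[of y] by (smt (verit))
  also have "\<dots> \<longleftrightarrow> \<bar>x\<bar> \<le> 1 \<and> \<bar>y\<bar> \<le> semicircle x"
  proof -
    have "\<bar>y\<bar> \<le> sqrt c \<longleftrightarrow> y\<^sup>2 \<le> c" for c by (metis real_sqrt_abs real_sqrt_le_iff)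
    then show ?thesis unfolding semicircle_def by (simp only: abs_square_le_1)
  qed
  finally show ?thesis .
qed

lemma half_area_deriv:
  assumes "x \<in> {-2<..<2}"
  shows "(half_area has_real_derivative semicircle x) (at x)"
proof -
  have "((\<lambda>x. integral {-2..x} semicircle) has_real_derivative semicircle x) (at x within {-2..2})"
    using assms by (intro integral_has_real_derivative continuous_semicircle) auto
  moreover have "at x within {-2..2} = at x" using assms by (intro at_within_interior) auto
  ultimately show ?thesis by (simp add: half_area_def[abs_def])
qed

lemma continuous_half_area: "continuous_on {-1..1} half_area"
  by (rule DERIV_continuous_on[where D=semicircle]) (auto intro!: has_field_derivative_at_within half_area_deriv)

lemma half_area_minus_1: "half_area (-1) = 0"
  unfolding half_area_def by (subst integral_cong[where g="\<lambda>_. 0"]) (auto intro: semicircle_eq_0)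

lemma half_area_strict_mono:
  assumes "-1 \<le> x" "x < y" "y \<le> 1"
  shows "half_area x < half_area y"
proof (rule DERIV_pos_imp_increasing_open[OF assms(2)])
  show "\<exists>d. (half_area has_real_derivative d) (at z) \<and> 0 < d" if "x < z" "z < y" for z
    using that assms semicircle_pos_iff[of z] by (intro exI[of _ "semicircle z"] conjI half_area_deriv) auto
  show "continuous_on {x..y} half_area"
    using continuous_half_area by (rule continuous_on_subset) (use assms in auto)
qed

lemma half_area_1_pos: "0 < half_area 1"
  using half_area_strict_mono[of "-1" 1] half_area_minus_1 by simp

lemma area_fraction_deriv:
  "x \<in> {-1..1} \<Longrightarrow> (area_fraction has_real_derivative semicircle x / half_area 1) (at x)"
  unfolding area_fraction_def[abs_def] by (intro DERIV_cdivide half_area_deriv) auto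

lemma continuous_area_fraction: "continuous_on {-1..1} area_fraction"
  unfolding area_fraction_def[abs_def] by (intro continuous_intros continuous_half_area) (use half_area_1_pos in auto)

lemma area_fraction_ends: "area_fraction (-1) = 0" "area_fraction 1 = 1"
  using half_area_1_pos by (auto simp: area_fraction_def half_area_minus_1)

lemma area_fraction_strict_mono:
  "-1 \<le> x \<Longrightarrow> x < y \<Longrightarrow> y \<le> 1 \<Longrightarrow> area_fraction x < area_fraction y"
  unfolding area_fraction_def using half_area_strict_mono half_area_1_pos by (auto intro: divide_strict_right_mono)

lemma area_fraction_bij: "bij_betw area_fraction {-1..1} {0..1}"
proof -
  have "inj_on area_fraction {-1..1}"
    by (rule linorder_inj_onI) (use area_fraction_strict_mono in force)+
  moreover have "area_fraction ` {-1..1} = {0..1}"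
  proof
    show "area_fraction ` {-1..1} \<subseteq> {0..1}"
    proof
      fix s assume "s \<in> area_fraction ` {-1..1}"
      then obtain x where x: "-1 \<le> x" "x \<le> 1" "s = area_fraction x" by auto
      have "area_fraction (-1) \<le> area_fraction x" "area_fraction x \<le> area_fraction 1"
        using area_fraction_strict_mono[of "-1" x] area_fraction_strict_mono[of x 1] x by (auto simp: le_less)
      then show "s \<in> {0..1}" using x by (simp add: area_fraction_ends)
    qed
    show "{0..1} \<subseteq> area_fraction ` {-1..1}"
    proof
      fix s :: real assume "s \<in> {0..1}"
      then obtain x where "-1 \<le> x" "x \<le> 1" "area_fraction x = s"
        using IVT'[of area_fraction "-1" s 1] continuous_area_fraction by (auto simp: area_fraction_ends)
      then show "s \<in> area_fraction ` {-1..1}" by auto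
    qed
  qed
  ultimately show ?thesis by (simp add: bij_betw_def)
qed

text \<open>Substitution \<open>s = area_fraction x\<close>: its derivative is the chord length up
  to a constant, so the first coordinate of a random point of the disc becomes uniform on the unit
  interval.\<close>

lemma nn_integral_area_fraction:
  assumes h [measurable]: "h \<in> borel_measurable borel" and nonneg: "\<And>s. 0 \<le> h s"
  shows "(\<integral>\<^sup>+x. ennreal (2 * semicircle x) * ennreal (h (area_fraction x)) * indicator {-1..1} x \<partial>lborel) =
    ennreal (2 * half_area 1) * (\<integral>\<^sup>+s. ennreal (h s) * indicator {0..1} s \<partial>lborel)"
proof -
  let ?C = "half_area 1"
  have "(\<integral>\<^sup>+s. ennreal (h s) * indicator {0..1} s \<partial>lborel) =
      (\<integral>\<^sup>+s. h s * indicator {area_fraction (-1)..area_fraction 1} s \<partial>lborel)"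
    by (intro nn_integral_cong) (auto simp: area_fraction_ends indicator_def)
  also have "\<dots> = (\<integral>\<^sup>+x. h (area_fraction x) * (semicircle x / ?C) * indicator {-1..1} x \<partial>lborel)"
  proof (rule nn_integral_substitution)
    show "set_borel_measurable borel {area_fraction (- 1)..area_fraction 1} h"
      unfolding set_borel_measurable_def by measurable
    show "continuous_on {-1..1} (\<lambda>x. semicircle x / ?C)"
      using half_area_1_pos by (intro continuous_intros continuous_semicircle) auto
  qed (use area_fraction_deriv half_area_1_pos in auto)
  finally have eq: "(\<integral>\<^sup>+s. ennreal (h s) * indicator {0..1} s \<partial>lborel) =
      (\<integral>\<^sup>+x. h (area_fraction x) * (semicircle x / ?C) * indicator {-1..1} x \<partial>lborel)" .
  \<comment> \<open>Continuity of \<open>area_fraction\<close> is available on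
    \<open>{-1..1}\<close> only, so measurability is obtained for its truncation.\<close>
  have fm: "(\<lambda>x. area_fraction x * indicator {-1..1} x) \<in> borel_measurable borel"
    using borel_measurable_continuous_on_indicator[OF _ continuous_area_fraction] by (simp add: mult.commute)
  have "(\<lambda>x. h (area_fraction x * indicator {-1..1} x) * (semicircle x / ?C) * indicator {-1..1} x) \<in> borel_measurable borel"
    using measurable_compose[OF fm h] by measurable
  also have "(\<lambda>x. h (area_fraction x * indicator {-1..1} x) * (semicircle x / ?C) * indicator {-1..1} x) =
      (\<lambda>x. h (area_fraction x) * (semicircle x / ?C) * indicator {-1..1} x)"
    by (auto simp: indicator_def)
  finally have meas: "(\<lambda>x. h (area_fraction x) * (semicircle x / ?C) * indicator {-1..1} x) \<in> borel_measurable borel" .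
  have "(\<integral>\<^sup>+x. ennreal (2 * semicircle x) * ennreal (h (area_fraction x)) * indicator {-1..1} x \<partial>lborel) =
      (\<integral>\<^sup>+x. ennreal (2 * ?C) * ennreal (h (area_fraction x) * (semicircle x / ?C) * indicator {-1..1} x) \<partial>lborel)"
  proof (intro nn_integral_cong)
    fix x :: real
    have "2 * semicircle x * h (area_fraction x) = 2 * ?C * (h (area_fraction x) * (semicircle x / ?C))"
      using half_area_1_pos by simp
    then show "ennreal (2 * semicircle x) * ennreal (h (area_fraction x)) * indicator {-1..1} x =
        ennreal (2 * ?C) * ennreal (h (area_fraction x) * (semicircle x / ?C) * indicator {-1..1} x)"
      using nonneg half_area_1_pos by (simp add: indicator_def ennreal_mult'[symmetric])
  qed
  also have "\<dots> = ennreal (2 * ?C) * (\<integral>\<^sup>+s. ennreal (h s) * indicator {0..1} s \<partial>lborel)"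
    unfolding eq using meas by (intro nn_integral_cmult) simp
  finally show ?thesis .
qed

lemma emeasure_affine_preimage:
  assumes [measurable]: "D \<in> sets borel" and c: "0 < c"
  shows "emeasure lborel {y. (y / c + 1) / 2 \<in> D} = ennreal (2 * c) * emeasure lborel D"
proof -
  have D': "{y. (y / c + 1) / 2 \<in> D} \<in> sets borel"
  proof -
    have "(\<lambda>y. (y / c + 1) / 2) \<in> borel \<rightarrow>\<^sub>M (borel :: real measure)" by measurable
    from measurable_sets_borel[OF this assms(1)] show ?thesis by (simp add: vimage_def)
  qed
  have "emeasure lborel {y. (y / c + 1) / 2 \<in> D} = (\<integral>\<^sup>+y. indicator {y. (y / c + 1) / 2 \<in> D} y \<partial>lborel)"
    using D' by simp
  also have "\<dots> = ennreal \<bar>2 * c\<bar> * (\<integral>\<^sup>+t. indicator {y. (y / c + 1) / 2 \<in> D} (- c + 2 * c * t) \<partial>lborel)"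
    using D' c by (intro nn_integral_real_affine) auto
  also have "(\<lambda>t. indicator {y. (y / c + 1) / 2 \<in> D} (- c + 2 * c * t)) = (indicator D :: real \<Rightarrow> ennreal)"
  proof
    fix t
    have "((- c + 2 * c * t) / c + 1) / 2 = t" using c by (simp add: field_simps)
    then show "indicator {y. (y / c + 1) / 2 \<in> D} (- c + 2 * c * t) = (indicator D t :: ennreal)"
      by (simp add: indicator_def)
  qed
  finally show ?thesis using c by simp
qed

lemma disc_borel: "disc \<in> sets borel"
  unfolding disc_def by simp

lemma emeasure_disc: "emeasure lborel disc = ennreal (2 * half_area 1)"
proof -
  have "emeasure lborel disc = (\<integral>\<^sup>+x. emeasure lborel {y. (x, y) \<in> disc} \<partial>lborel)"
    by (rule emeasure_lborel_pair(1)) (rule disc_borel)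
  also have "\<dots> = (\<integral>\<^sup>+x. ennreal (2 * semicircle x) * ennreal 1 * indicator {-1..1} x \<partial>lborel)"
  proof (intro nn_integral_cong)
    fix x :: real
    have "{y. (x, y) \<in> disc} = (if x \<in> {-1..1} then {- semicircle x..semicircle x} else {})"
      by (auto simp: mem_disc_iff abs_le_iff)
    then show "emeasure lborel {y. (x, y) \<in> disc} = ennreal (2 * semicircle x) * ennreal 1 * indicator {-1..1} x"
      by auto
  qed
  also have "\<dots> = ennreal (2 * half_area 1) * (\<integral>\<^sup>+s. ennreal 1 * indicator {0..1::real} s \<partial>lborel)"
    by (rule nn_integral_area_fraction[of "\<lambda>_. 1"]) auto
  also have "(\<integral>\<^sup>+s. ennreal 1 * indicator {0..1::real} s \<partial>lborel) = 1" by simp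
  finally show ?thesis by simp
qed

text \<open>The first coordinate becomes the fraction of area to the left, the second the relative
  height on the vertical chord. The chord length cancels in the Jacobian, which is the constant
  \<open>1 / (2 * half_area 1)\<close>.\<close>

definition disc_to_torus :: "real \<times> real \<Rightarrow> real \<times> real" where
  "disc_to_torus z = (if fst z \<in> {-1<..<1} then (area_fraction (fst z), (snd z / semicircle (fst z) + 1) / 2) else (0, 0))"

definition torus_to_disc :: "real \<times> real \<Rightarrow> real \<times> real" where
  "torus_to_disc w =
    (let x = (if fst w \<in> {0..1} then the_inv_into {-1..1} area_fraction (fst w) else 0)
     in (x, (2 * snd w - 1) * semicircle x))"

lemma area_fraction_inverse:
  assumes "x \<in> {-1..1}" shows "the_inv_into {-1..1} area_fraction (area_fraction x) = x"
  using area_fraction_bij assms by (simp add: bij_betw_def the_inv_into_f_f)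

lemma area_fraction_open: "x \<in> {-1<..<1} \<Longrightarrow> area_fraction x \<in> {0<..<1}"
  using area_fraction_strict_mono[of "-1" x] area_fraction_strict_mono[of x 1] by (simp add: area_fraction_ends)

lemma area_fraction_inverse_open:
  assumes "s \<in> {0<..<1}"
  obtains x where "x \<in> {-1<..<1}" "area_fraction x = s" "the_inv_into {-1..1} area_fraction s = x"
proof -
  obtain x where x: "x \<in> {-1..1}" "area_fraction x = s"
    using area_fraction_bij assms unfolding bij_betw_def by (metis atLeastAtMost_iff greaterThanLessThan_iff imageE less_imp_le)
  have "x \<noteq> -1" "x \<noteq> 1" using x assms area_fraction_ends by auto
  with x show thesis using that[of x] area_fraction_inverse[of x] by auto
qed

lemma measurable_disc_to_torus [measurable]: "disc_to_torus \<in> borel \<rightarrow>\<^sub>M borel"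
proof -
  have [measurable]: "(\<lambda>x. indicator {-1<..<1} x *\<^sub>R area_fraction x) \<in> borel_measurable borel"
    by (rule borel_measurable_continuous_on_indicator) (auto intro: continuous_on_subset[OF continuous_area_fraction])
  have "disc_to_torus = (\<lambda>z. if fst z \<in> {-1<..<1} then (indicator {-1<..<1} (fst z) *\<^sub>R area_fraction (fst z),
      (snd z / semicircle (fst z) + 1) / 2) else (0, 0))"
    by (auto simp: disc_to_torus_def)
  also have "\<dots> \<in> borel \<rightarrow>\<^sub>M borel" unfolding borel_prod[symmetric] by measurable
  finally show ?thesis .
qed

lemma measurable_torus_to_disc [measurable]: "torus_to_disc \<in> borel \<rightarrow>\<^sub>M borel"
proof -
  let ?g = "the_inv_into {-1..1} area_fraction"
  have "continuous_on (area_fraction ` {-1..1}) ?g"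
    by (rule continuous_on_inv) (use continuous_area_fraction area_fraction_inverse in auto)
  then have "continuous_on {0..1} ?g" using area_fraction_bij by (simp add: bij_betw_def)
  then have "(\<lambda>s. indicator {0..1} s *\<^sub>R ?g s) \<in> borel_measurable borel"
    by (intro borel_measurable_continuous_on_indicator) auto
  also have "(\<lambda>s. indicator {0..1} s *\<^sub>R ?g s) = (\<lambda>s. if s \<in> {0..1} then ?g s else 0)"
    by (auto simp: indicator_def)
  finally have [measurable]: "(\<lambda>s. if s \<in> {0..1} then ?g s else 0) \<in> borel_measurable borel" .
  define G where "G s = (if s \<in> {0..1} then ?g s else 0)" for s
  have [measurable]: "G \<in> borel_measurable borel" unfolding G_def[abs_def] by fact
  have "torus_to_disc = (\<lambda>w. (G (fst w), (2 * snd w - 1) * semicircle (G (fst w))))"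
    by (auto simp: torus_to_disc_def G_def Let_def)
  also have "\<dots> \<in> borel \<rightarrow>\<^sub>M borel" unfolding borel_prod[symmetric] by measurable
  finally show ?thesis .
qed

text \<open>Whatever is mapped into the half-open square lies in the disc and returns to itself;
  hence the set in the area condition of a chart is a plain preimage.\<close>

lemma disc_round_trip:
  assumes z: "disc_to_torus z \<in> {0<..<1} \<times> {0..<1}"
  shows "fst z \<in> {-1<..<1}" "z \<in> disc" "torus_to_disc (disc_to_torus z) = z"
proof -
  show x: "fst z \<in> {-1<..<1}" using z by (auto simp: disc_to_torus_def split: if_splits)
  define x y where "x = fst z" and "y = snd z"
  have zxy: "z = (x, y)" by (simp add: x_def y_def)
  have pos: "0 < semicircle x" using x semicircle_pos_iff by (simp add: x_def)
  have t: "0 \<le> (y / semicircle x + 1) / 2" "(y / semicircle x + 1) / 2 < 1"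
    using z x by (auto simp: disc_to_torus_def zxy)
  then have "- 1 \<le> y / semicircle x" "y / semicircle x \<le> 1" by auto
  then have "- semicircle x \<le> y" "y \<le> semicircle x" using pos by (simp_all add: field_simps)
  then show "z \<in> disc" using x by (auto simp: zxy mem_disc_iff)
  have "(2 * ((y / semicircle x + 1) / 2) - 1) * semicircle x = y" using pos by (simp add: field_simps)
  then show "torus_to_disc (disc_to_torus z) = z"
    using x area_fraction_open[of x] area_fraction_inverse[of x]
    by (simp add: disc_to_torus_def torus_to_disc_def zxy Let_def less_imp_le)
qed

lemma chart_disc: "chart disc disc_to_torus torus_to_disc"
proof
  show "disc \<in> sets borel" by (rule disc_borel)
  show "emeasure lborel disc \<noteq> 0" "emeasure lborel disc \<noteq> top"
    using half_area_1_pos by (auto simp: emeasure_disc)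
next
  fix w :: "real \<times> real" assume w: "w \<in> {0<..<1} \<times> {0..<1}"
  then have "fst w \<in> {0<..<1}" by auto
  then obtain x where x: "x \<in> {-1<..<1}" "area_fraction x = fst w" "the_inv_into {-1..1} area_fraction (fst w) = x"
    by (rule area_fraction_inverse_open)
  have pos: "0 < semicircle x" using x semicircle_pos_iff by simp
  have td: "torus_to_disc w = (x, (2 * snd w - 1) * semicircle x)"
    using w x(3) by (auto simp: torus_to_disc_def Let_def)
  have "disc_to_torus (torus_to_disc w) = (fst w, snd w)"
    unfolding td using x pos by (simp add: disc_to_torus_def)
  then show "disc_to_torus (torus_to_disc w) = w" by simp
  with disc_round_trip(2)[of "torus_to_disc w"] w show "torus_to_disc w \<in> disc" by simp
next
  fix B :: "(real \<times> real) set" assume B [measurable]: "B \<in> sets borel" and sub: "B \<subseteq> {0<..<1} \<times> {0..<1}"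
  define h where "h s = measure lborel {t. (s, t) \<in> B}" for s
  have sec: "{t. (s, t) \<in> B} \<in> sets borel" for s
  proof -
    have "(\<lambda>t. (s, t)) \<in> borel \<rightarrow>\<^sub>M (borel :: (real \<times> real) measure)"
      unfolding borel_prod[symmetric] by measurable
    from measurable_sets_borel[OF this B] show ?thesis by (simp add: vimage_def)
  qed
  have fin: "emeasure lborel {t. (s, t) \<in> B} = ennreal (h s)" for s
  proof -
    have "emeasure lborel {t. (s, t) \<in> B} \<le> emeasure lborel {0..1::real}"
      using sub by (intro emeasure_mono) auto
    then have "emeasure lborel {t. (s, t) \<in> B} \<noteq> top" by (auto simp: top_unique)
    then show ?thesis unfolding h_def by (rule emeasure_eq_ennreal_measure)
  qed
  have h_meas: "h \<in> borel_measurable borel"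
    unfolding h_def[abs_def] measure_def using emeasure_lborel_pair(2)[OF B] by measurable
  let ?D = "{z \<in> disc. disc_to_torus z \<in> B \<and> torus_to_disc (disc_to_torus z) = z}"
  have D_eq: "?D = disc_to_torus -` B" using disc_round_trip(2,3)[OF subsetD[OF sub]] by blast
  have "?D \<in> sets borel" unfolding D_eq by (rule measurable_sets_borel[OF measurable_disc_to_torus B])
  then have "emeasure lborel ?D = (\<integral>\<^sup>+x. emeasure lborel {y. (x, y) \<in> ?D} \<partial>lborel)"
    by (rule emeasure_lborel_pair(1))
  also have "\<dots> = (\<integral>\<^sup>+x. ennreal (2 * semicircle x) * ennreal (h (area_fraction x)) * indicator {-1..1} x \<partial>lborel)"
  proof (intro nn_integral_cong)
    fix x :: real
    show "emeasure lborel {y. (x, y) \<in> ?D} = ennreal (2 * semicircle x) * ennreal (h (area_fraction x)) * indicator {-1..1} x"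
    proof (cases "x \<in> {-1<..<1}")
      case True
      have "{y. (x, y) \<in> ?D} = {y. (y / semicircle x + 1) / 2 \<in> {t. (area_fraction x, t) \<in> B}}"
        unfolding D_eq using True by (auto simp: disc_to_torus_def)
      then have "emeasure lborel {y. (x, y) \<in> ?D} = ennreal (2 * semicircle x) * ennreal (h (area_fraction x))"
        using emeasure_affine_preimage[OF sec, of "semicircle x"] True semicircle_pos_iff[of x] fin by simp
      with True show ?thesis by (simp add: less_imp_le)
    next
      case False
      then have "{y. (x, y) \<in> ?D} = {}" unfolding D_eq using sub by (auto simp: disc_to_torus_def)
      with False show ?thesis by (simp only: emeasure_empty) (simp add: semicircle_eq_0)
    qed
  qed
  also have "\<dots> = ennreal (2 * half_area 1) * (\<integral>\<^sup>+s. ennreal (h s) * indicator {0..1} s \<partial>lborel)"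
    by (rule nn_integral_area_fraction[OF h_meas]) (simp add: h_def)
  also have "(\<integral>\<^sup>+s. ennreal (h s) * indicator {0..1} s \<partial>lborel) = (\<integral>\<^sup>+s. emeasure lborel {t. (s, t) \<in> B} \<partial>lborel)"
  proof (intro nn_integral_cong)
    fix s :: real
    have "s \<notin> {0..1} \<Longrightarrow> {t. (s, t) \<in> B} = {}" using sub by auto
    then show "ennreal (h s) * indicator {0..1} s = emeasure lborel {t. (s, t) \<in> B}"
      by (cases "s \<in> {0..1}") (auto simp: fin h_def)
  qed
  also have "\<dots> = emeasure lborel B" by (rule emeasure_lborel_pair(1)[symmetric]) simp
  finally show "emeasure lborel ?D = emeasure lborel B * emeasure lborel disc"
    by (simp add: emeasure_disc mult.commute)
qed (rule measurable_disc_to_torus measurable_torus_to_disc)+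

subsection \<open>The theorem\<close>

text \<open>Serves the torus and the annulus, which both have area 1 and contain this half-open
  square; the lines in which they differ stay outside the chart.\<close>

lemma chart_id:
  assumes X: "X \<in> sets borel" "emeasure lborel X = 1" "{0<..<1} \<times> {0..<1} \<subseteq> X"
  shows "chart X (\<lambda>z. z) (\<lambda>z. z)"
proof
  fix B :: "(real \<times> real) set" assume B: "B \<subseteq> {0<..<1} \<times> {0..<1}"
  then have "{z \<in> X. z \<in> B \<and> z = z} = B" using X(3) by auto
  then show "emeasure lborel {z \<in> X. z \<in> B \<and> z = z} = emeasure lborel B * emeasure lborel X"
    by (simp only: X(2) mult_1_right)
qed (use X in auto)

lemma chart_torus: "chart torus (\<lambda>z. z) (\<lambda>z. z)"
  by (rule chart_id) (auto simp: torus_def[symmetric], auto simp: torus_def)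

lemma chart_annulus: "chart annulus (\<lambda>z. z) (\<lambda>z. z)"
proof (rule chart_id)
  show "annulus \<in> sets borel" unfolding annulus_def borel_prod[symmetric] by measurable
  show "emeasure lborel annulus = 1" unfolding annulus_def by (subst emeasure_lborel_Times) auto
qed (auto simp: annulus_def)

theorem theorem1p5:
  fixes u :: real and X :: "(real \<times> real) set"
  assumes "u \<in> {0..1}" and "X \<in> {torus, disc, annulus}"
  shows "\<exists>T. invertible_measure_preserving (normalized_lebesgue X) T \<and>
             good_cyclic_approximation (normalized_lebesgue X) T \<and>
             lower_slow_entropy (normalized_lebesgue X) (\<lambda>n t. real n powr t) T = ereal u"
proof -
  obtain \<phi> \<psi> where "chart X \<phi> \<psi>"
    using assms(2) chart_torus chart_annulus chart_disc by auto
  \<comment> \<open>The time scale is the height to the power \<open>1 / u\<close>; this exponent is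
    at least 1, as the parameters demand, because \<open>u \<le> 1\<close>. For \<open>u = 0\<close>
    exponents tending to infinity make the height smaller than every positive power of the
    time.\<close>
  define v where "v k = (if u = 0 then real k + 1 else 1 / u)" for k :: nat
  have v: "1 \<le> v k" for k using assms(1) by (auto simp: v_def field_simps)
  interpret transported_skew X \<phi> \<psi> "denominator v" "\<lambda>k. amplitude k (denominator v k)"
    "\<lambda>k. time_scale v k (denominator v k)" "\<lambda>k. k + 64"
    using \<open>chart X \<phi> \<psi>\<close> skew_parameters_denominator[OF v] by (simp add: transported_skew_def)
  have "lower_slow_entropy M (\<lambda>n t. real n powr t) \<tau> \<le> ereal u"
  proof (rule lower_slow_entropy_\<tau>_le)
    fix t assume t: "u < t"
    have "\<exists>\<delta>>0. eventually (\<lambda>k. 1 + \<delta> \<le> v k * t) sequentially"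
    proof (cases "u = 0")
      case True
      then have "eventually (\<lambda>k. 2 / t \<le> real k) sequentially"
        using filterlim_real_sequentially unfolding filterlim_at_top by blast
      then have "eventually (\<lambda>k. 1 + 1 \<le> v k * t) sequentially"
      proof eventually_elim
        case (elim k)
        have "0 < t" using t True by simp
        then have "2 \<le> real k * t" using elim by (simp add: field_simps)
        then show ?case using \<open>0 < t\<close> True by (simp add: v_def algebra_simps)
      qed
      then show ?thesis by (intro exI[of _ 1]) auto
    next
      case False
      then show ?thesis using t assms(1) by (intro exI[of _ "t / u - 1"]) (auto simp: v_def)
    qed
    then obtain \<delta> where "\<delta> > 0" "eventually (\<lambda>k. 1 + \<delta> \<le> v k * t) sequentially" by auto
    moreover have "0 < t" using t assms(1) by simp
    ultimately show "(\<lambda>k. real (height k) / real (time_scale v k (denominator v k) div (k + 64) ^ 2) powr t) \<longlonglongrightarrow> 0"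
      unfolding height_def using v by (intro height_over_time)
  qed (use assms(1) in simp)
  moreover have "ereal u \<le> lower_slow_entropy M (\<lambda>n t. real n powr t) \<tau>"
  proof (rule le_lower_slow_entropy_\<tau>)
    fix t assume t: "0 < t" "t < u"
    \<comment> \<open>An exponent strictly between 0 and \<open>u\<close> exists only for
      \<open>u > 0\<close>, where the sequence \<open>v\<close> is constant.\<close>
    then have "v = (\<lambda>_. 1 / u)" by (auto simp: v_def)
    moreover have "1 \<le> 1 / u" "t * (1 / u) < 1" using t assms(1) by auto
    ultimately show "eventually (\<lambda>k. real (time_scale v (Suc k) (denominator v (Suc k))) powr t
        \<le> amplitude k (denominator v k)) sequentially"
      using time_scale_le_amplitude[of "1 / u" t] t(1) by simp
  qed (use assms(1) in simp)
  ultimately have "lower_slow_entropy M (\<lambda>n t. real n powr t) \<tau> = ereal u" by (rule antisym)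
  with invertible_\<tau> good_cyclic_approximation_\<tau> show ?thesis by blast
qed

end
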